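(* Let $R$ be a reduced root system of type $\mathsf{R}$ and rank $n$, with Weyl group $W(R)$. The following properties are equivalent: (i) there is a number field $K$ of degree $n$ over $\mathbb{Q}$ such that $W(R)$ is isomorphic to a subgroup $G$ of the group $\mathcal{L}(K)$; (ii) $\mathsf{R}$ is contained in the following list: $$\mathsf{A}_1,\quad \mathsf{A}_2,\quad \mathsf{B}_2,\quad \mathsf{G}_2,\quad 2\mathsf{A}_1,\quad 2\mathsf{A}_1\dot{+}\mathsf{A}_2,\quad \mathsf{A}_2\dot{+}\mathsf{B}_2.$$
   Context: A number field is an extension of finite degree of the field $\mathbb{Q}$ (the field $\mathbb{Q}$ itself is allowed). For a number field $K$, $\mathrm{GL}_{\mathbb{Q}}(K)$ is the group of nondegenerate $\mathbb{Q}$-linear transformations of $K$ viewed as a $\mathbb{Q}$-vector space; $\mathrm{Aut}(K)$ is the automorphism group of the field $K$, viewed as a subgroup of $\mathrm{GL}_{\mathbb{Q}}(K)$; for $a\in K^*$, $\mathrm{mult}(a)\in \mathrm{GL}_{\mathbb{Q}}(K)$ is the operator $x\mapsto ax$. The group $\mathcal{L}(K)$ is the subgroup of $\mathrm{GL}_{\mathbb{Q}}(K)$ generated by $\mathrm{Aut}(K)$ and $\mathrm{mult}(K^* )=\{\mathrm{mult}(a)\mid a\in K^*\}$. The type of a root system is the type of its Dynkin diagram (so $\mathsf{B}_2=\mathsf{C}_2$); $\dot{+}$ denotes the type of the direct sum of root systems, and $m\mathsf{R}$ is the type of the direct sum of $m$ copies of a root system of type $\mathsf{R}$. Ranks are positive.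 *)

theory Defs
  imports "HOL-Analysis.Analysis" "HOL-Algebra.Algebra" "HOL-Algebra.Algebraic_Closure_Type"
begin

section \<open>Number fields\<close>

text \<open>Number fields are ring structures with carrier in an arbitrary type. Since a formula cannot
  quantify over types, the existence of a number field with some isomorphism-invariant property is
  stated as its existence with carrier in a given infinite type; no generality is lost, as number
  fields are countably infinite and so have isomorphic copies in every infinite type.\<close>

text \<open>The canonical map from the rationals to a field: \<open>a / b\<close> goes to \<open>(a \<cdot> 1) (b \<cdot> 1)\<^sup>-\<^sup>1\<close>.
  It is a ring homomorphism precisely when the field has characteristic 0, and then it is the only
  one, so that the field is an extension of the rationals in exactly one way.\<close>

definition rat_emb :: "('k, 'm) ring_scheme \<Rightarrow> rat \<Rightarrow> 'k" where
  "rat_emb K q = (case quotient_of q of (a, b) \<Rightarrow>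
     add_pow K a \<one>\<^bsub>K\<^esub> \<otimes>\<^bsub>K\<^esub> m_inv K (add_pow K b \<one>\<^bsub>K\<^esub>))"

abbreviation rat_subfield :: "('k, 'm) ring_scheme \<Rightarrow> 'k set" where
  "rat_subfield K \<equiv> range (rat_emb K)"

locale number_field = field K for K (structure) +
  assumes rat_emb_hom: "rat_emb K \<in> ring_hom (ring_of_type_algebra :: rat ring) K"
    and finite_degree: "ring.finite_dimension K (rat_subfield K) (carrier K)"

definition field_degree :: "('k, 'm) ring_scheme \<Rightarrow> nat" where
  "field_degree K = ring.dim K (rat_subfield K) (carrier K)"

text \<open>Maps of \<open>K\<close> to itself are extensional functions, and the group operation is composition,
  as in the library's group of bijections of a set.\<close>

definition rat_linear :: "('k, 'm) ring_scheme \<Rightarrow> ('k \<Rightarrow> 'k) \<Rightarrow> bool" where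
  "rat_linear K f \<longleftrightarrow>
     (\<forall>x\<in>carrier K. \<forall>y\<in>carrier K. f (x \<oplus>\<^bsub>K\<^esub> y) = f x \<oplus>\<^bsub>K\<^esub> f y) \<and>
     (\<forall>q. \<forall>x\<in>carrier K. f (rat_emb K q \<otimes>\<^bsub>K\<^esub> x) = rat_emb K q \<otimes>\<^bsub>K\<^esub> f x)"

definition GL_rat :: "('k, 'm) ring_scheme \<Rightarrow> ('k \<Rightarrow> 'k) monoid" where
  "GL_rat K = BijGroup (carrier K) \<lparr>carrier := {f \<in> Bij (carrier K). rat_linear K f}\<rparr>"

definition field_Aut :: "('k, 'm) ring_scheme \<Rightarrow> ('k \<Rightarrow> 'k) set" where
  "field_Aut K = ring_iso K K \<inter> extensional (carrier K)"

definition mult_op :: "('k, 'm) ring_scheme \<Rightarrow> 'k \<Rightarrow> 'k \<Rightarrow> 'k" where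
  "mult_op K a = (\<lambda>x\<in>carrier K. a \<otimes>\<^bsub>K\<^esub> x)"

definition L_group :: "('k, 'm) ring_scheme \<Rightarrow> ('k \<Rightarrow> 'k) monoid" where
  "L_group K =
     subgroup_generated (GL_rat K) (field_Aut K \<union> mult_op K ` (carrier K - {\<zero>\<^bsub>K\<^esub>}))"


section \<open>Root systems\<close>

text \<open>A root system spans the whole Euclidean space \<open>'a\<close>, and reflections are orthogonal.
  The rank is the dimension of this space.\<close>

definition cartan :: "'a::euclidean_space \<Rightarrow> 'a \<Rightarrow> real" where
  "cartan \<beta> \<alpha> = 2 * (\<beta> \<bullet> \<alpha>) / (\<alpha> \<bullet> \<alpha>)"

definition reflection :: "'a::euclidean_space \<Rightarrow> 'a \<Rightarrow> 'a" where
  "reflection \<alpha> \<beta> = \<beta> - cartan \<beta> \<alpha> *\<^sub>R \<alpha>"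

definition root_system :: "'a::euclidean_space set \<Rightarrow> bool" where
  "root_system R \<longleftrightarrow>
     finite R \<and> span R = UNIV \<and> 0 \<notin> R \<and>
     (\<forall>\<alpha>\<in>R. reflection \<alpha> ` R \<subseteq> R) \<and>
     (\<forall>\<alpha>\<in>R. \<forall>\<beta>\<in>R. cartan \<beta> \<alpha> \<in> \<int>)"

definition reduced_roots :: "'a::euclidean_space set \<Rightarrow> bool" where
  "reduced_roots R \<longleftrightarrow> (\<forall>\<alpha>\<in>R. \<forall>c. c *\<^sub>R \<alpha> \<in> R \<longrightarrow> c = 1 \<or> c = -1)"

definition weyl_group :: "'a::euclidean_space set \<Rightarrow> ('a \<Rightarrow> 'a) monoid" where
  "weyl_group R = subgroup_generated (BijGroup UNIV) (reflection ` R)"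

definition root_base :: "'a::euclidean_space set \<Rightarrow> 'a set \<Rightarrow> bool" where
  "root_base R \<Delta> \<longleftrightarrow>
     \<Delta> \<subseteq> R \<and> independent \<Delta> \<and> span \<Delta> = UNIV \<and>
     (\<forall>\<beta>\<in>R. \<exists>k :: 'a \<Rightarrow> int. \<beta> = (\<Sum>\<alpha>\<in>\<Delta>. of_int (k \<alpha>) *\<^sub>R \<alpha>) \<and>
        ((\<forall>\<alpha>\<in>\<Delta>. 0 \<le> k \<alpha>) \<or> (\<forall>\<alpha>\<in>\<Delta>. k \<alpha> \<le> 0)))"


section \<open>Dynkin diagrams and types\<close>

text \<open>\<open>edges u v\<close> is the number of edges joining \<open>u\<close> and \<open>v\<close>; \<open>arrow u v\<close> means that these
  edges carry an arrow from \<open>u\<close> to \<open>v\<close>. For roots, the arrow points to the shorter one.\<close>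

record 'v dynkin =
  verts :: "'v set"
  edges :: "'v \<Rightarrow> 'v \<Rightarrow> nat"
  arrow :: "'v \<Rightarrow> 'v \<Rightarrow> bool"

definition dynkin_diagram :: "'a::euclidean_space set \<Rightarrow> 'a dynkin" where
  "dynkin_diagram \<Delta> =
     \<lparr>verts = \<Delta>,
      edges = (\<lambda>\<alpha> \<beta>. if \<alpha> = \<beta> then 0 else nat \<lfloor>cartan \<alpha> \<beta> * cartan \<beta> \<alpha>\<rfloor>),
      arrow = (\<lambda>\<alpha> \<beta>. \<alpha> \<bullet> \<beta> \<noteq> 0 \<and> norm \<beta> < norm \<alpha>)\<rparr>"

definition dynkin_iso :: "'u dynkin \<Rightarrow> 'v dynkin \<Rightarrow> bool" where
  "dynkin_iso D E \<longleftrightarrow>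
     (\<exists>f. bij_betw f (verts D) (verts E) \<and>
        (\<forall>u\<in>verts D. \<forall>v\<in>verts D.
           edges E (f u) (f v) = edges D u v \<and> arrow E (f u) (f v) = arrow D u v))"

definition has_type :: "'a::euclidean_space set \<Rightarrow> 'v dynkin \<Rightarrow> bool" where
  "has_type R D \<longleftrightarrow> (\<exists>\<Delta>. root_base R \<Delta> \<and> dynkin_iso (dynkin_diagram \<Delta>) D)"

text \<open>The type of a direct sum of root systems is the disjoint union of the diagrams.\<close>

definition dynkin_sum :: "'u dynkin \<Rightarrow> 'v dynkin \<Rightarrow> ('u + 'v) dynkin"  (infixl \<open>\<boxplus>\<close> 65) where
  "D \<boxplus> E =
     \<lparr>verts = Inl ` verts D \<union> Inr ` verts E,
      edges = (\<lambda>x y. case (x, y) of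
        (Inl u, Inl v) \<Rightarrow> edges D u v | (Inr u, Inr v) \<Rightarrow> edges E u v | _ \<Rightarrow> 0),
      arrow = (\<lambda>x y. case (x, y) of
        (Inl u, Inl v) \<Rightarrow> arrow D u v | (Inr u, Inr v) \<Rightarrow> arrow E u v | _ \<Rightarrow> False)\<rparr>"

definition type_A1 :: "bool dynkin" where
  "type_A1 = \<lparr>verts = {True}, edges = (\<lambda>_ _. 0), arrow = (\<lambda>_ _. False)\<rparr>"

definition type_A2 :: "bool dynkin" where
  "type_A2 = \<lparr>verts = UNIV, edges = (\<lambda>u v. if u = v then 0 else 1), arrow = (\<lambda>_ _. False)\<rparr>"

definition type_B2 :: "bool dynkin" where
  "type_B2 = \<lparr>verts = UNIV, edges = (\<lambda>u v. if u = v then 0 else 2), arrow = (\<lambda>u v. u \<and> \<not> v)\<rparr>"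

definition type_G2 :: "bool dynkin" where
  "type_G2 = \<lparr>verts = UNIV, edges = (\<lambda>u v. if u = v then 0 else 3), arrow = (\<lambda>u v. u \<and> \<not> v)\<rparr>"

end

theory Submission
  imports Defs
begin

text \<open>If \<open>W(R)\<close> embeds into \<open>\<L>(K)\<close>, let \<open>C \<subseteq> W(R)\<close> consist of the elements that act as
  multiplications. It is a normal subgroup of index at most \<open>n\<close>, because at most \<open>n\<close> automorphisms are
  available, and \<open>c\<^sup>m = 1\<close> has at most \<open>m\<close> solutions in \<open>C\<close>. If some \<open>c \<in> C\<close> moves a simple root
  \<open>a\<close> off its line, the commutator \<open>r\<close> of \<open>s\<^sub>a\<close> and \<open>c\<close> is the rotation \<open>s\<^sub>a s\<^bsub>c a\<^esub>\<close>, and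
  its powers are all the solutions of \<open>c\<^sup>m = 1\<close> in \<open>C\<close>, where \<open>m\<close> is its order. So they form a normal
  subgroup, the plane of \<open>r\<close> is invariant, and \<open>a\<close> lies in a component of rank 2. Hence \<open>C\<close> has an
  exponent \<open>e \<in> {2, 4, 6, 12}\<close> determined by these components, so \<open>|C| \<le> e\<close>, and comparing
  \<open>|W(R)| \<ge> 2\<^sup>n\<close> (more if there are components of rank 2) with \<open>n |C|\<close> leaves rank at most 2, the two
  types of rank 4, and a candidate in rank 3. The latter is impossible since a cubic field has no cube root of
  unity except 1.

  Conversely these Weyl groups are dihedral or products of two dihedral groups, and roots of unity together
  with Galois automorphisms realise them over \<open>\<rat>\<close>, \<open>\<rat>(\<i>)\<close>, \<open>\<rat>(\<surd>-3)\<close> and \<open>\<rat>(\<i>, \<surd>-3)\<close>.\<close>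

text \<open>The commutator turns a single element of \<open>C\<close> into information about the
  whole group: being a product of two reflections, it displaces vectors only inside a plane, and the
  scarcity of roots of unity forces each of its conjugates to be one of its own powers. Components
  of rank above 2 therefore meet \<open>C\<close> only in simple roots whose lines \<open>C\<close>
  preserves, and they fall to size alone.

  The counting is sharp. For A2 + B2 both sides equal 48 = 4 * 12, and for 2 A1 + A2 both equal 24 =
  4 * 6, so the bound on \<open>C\<close> leaves no slack. In rank 3 the type A1 + A2 gives 12 <= 3
  * 6 and passes every count, which is why arithmetic of cubic fields has to enter. In rank at most
  2 nothing has to be excluded, because every reduced type of that rank is in the list.

  In the converse the same numbers dictate the field: rank 4 asks for at least 6 or 12 roots of
  unity in degree 4, and Q(i, sqrt(-3)) has exactly 12.\<close>

section \<open>Reflections and Cartan numbers\<close>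

lemma cartan_add: "cartan (x + y) a = cartan x a + cartan y a"
  by (simp add: cartan_def inner_add_left algebra_simps add_divide_distrib)

lemma cartan_scaleR: "cartan (c *\<^sub>R x) a = c * cartan x a"
  by (simp add: cartan_def)

lemma cartan_minus: "cartan (- x) a = - cartan x a"
  by (simp add: cartan_def)

lemma cartan_diff: "cartan (x - y) a = cartan x a - cartan y a"
  using cartan_add[of x "- y" a] by (simp add: cartan_minus)

lemma cartan_self: "a \<noteq> 0 \<Longrightarrow> cartan a a = 2"
  by (simp add: cartan_def)

lemma cartan_eq_0_iff: "a \<noteq> 0 \<Longrightarrow> cartan x a = 0 \<longleftrightarrow> x \<bullet> a = 0"
  by (simp add: cartan_def)

lemmas cartan_linear = cartan_add cartan_diff cartan_minus cartan_scaleR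

lemma linear_reflection: "linear (reflection a)"
  by (rule linearI) (simp_all add: reflection_def cartan_add cartan_scaleR algebra_simps)

lemma reflection_self: "reflection a a = - a"
  by (cases "a = 0") (simp_all add: reflection_def cartan_self scaleR_2)

lemma reflection_reflection [simp]: "reflection a (reflection a x) = x"
  by (cases "a = 0") (simp_all add: reflection_def cartan_linear cartan_self algebra_simps)

lemma reflection_comp_self [simp]: "reflection a \<circ> reflection a = id"
  by (simp add: fun_eq_iff)

lemma reflection_isometry: "reflection a x \<bullet> reflection a y = x \<bullet> y"
proof (cases "a = 0")
  case False
  then have "cartan x a * (a \<bullet> a) = 2 * (x \<bullet> a)" "cartan y a * (a \<bullet> a) = 2 * (y \<bullet> a)"
    by (simp_all add: cartan_def)
  moreover have "reflection a x \<bullet> reflection a y =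
      x \<bullet> y - cartan y a * (x \<bullet> a) - cartan x a * (y \<bullet> a) + cartan x a * (cartan y a * (a \<bullet> a))"
    by (simp add: reflection_def inner_diff_left inner_diff_right inner_commute[of a y] right_diff_distrib)
  moreover have "cartan y a * (x \<bullet> a) = cartan x a * (y \<bullet> a)" by (simp add: cartan_def)
  ultimately show ?thesis by simp
qed (simp add: reflection_def)

lemma reflection_uminus: "reflection (- a) = reflection a"
  by (simp add: reflection_def cartan_def fun_eq_iff)

lemma reflection_orthogonal: "x \<bullet> a = 0 \<Longrightarrow> reflection a x = x"
  by (simp add: reflection_def cartan_def)

lemma bij_reflection: "bij (reflection a)"
  by (rule o_bij[of "reflection a"]) simp_all

lemma reflection_conj:
  assumes "linear w" "\<And>x y. w x \<bullet> w y = x \<bullet> y"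
  shows "w (reflection a x) = reflection (w a) (w x)"
  using assms by (simp add: reflection_def cartan_def linear_diff linear_cmul)

section \<open>Groups generated by reflections\<close>

text \<open>Formally a monoid of words in the reflections; since each generator is an involution, it
  is closed under inverses and is the generated group. Words grow on the left only, which makes most
  properties one-step inductions.\<close>

inductive_set refl_group :: "'a::euclidean_space set \<Rightarrow> ('a \<Rightarrow> 'a) set" for S where
  refl_group_id: "id \<in> refl_group S"
| refl_group_step: "a \<in> S \<Longrightarrow> w \<in> refl_group S \<Longrightarrow> reflection a \<circ> w \<in> refl_group S"

lemma refl_group_reflection: "a \<in> S \<Longrightarrow> reflection a \<in> refl_group S"
  using refl_group_step[OF _ refl_group_id] by fastforce

lemma refl_group_comp:
  assumes "v \<in> refl_group S" "w \<in> refl_group S" shows "v \<circ> w \<in> refl_group S"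
  using assms(1)
proof induction
  case (refl_group_step a v)
  then show ?case using refl_group.refl_group_step by (metis comp_assoc)
qed (use assms in simp)

lemma refl_group_funpow: "w \<in> refl_group S \<Longrightarrow> (w ^^ n) \<in> refl_group S"
  by (induction n) (simp_all only: funpow.simps refl_group_id refl_group_comp)

lemma refl_group_mono: "S \<subseteq> T \<Longrightarrow> refl_group S \<subseteq> refl_group T"
proof
  fix w assume "w \<in> refl_group S" "S \<subseteq> T"
  then show "w \<in> refl_group T"
    by induction (blast intro: refl_group.intros)+
qed

lemma refl_group_subset:
  assumes "\<And>a. a \<in> S \<Longrightarrow> reflection a \<in> refl_group T" shows "refl_group S \<subseteq> refl_group T"
proof
  fix w assume "w \<in> refl_group S"
  then show "w \<in> refl_group T"
    by induction (blast intro: refl_group.intros refl_group_comp assms)+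
qed

lemma refl_group_inverse:
  assumes "w \<in> refl_group S" shows "\<exists>v\<in>refl_group S. v \<circ> w = id \<and> w \<circ> v = id"
  using assms
proof induction
  case (refl_group_step a w)
  then obtain v where v: "v \<in> refl_group S" "v \<circ> w = id" "w \<circ> v = id" by blast
  have "v \<circ> reflection a \<in> refl_group S"
    using v refl_group_step by (simp add: refl_group_comp refl_group_reflection)
  moreover have "(v \<circ> reflection a) \<circ> (reflection a \<circ> w) = id"
    "(reflection a \<circ> w) \<circ> (v \<circ> reflection a) = id"
    using v by (auto simp: fun_eq_iff)
  ultimately show ?case by blast
qed (metis refl_group_id comp_id)

lemma refl_group_linear: "w \<in> refl_group S \<Longrightarrow> linear w"
  by (induction rule: refl_group.induct) (blast intro: linear_reflection linear_compose linear_id)+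

lemma refl_group_isometry: "w \<in> refl_group S \<Longrightarrow> w x \<bullet> w y = x \<bullet> y"
  by (induction arbitrary: x y rule: refl_group.induct) (auto simp: reflection_isometry)

lemma refl_group_bij: "w \<in> refl_group S \<Longrightarrow> bij w"
  by (induction rule: refl_group.induct) (blast intro: bij_reflection bij_comp bij_id)+

text \<open>Each factor changes its argument by a multiple of a root in \<open>S\<close>. Confining
  displacements to a subspace is behind both the trivial intersections below and the invariant plane
  of the commutator.\<close>

lemma refl_group_moves: "w \<in> refl_group S \<Longrightarrow> w x - x \<in> span S"
proof (induction rule: refl_group.induct)
  case (refl_group_step a w)
  have "(reflection a \<circ> w) x - x = (w x - x) - cartan (w x) a *\<^sub>R a"
    by (simp add: reflection_def)
  then show ?case using span_diff[OF refl_group_step(3) span_mul[OF span_base[OF refl_group_step(1)]]] by metis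
qed (simp add: span_zero)

lemma refl_group_orthogonal:
  assumes "w \<in> refl_group S" "\<And>a. a \<in> S \<Longrightarrow> x \<bullet> a = 0" shows "w x = x"
  using assms by induction (auto simp: reflection_orthogonal)

lemma independent_span_inter:
  fixes A B :: "'a::euclidean_space set"
  assumes "independent (A \<union> B)" "A \<inter> B = {}" "x \<in> span A" "x \<in> span B" shows "x = 0"
proof -
  have A: "independent A" and B: "independent B"
    using assms independent_mono by blast+
  have "representation (A \<union> B) x = representation A x" "representation (A \<union> B) x = representation B x"
    using assms by (auto intro!: real_vector.representation_extend)
  then have "representation A x b = 0" for b
    using assms(2) by (metis disjoint_iff real_vector.representation_ne_zero)
  then show ?thesis
    using real_vector.sum_nonzero_representation_eq[OF A assms(3)] by simp
qed

text \<open>A common element displaces every vector by an element of \<open>span A\<close> and of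
  \<open>span B\<close>, and these spans meet only in 0.\<close>

lemma refl_group_inter:
  assumes "independent (A \<union> B)" "A \<inter> B = {}" "w \<in> refl_group A" "w \<in> refl_group B"
  shows "w = id"
proof
  fix x
  show "w x = id x"
    using independent_span_inter[OF assms(1,2), of "w x - x"] assms(3,4)
    by (simp add: refl_group_moves)
qed

text \<open>\<open>A\<close> and \<open>B\<close> may be non-orthogonal, so the products need not
  form a subgroup; cancelling in \<open>v \<circ> w = v' \<circ> w'\<close> leaves an element of
  both groups, which is the identity.\<close>

lemma refl_group_mult_inj:
  assumes "independent (A \<union> B)" "A \<inter> B = {}"
  shows "inj_on (\<lambda>(v, w). v \<circ> w) (refl_group A \<times> refl_group B)"
proof (rule inj_onI, clarify)
  fix v w v' w' assume vw: "v \<in> refl_group A" "w \<in> refl_group B"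
    "v' \<in> refl_group A" "w' \<in> refl_group B" and eq: "v \<circ> w = v' \<circ> w'"
  obtain u where u: "u \<in> refl_group A" "u \<circ> v' = id" "v' \<circ> u = id"
    using refl_group_inverse vw by blast
  obtain t where t: "t \<in> refl_group B" "t \<circ> w = id" "w \<circ> t = id"
    using refl_group_inverse vw by blast
  have "u \<circ> v = u \<circ> ((v \<circ> w) \<circ> t)" using t by (simp add: comp_assoc)
  also have "\<dots> = w' \<circ> t" unfolding eq using u by (metis comp_assoc comp_id id_comp)
  finally have uv: "u \<circ> v = w' \<circ> t" .
  then have "u \<circ> v = id" using refl_group_inter[OF assms] u t vw by (metis refl_group_comp)
  then have "v = v'" using u by (metis comp_assoc comp_id id_comp)
  moreover from \<open>u \<circ> v = id\<close> uv have "w' = w" using t by (metis comp_assoc comp_id id_comp)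
  ultimately show "v = v' \<and> w = w'" by simp
qed

text \<open>Lower bounds on the order of a Weyl group come from cutting a base into disjoint pieces
  and applying this inequality.\<close>

lemma refl_group_card_mult:
  assumes "independent (A \<union> B)" "A \<inter> B = {}" "finite (refl_group (A \<union> B))"
  shows "card (refl_group A) * card (refl_group B) \<le> card (refl_group (A \<union> B))"
proof -
  have "(\<lambda>(v, w). v \<circ> w) ` (refl_group A \<times> refl_group B) \<subseteq> refl_group (A \<union> B)"
  proof clarify
    fix v w assume "v \<in> refl_group A" "w \<in> refl_group B"
    then have "v \<in> refl_group (A \<union> B)" "w \<in> refl_group (A \<union> B)"
      using refl_group_mono[of A "A \<union> B"] refl_group_mono[of B "A \<union> B"] by auto
    then show "v \<circ> w \<in> refl_group (A \<union> B)" by (rule refl_group_comp)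
  qed
  from card_mono[OF assms(3) this] show ?thesis
    using card_image[OF refl_group_mult_inj[OF assms(1,2)]] by (simp add: card_cartesian_product)
qed

text \<open>An element \<open>u\<close> of the first group fixes the vectors orthogonal to
  \<open>A\<close>, hence commutes with every reflection in a root of \<open>B\<close>, which can
  therefore be moved to the right past \<open>u\<close>.\<close>

lemma refl_group_mult_surj:
  assumes "\<And>a b. a \<in> A \<Longrightarrow> b \<in> B \<Longrightarrow> a \<bullet> b = 0" "w \<in> refl_group (A \<union> B)"
  shows "\<exists>u\<in>refl_group A. \<exists>v\<in>refl_group B. w = u \<circ> v"
  using assms(2)
proof induction
  case refl_group_id
  then show ?case by (metis refl_group.refl_group_id comp_id)
next
  case (refl_group_step a w)
  then obtain u v where uv: "u \<in> refl_group A" "v \<in> refl_group B" "w = u \<circ> v" by blast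
  show ?case
  proof (cases "a \<in> A")
    case True
    then show ?thesis using uv refl_group.refl_group_step[OF True uv(1)] by (metis comp_assoc)
  next
    case False
    then have a: "a \<in> B" using refl_group_step by blast
    have ua: "u a = a" using refl_group_orthogonal[OF uv(1)] assms(1)[OF _ a] by (metis inner_commute)
    have "reflection a \<circ> u = u \<circ> reflection a"
      using reflection_conj[OF refl_group_linear[OF uv(1)] refl_group_isometry[OF uv(1)], of a] ua
      by (auto simp: fun_eq_iff)
    then have "reflection a \<circ> w = u \<circ> (reflection a \<circ> v)" unfolding uv(3) by (metis comp_assoc)
    then show ?thesis using uv(1) refl_group.refl_group_step[OF a uv(2)] by blast
  qed
qed

lemma refl_group_commute:
  assumes "\<And>a b. a \<in> A \<Longrightarrow> b \<in> B \<Longrightarrow> a \<bullet> b = 0" "u \<in> refl_group A" "v \<in> refl_group B"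
  shows "u \<circ> v = v \<circ> u"
  using assms(3)
proof induction
  case (refl_group_step b v)
  have ub: "u b = b" using refl_group_orthogonal[OF assms(2)] assms(1)[OF _ refl_group_step(1)]
    by (metis inner_commute)
  have "reflection b \<circ> u = u \<circ> reflection b"
    using reflection_conj[OF refl_group_linear[OF assms(2)] refl_group_isometry[OF assms(2)], of b] ub
    by (auto simp: fun_eq_iff)
  then show ?case using refl_group_step by (metis comp_assoc)
qed simp

section \<open>The Weyl group as a set of plain functions under composition\<close>

lemma BijGroup_UNIV_simps:
  "carrier (BijGroup UNIV) = {f. bij f}" "\<one>\<^bsub>BijGroup UNIV\<^esub> = id"
  "bij f \<Longrightarrow> bij g \<Longrightarrow> f \<otimes>\<^bsub>BijGroup UNIV\<^esub> g = f \<circ> g"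
  by (auto simp: BijGroup_def Bij_def compose_def fun_eq_iff)

lemma weyl_group_one: "\<one>\<^bsub>weyl_group R\<^esub> = id"
  by (simp add: weyl_group_def BijGroup_UNIV_simps)

lemma carrier_weyl_group: "carrier (weyl_group R) = refl_group R"
proof -
  interpret B: group "BijGroup (UNIV :: 'a set)" by (rule group_BijGroup)
  have sub: "reflection ` R \<subseteq> carrier (BijGroup UNIV)"
    by (auto simp: BijGroup_UNIV_simps bij_reflection)
  have c: "carrier (weyl_group R) = generate (BijGroup UNIV) (reflection ` R)"
    using sub by (simp add: weyl_group_def carrier_subgroup_generated Int_absorb1)
  have sg: "subgroup (refl_group R) (BijGroup UNIV)"
  proof
    show "refl_group R \<subseteq> carrier (BijGroup UNIV)" by (auto simp: BijGroup_UNIV_simps refl_group_bij)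
  next
    fix x y assume "x \<in> refl_group R" "y \<in> refl_group R"
    then show "x \<otimes>\<^bsub>BijGroup UNIV\<^esub> y \<in> refl_group R"
      by (simp add: BijGroup_UNIV_simps refl_group_bij refl_group_comp)
  next
    show "\<one>\<^bsub>BijGroup UNIV\<^esub> \<in> refl_group R" by (simp add: BijGroup_UNIV_simps refl_group_id)
  next
    fix x assume x: "x \<in> refl_group R"
    obtain v where v: "v \<in> refl_group R" "v \<circ> x = id" using refl_group_inverse[OF x] by blast
    have "inv\<^bsub>BijGroup UNIV\<^esub> x = v"
      using B.inv_equality[of v x] x v by (simp add: BijGroup_UNIV_simps refl_group_bij)
    then show "inv\<^bsub>BijGroup UNIV\<^esub> x \<in> refl_group R" using v by simp
  qed
  have "generate (BijGroup UNIV) (reflection ` R) \<subseteq> refl_group R"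
    by (rule B.generate_subgroup_incl[OF _ sg]) (auto simp: refl_group_reflection)
  moreover have "w \<in> generate (BijGroup UNIV) (reflection ` R)" if "w \<in> refl_group R" for w
    using that
  proof induction
    case refl_group_id
    then show ?case using generate.one[of "BijGroup UNIV"] by (metis BijGroup_UNIV_simps(2))
  next
    case (refl_group_step a w)
    then show ?case
      using generate.eng[OF generate.incl[of "reflection a"] refl_group_step(3)]
      by (metis BijGroup_UNIV_simps(3) bij_reflection image_eqI refl_group_bij)
  qed
  ultimately show ?thesis using c by blast
qed

lemma weyl_group_mult:
  "v \<in> refl_group R \<Longrightarrow> w \<in> refl_group R \<Longrightarrow> v \<otimes>\<^bsub>weyl_group R\<^esub> w = v \<circ> w"
  by (simp add: weyl_group_def BijGroup_UNIV_simps refl_group_bij)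

lemma group_weyl_group: "group (weyl_group R)"
  unfolding weyl_group_def by (rule group.group_subgroup_generated[OF group_BijGroup])

lemma weyl_group_pow: "w \<in> refl_group R \<Longrightarrow> w [^]\<^bsub>weyl_group R\<^esub> (n::nat) = w ^^ n"
proof (induction n)
  case (Suc n)
  interpret group "weyl_group R" by (rule group_weyl_group)
  show ?case using Suc by (simp add: weyl_group_mult refl_group_funpow funpow_Suc_right del: funpow.simps)
qed (simp add: weyl_group_one id_def)

lemma refl_group_root_system:
  assumes "root_system R" "w \<in> refl_group R" shows "w ` R = R"
proof -
  have fin: "finite R" using assms(1) by (simp add: root_system_def)
  from assms(2) show ?thesis
  proof induction
    case (refl_group_step a w)
    have "reflection a ` R \<subseteq> R" using assms(1) refl_group_step(1) by (simp add: root_system_def)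
    moreover have "inj_on (reflection a) R" using bij_is_inj[OF bij_reflection] by (rule inj_on_subset) simp
    ultimately have "reflection a ` R = R" using endo_inj_surj fin by blast
    then show ?case using refl_group_step by (metis image_comp)
  qed simp
qed

lemma linear_eq_on_spanning:
  assumes "linear f" "linear g" "span S = UNIV" "\<And>x. x \<in> S \<Longrightarrow> f x = g x" shows "f = g"
  using linear_eq_on_span[OF assms(1,2,4)] assms(3) by auto

text \<open>The roots span the space and are permuted, so an element is determined by its
  restriction to the finite set \<open>R\<close>.\<close>

lemma finite_refl_group:
  assumes "root_system R" shows "finite (refl_group R)"
proof (rule finite_imageD[of "\<lambda>w. restrict w R"])
  have fin: "finite R" and sp: "span R = UNIV" using assms by (auto simp: root_system_def)
  have "(\<lambda>w. restrict w R) ` refl_group R \<subseteq> R \<rightarrow>\<^sub>E R"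
    using refl_group_root_system[OF assms] by fastforce
  then show "finite ((\<lambda>w. restrict w R) ` refl_group R)"
    using finite_PiE[OF fin, of "\<lambda>_. R"] fin finite_subset by blast
  show "inj_on (\<lambda>w. restrict w R) (refl_group R)"
  proof (rule inj_onI)
    fix v w assume vw: "v \<in> refl_group R" "w \<in> refl_group R" "restrict v R = restrict w R"
    then have "v x = w x" if "x \<in> R" for x using that by (metis restrict_apply')
    then show "v = w"
      using linear_eq_on_spanning[OF refl_group_linear refl_group_linear sp] vw by blast
  qed
qed

section \<open>Roots and bases of simple roots\<close>

lemma root_nonzero: "root_system R \<Longrightarrow> a \<in> R \<Longrightarrow> a \<noteq> 0"
  by (auto simp: root_system_def)

lemma root_reflection: "root_system R \<Longrightarrow> a \<in> R \<Longrightarrow> b \<in> R \<Longrightarrow> reflection a b \<in> R"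
  by (auto simp: root_system_def)

lemma root_uminus: "root_system R \<Longrightarrow> a \<in> R \<Longrightarrow> - a \<in> R"
  using root_reflection[of R a a] by (simp add: reflection_self)

lemma cartan_Ints: "root_system R \<Longrightarrow> a \<in> R \<Longrightarrow> b \<in> R \<Longrightarrow> cartan b a \<in> \<int>"
  by (auto simp: root_system_def)

text \<open>\<open>t *\<^sub>R b\<close> is the orthogonal projection of \<open>a\<close> to the
  line of \<open>b\<close>; the remaining part is nonzero and has positive square length.\<close>

lemma Cauchy_Schwarz_strict:
  fixes a b :: "'a::real_inner"
  assumes "b \<noteq> 0" "\<And>t. a \<noteq> t *\<^sub>R b"
  shows "(a \<bullet> b)\<^sup>2 < (a \<bullet> a) * (b \<bullet> b)"
proof -
  define t where "t = (a \<bullet> b) / (b \<bullet> b)"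
  have tb: "t * (b \<bullet> b) = a \<bullet> b" using assms(1) by (simp add: t_def)
  have "0 < (a - t *\<^sub>R b) \<bullet> (a - t *\<^sub>R b)" using assms(2)[of t] by simp
  also have "\<dots> = a \<bullet> a - t * (a \<bullet> b) - t * (a \<bullet> b) + t * (t * (b \<bullet> b))"
    by (simp add: inner_diff_left inner_diff_right inner_commute[of b a] right_diff_distrib)
  also have "\<dots> = a \<bullet> a - t * (a \<bullet> b)" unfolding tb by simp
  finally have "0 < (a \<bullet> a - t * (a \<bullet> b)) * (b \<bullet> b)" using assms(1) by simp
  also have "\<dots> = (a \<bullet> a) * (b \<bullet> b) - (t * (b \<bullet> b)) * (a \<bullet> b)" by (simp add: algebra_simps)
  finally show ?thesis unfolding tb by (simp add: power2_eq_square)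
qed

text \<open>The product is four times the squared cosine of the angle between \<open>a\<close> and
  \<open>b\<close>.\<close>

lemma cartan_product_less_4:
  assumes "a \<noteq> 0" "b \<noteq> 0" "\<And>t. a \<noteq> t *\<^sub>R b"
  shows "cartan a b * cartan b a < 4"
proof -
  have "cartan a b * cartan b a = 4 * ((a \<bullet> b)\<^sup>2 / ((a \<bullet> a) * (b \<bullet> b)))"
    by (simp add: cartan_def power2_eq_square inner_commute[of b a])
  also have "\<dots> < 4"
    using Cauchy_Schwarz_strict[OF assms(2,3)] assms(1,2) by (simp add: divide_less_eq)
  finally show ?thesis .
qed

lemma cartan_pos_iff: "a \<noteq> 0 \<Longrightarrow> 0 < cartan b a \<longleftrightarrow> 0 < b \<bullet> a"
  using inner_ge_zero[of a] by (auto simp: cartan_def zero_less_divide_iff simp del: inner_ge_zero)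

lemma cartan_nonpos_iff: "a \<noteq> 0 \<Longrightarrow> cartan b a \<le> 0 \<longleftrightarrow> b \<bullet> a \<le> 0"
  using cartan_pos_iff[of a b] by linarith

text \<open>This is the table of possible pairs of Cartan integers, up to sign.\<close>

lemma int_product_less_4:
  fixes x y :: int
  assumes "0 \<le> x" "0 \<le> y" "x * y < 4" "x = 0 \<longleftrightarrow> y = 0"
  shows "(x, y) \<in> {(0,0), (1,1), (1,2), (2,1), (1,3), (3,1)}"
proof (cases "x = 0")
  case False
  then have x: "1 \<le> x" and y: "1 \<le> y" using assms by auto
  have "x * 1 \<le> x * y" using x y by (intro mult_left_mono) auto
  then have "x \<le> 3" using assms(3) by simp
  moreover have "1 * y \<le> x * y" using x y by (intro mult_right_mono) auto
  then have "y \<le> 3" using assms(3) by simp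
  ultimately have "x \<in> {1,2,3}" "y \<in> {1,2,3}" using x y by auto
  then show ?thesis using assms(3) by auto
qed (use assms in simp)

text \<open>Two positive Cartan integers with product below 4 include a 1, and the corresponding
  reflection takes one root to the difference, up to sign.\<close>

lemma root_diff:
  assumes R: "root_system R" and ab: "a \<in> R" "b \<in> R" "0 < a \<bullet> b" "\<And>t. a \<noteq> t *\<^sub>R b"
  shows "a - b \<in> R"
proof -
  have nz: "a \<noteq> 0" "b \<noteq> 0" using R ab root_nonzero by blast+
  obtain x y where xy: "cartan a b = of_int x" "cartan b a = of_int y"
    using cartan_Ints[OF R ab(1,2)] cartan_Ints[OF R ab(2,1)] by (auto elim!: Ints_cases)
  have "0 < cartan a b" "0 < cartan b a" using nz ab(3) by (auto simp: cartan_pos_iff inner_commute)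
  then have pos: "0 < x" "0 < y" using xy by auto
  have "real_of_int (x * y) < 4" using cartan_product_less_4[OF nz ab(4)] xy by simp
  then have "x * y < 4" by linarith
  then have "x = 1 \<or> y = 1" using int_product_less_4[of x y] pos by auto
  then show ?thesis
  proof
    assume "x = 1"
    then have "reflection b a = a - b" using xy by (simp add: reflection_def)
    then show ?thesis using root_reflection[OF R ab(2,1)] by simp
  next
    assume "y = 1"
    then have "reflection a b = - (a - b)" using xy by (simp add: reflection_def)
    then show ?thesis using root_uminus[OF R root_reflection[OF R ab(1,2)]] by simp
  qed
qed

text \<open>Separating the positive and negative coefficients of a relation gives one vector written
  in two ways, \<open>p = q\<close>. Obtuseness yields \<open>p \<bullet> q \<le> 0\<close>, so
  \<open>p = 0\<close>; pairing with \<open>v\<close>, which is positive on \<open>D\<close>, then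
  kills every coefficient.\<close>

lemma obtuse_independent:
  fixes D :: "'a::euclidean_space set"
  assumes D: "finite D" and pos: "\<And>a. a \<in> D \<Longrightarrow> 0 < v \<bullet> a"
    and obt: "\<And>a b. a \<in> D \<Longrightarrow> b \<in> D \<Longrightarrow> a \<noteq> b \<Longrightarrow> a \<bullet> b \<le> 0"
  shows "independent D"
proof
  assume "dependent D"
  then obtain u where u: "(\<Sum>x\<in>D. u x *\<^sub>R x) = 0" "\<exists>x\<in>D. u x \<noteq> 0"
    using dependent_finite[OF D] by auto
  define p where "p = (\<Sum>x\<in>D. max (u x) 0 *\<^sub>R x)"
  define q where "q = (\<Sum>x\<in>D. max (- u x) 0 *\<^sub>R x)"
  have "p - q = (\<Sum>x\<in>D. u x *\<^sub>R x)"
    unfolding p_def q_def sum_subtractf[symmetric] scaleR_left_diff_distrib[symmetric]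
    by (intro sum.cong arg_cong2[of _ _ _ _ scaleR]) auto
  then have pq: "p = q" using u by simp
  have "p \<bullet> q = (\<Sum>x\<in>D. \<Sum>y\<in>D. max (u x) 0 * (max (- u y) 0 * (x \<bullet> y)))"
    unfolding p_def q_def inner_sum_left by (simp add: inner_sum_right sum_distrib_left mult.left_commute)
  also have "\<dots> \<le> 0"
  proof (intro sum_nonpos)
    fix x y assume xy: "x \<in> D" "y \<in> D"
    show "max (u x) 0 * (max (- u y) 0 * (x \<bullet> y)) \<le> 0"
    proof (cases "x = y")
      case False
      then have "x \<bullet> y \<le> 0" using obt xy by blast
      then show ?thesis by (simp add: mult_nonneg_nonpos)
    qed (auto simp: max_def)
  qed
  finally have "p = 0" using pq by (metis inner_gt_zero_iff not_less)
  have "max (u x) 0 = 0 \<and> max (- u x) 0 = 0" if x: "x \<in> D" for x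
  proof -
    have z: "f x = 0" if f: "\<And>x. x \<in> D \<Longrightarrow> 0 \<le> f x" "(\<Sum>x\<in>D. f x *\<^sub>R x) = 0" for f :: "'a \<Rightarrow> real"
    proof -
      have "(\<Sum>x\<in>D. f x * (v \<bullet> x)) = v \<bullet> (\<Sum>x\<in>D. f x *\<^sub>R x)" by (simp add: inner_sum_right)
      then have "f x * (v \<bullet> x) = 0"
        using sum_nonneg_eq_0_iff[OF D, of "\<lambda>x. f x * (v \<bullet> x)"] f pos x
        by (simp add: less_imp_le)
      then show ?thesis using pos[OF x] by simp
    qed
    show ?thesis using z[of "\<lambda>x. max (u x) 0"] z[of "\<lambda>x. max (- u x) 0"] \<open>p = 0\<close> pq
      by (simp add: p_def q_def)
  qed
  then have "u x = 0" if "x \<in> D" for x using that by (force simp: max_def split: if_splits)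
  then show False using u by blast
qed

text \<open>Finitely many hyperplanes form a null set and cannot cover the space.\<close>

lemma exists_nonorthogonal:
  fixes R :: "'a::euclidean_space set"
  assumes "finite R" "0 \<notin> R" shows "\<exists>v. \<forall>a\<in>R. v \<bullet> a \<noteq> 0"
proof -
  have "negligible (\<Union>a\<in>R. {x. a \<bullet> x = 0})"
    using assms by (intro negligible_Union) (auto intro!: negligible_hyperplane)
  then have "(\<Union>a\<in>R. {x. a \<bullet> x = 0}) \<noteq> UNIV" using non_negligible_UNIV by metis
  then show ?thesis by (auto simp: inner_commute)
qed

lemma root_base_exists:
  fixes R :: "'a::euclidean_space set"
  assumes R: "root_system R" and red: "reduced_roots R" shows "\<exists>\<Delta>. root_base R \<Delta>"
proof -
  have fin: "finite R" and sp: "span R = UNIV" and nz: "0 \<notin> R"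
    using R by (auto simp: root_system_def)
  obtain v where v: "\<And>a. a \<in> R \<Longrightarrow> v \<bullet> a \<noteq> 0" using exists_nonorthogonal[OF fin nz] by blast
  define P where "P = {a\<in>R. 0 < v \<bullet> a}"
  \<comment> \<open>The base consists of the indecomposable roots in the half space of
    \<open>v\<close>.\<close>
  define \<Delta> where "\<Delta> = {a\<in>P. \<not> (\<exists>b\<in>P. \<exists>c\<in>P. a = b + c)}"
  have finP: "finite P" and finD: "finite \<Delta>" using fin by (auto simp: P_def \<Delta>_def)
  have comb: "\<exists>k :: 'a \<Rightarrow> nat. a = (\<Sum>d\<in>\<Delta>. of_nat (k d) *\<^sub>R d)" if "a \<in> P" for a
    using that
  \<comment> \<open>The heights \<open>v \<bullet> a\<close> are real numbers, so the induction
    counts the positive roots of smaller height instead.\<close>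
  proof (induction "card {b\<in>P. v \<bullet> b < v \<bullet> a}" arbitrary: a rule: less_induct)
    case less
    show ?case
    proof (cases "a \<in> \<Delta>")
      case True
      have "(\<Sum>d\<in>\<Delta>. of_nat (if d = a then 1 else 0) *\<^sub>R d) = (\<Sum>d\<in>\<Delta>. if d = a then d else 0)"
        by (intro sum.cong) auto
      also have "\<dots> = a" using True finD by simp
      finally show ?thesis by (intro exI[of _ "\<lambda>d. if d = a then 1 else 0"]) simp
    next
      case False
      then obtain b c where bc: "b \<in> P" "c \<in> P" "a = b + c" using less by (auto simp: \<Delta>_def)
      have lt: "card {e\<in>P. v \<bullet> e < v \<bullet> b} < card {e\<in>P. v \<bullet> e < v \<bullet> a}"
        if "b \<in> P" "v \<bullet> b < v \<bullet> a" for b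
        using that finP by (intro psubset_card_mono) auto
      have "v \<bullet> b < v \<bullet> a" "v \<bullet> c < v \<bullet> a" using bc by (auto simp: P_def inner_add_right)
      with less(1)[OF lt bc(1)] less(1)[OF lt bc(2)] bc obtain k l :: "'a \<Rightarrow> nat" where
        "b = (\<Sum>d\<in>\<Delta>. of_nat (k d) *\<^sub>R d)" "c = (\<Sum>d\<in>\<Delta>. of_nat (l d) *\<^sub>R d)" by blast
      then have "a = (\<Sum>d\<in>\<Delta>. of_nat (k d + l d) *\<^sub>R d)"
        by (simp add: bc(3) scaleR_add_left sum.distrib)
      then show ?thesis by (intro exI[of _ "\<lambda>d. k d + l d"]) simp
    qed
  qed
  have obt: "a \<bullet> b \<le> 0" if ab: "a \<in> \<Delta>" "b \<in> \<Delta>" "a \<noteq> b" for a b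
  proof (rule ccontr)
    assume "\<not> a \<bullet> b \<le> 0"
    then have pos: "0 < a \<bullet> b" by simp
    have aP: "a \<in> P" "b \<in> P" using ab by (auto simp: \<Delta>_def)
    then have aR: "a \<in> R" "b \<in> R" "0 < v \<bullet> a" "0 < v \<bullet> b" by (auto simp: P_def)
    have np: "a \<noteq> t *\<^sub>R b" for t
    proof
      assume t: "a = t *\<^sub>R b"
      then have "t = 1 \<or> t = -1" using red aR by (auto simp: reduced_roots_def)
      then show False using t ab aR by auto
    qed
    \<comment> \<open>The difference is a root, so it or its negative is positive, and then
      \<open>a\<close> or \<open>b\<close> would be a sum of two positive roots.\<close>
    have d: "a - b \<in> R" "b - a \<in> R"
      using root_diff[OF R aR(1,2) pos np] root_uminus[OF R] by fastforce+
    have "v \<bullet> (a - b) \<noteq> 0" using v d by blast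
    then consider "a - b \<in> P" | "b - a \<in> P" using d by (force simp: P_def inner_diff_right)
    then show False
    proof cases
      case 1
      moreover have "a = b + (a - b)" by simp
      ultimately show False using ab(1) aP unfolding \<Delta>_def by blast
    next
      case 2
      moreover have "b = a + (b - a)" by simp
      ultimately show False using ab(2) aP unfolding \<Delta>_def by blast
    qed
  qed
  have ind: "independent \<Delta>"
    by (rule obtuse_independent[OF finD _ obt, of v]) (auto simp: \<Delta>_def P_def)
  have signed: "\<exists>k :: 'a \<Rightarrow> int. b = (\<Sum>a\<in>\<Delta>. of_int (k a) *\<^sub>R a) \<and>
        ((\<forall>a\<in>\<Delta>. 0 \<le> k a) \<or> (\<forall>a\<in>\<Delta>. k a \<le> 0))" if b: "b \<in> R" for b
  proof (cases "b \<in> P")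
    case True
    then obtain k :: "'a \<Rightarrow> nat" where "b = (\<Sum>d\<in>\<Delta>. of_nat (k d) *\<^sub>R d)" using comb by blast
    then show ?thesis by (intro exI[of _ "\<lambda>d. int (k d)"]) simp
  next
    case False
    then have "- b \<in> P" using b v[OF b] root_uminus[OF R b] by (simp add: P_def)
    then obtain k :: "'a \<Rightarrow> nat" where "- b = (\<Sum>d\<in>\<Delta>. of_nat (k d) *\<^sub>R d)" using comb by blast
    then have "b = - (\<Sum>d\<in>\<Delta>. of_nat (k d) *\<^sub>R d)" by (metis minus_minus)
    then show ?thesis by (intro exI[of _ "\<lambda>d. - int (k d)"]) (simp add: sum_negf)
  qed
  have "R \<subseteq> span \<Delta>"
  proof
    fix b assume "b \<in> R"
    from signed[OF this] obtain k :: "'a \<Rightarrow> int" where "b = (\<Sum>a\<in>\<Delta>. of_int (k a) *\<^sub>R a)" by blast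
    then show "b \<in> span \<Delta>" using span_sum[of \<Delta> "\<lambda>a. of_int (k a) *\<^sub>R a"] by (simp add: span_mul span_base)
  qed
  then have "span \<Delta> = UNIV" using sp by (metis span_minimal subspace_span top.extremum_uniqueI)
  then show ?thesis unfolding root_base_def using ind signed by (auto simp: \<Delta>_def P_def intro!: exI[of _ \<Delta>])
qed

lemma root_base_finite: "root_base R \<Delta> \<Longrightarrow> finite \<Delta>"
  by (auto simp: root_base_def intro: finiteI_independent)

lemma independent_int_comb_unique:
  fixes \<Delta> :: "'a::euclidean_space set" and k l :: "'a \<Rightarrow> int"
  assumes "independent \<Delta>" "(\<Sum>a\<in>\<Delta>. of_int (k a) *\<^sub>R a) = (\<Sum>a\<in>\<Delta>. of_int (l a) *\<^sub>R a)" "a \<in> \<Delta>"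
  shows "k a = l a"
proof -
  have "(\<Sum>a\<in>\<Delta>. of_int (k a - l a) *\<^sub>R a) = 0"
    using assms(2) by (simp add: scaleR_left_diff_distrib sum_subtractf)
  then have "of_int (k a - l a) = (0::real)"
    using independentD[OF assms(1) finiteI_independent[OF assms(1)] subset_refl,
        of "\<lambda>a. of_int (k a - l a)" a] assms(3) by blast
  then show ?thesis by simp
qed

lemma sum_int_comb_upd:
  fixes \<Delta> :: "'a::euclidean_space set" and k :: "'a \<Rightarrow> int"
  assumes "finite \<Delta>" "a \<in> \<Delta>"
  shows "(\<Sum>x\<in>\<Delta>. of_int ((k(a := k a - c)) x) *\<^sub>R x) = (\<Sum>x\<in>\<Delta>. of_int (k x) *\<^sub>R x) - of_int c *\<^sub>R a"
proof -
  have "(\<Sum>x\<in>\<Delta>. of_int ((k(a := k a - c)) x) *\<^sub>R x) =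
    (\<Sum>x\<in>\<Delta>. of_int (k x) *\<^sub>R x - (if x = a then of_int c *\<^sub>R a else 0))"
    by (intro sum.cong) (auto simp: scaleR_left_diff_distrib)
  then show ?thesis using assms by (simp add: sum_subtractf)
qed

text \<open>With a positive Cartan number \<open>c\<close>, the reflected root
  \<open>b - c a\<close> would have the coefficients 1 and \<open>-c\<close>, of opposite
  signs.\<close>

lemma root_base_obtuse:
  assumes R: "root_system R" and base: "root_base R \<Delta>" and ab: "a \<in> \<Delta>" "b \<in> \<Delta>" "a \<noteq> b"
  shows "a \<bullet> b \<le> 0"
proof (rule ccontr)
  assume "\<not> a \<bullet> b \<le> 0"
  then have pos: "0 < b \<bullet> a" by (simp add: inner_commute)
  have fin: "finite \<Delta>" using base by (rule root_base_finite)
  have ind: "independent \<Delta>" and aR: "a \<in> R" "b \<in> R" using base ab by (auto simp: root_base_def)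
  obtain c where c: "cartan b a = of_int c" using cartan_Ints[OF R aR] by (auto elim: Ints_cases)
  then have "0 < c" using pos cartan_pos_iff[of a b] root_nonzero[OF R aR(1)] by simp
  define k :: "'a \<Rightarrow> int" where "k = (\<lambda>x. if x = b then 1 else 0)"
  have "(\<Sum>x\<in>\<Delta>. of_int (k x) *\<^sub>R x) = (\<Sum>x\<in>\<Delta>. if x = b then x else 0)"
    by (intro sum.cong) (auto simp: k_def)
  then have "(\<Sum>x\<in>\<Delta>. of_int (k x) *\<^sub>R x) = b" using fin ab by simp
  then have r: "reflection a b = (\<Sum>x\<in>\<Delta>. of_int ((k(a := k a - c)) x) *\<^sub>R x)"
    unfolding sum_int_comb_upd[OF fin ab(1)] by (simp add: reflection_def c)
  have "reflection a b \<in> R" using root_reflection[OF R aR] .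
  then obtain l :: "'a \<Rightarrow> int" where l: "reflection a b = (\<Sum>x\<in>\<Delta>. of_int (l x) *\<^sub>R x)"
    "(\<forall>a\<in>\<Delta>. 0 \<le> l a) \<or> (\<forall>a\<in>\<Delta>. l a \<le> 0)" using base unfolding root_base_def by blast
  have "l x = (k(a := k a - c)) x" if "x \<in> \<Delta>" for x
    using independent_int_comb_unique[OF ind _ that] l(1) r by metis
  from this[OF ab(1)] this[OF ab(2)] have "l a = - c" "l b = 1" using ab by (auto simp: k_def)
  then show False using l(2) ab \<open>0 < c\<close> by force
qed

text \<open>Induction on the height, the sum of the coefficients: some simple root \<open>a\<close>
  has positive inner product with \<open>b\<close>, and reflecting in it lowers the height. The
  reflection in \<open>b\<close> is conjugate to the reflection in the lower root.\<close>

lemma reflection_generated: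
  assumes R: "root_system R" and red: "reduced_roots R" and base: "root_base R \<Delta>"
    and "b \<in> R" "b = (\<Sum>x\<in>\<Delta>. of_int (k x) *\<^sub>R x)" "\<And>x. x \<in> \<Delta> \<Longrightarrow> 0 \<le> (k x :: int)"
  shows "reflection b \<in> refl_group \<Delta>"
  using assms(4-)
proof (induction "nat (\<Sum>x\<in>\<Delta>. k x)" arbitrary: b k rule: less_induct)
  case less
  have fin: "finite \<Delta>" using base by (rule root_base_finite)
  have ind: "independent \<Delta>" and sub: "\<Delta> \<subseteq> R" using base by (auto simp: root_base_def)
  have "0 < b \<bullet> b" using root_nonzero[OF R less(2)] by simp
  also have "b \<bullet> b = (\<Sum>x\<in>\<Delta>. of_int (k x) * (b \<bullet> x))"
    by (subst (2) less(3)) (simp add: inner_sum_right)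
  finally obtain a where a: "a \<in> \<Delta>" "0 < of_int (k a) * (b \<bullet> a)"
    using sum_nonpos by (metis (no_types, lifting) not_less)
  have ka: "0 < k a" "0 < b \<bullet> a" using a less(4)[OF a(1)] by (auto simp: zero_less_mult_iff)
  have aR: "a \<in> R" using a sub by blast
  show ?case
  \<comment> \<open>A root supported on \<open>a\<close> alone is \<open>a\<close> itself, by
    reducedness. Otherwise a second coefficient survives the reflection in \<open>a\<close>
    unchanged and keeps the new root positive.\<close>
  proof (cases "\<exists>a'\<in>\<Delta>. a' \<noteq> a \<and> k a' \<noteq> 0")
    case False
    then have "b = (\<Sum>x\<in>\<Delta>. if x = a then of_int (k a) *\<^sub>R a else 0)"
      unfolding less(3) by (intro sum.cong) auto
    then have b: "b = of_int (k a) *\<^sub>R a" using fin a by simp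
    then have "real_of_int (k a) = 1 \<or> real_of_int (k a) = -1"
      using red aR less(2) unfolding reduced_roots_def by metis
    then have "b = a" using ka b by auto
    then show ?thesis using a by (simp add: refl_group_reflection)
  next
    case True
    then obtain a' where a': "a' \<in> \<Delta>" "a' \<noteq> a" "k a' \<noteq> 0" by blast
    obtain c where c: "cartan b a = of_int c" using cartan_Ints[OF R aR less(2)] by (auto elim: Ints_cases)
    then have "0 < c" using ka cartan_pos_iff[of a b] root_nonzero[OF R aR] by simp
    define g where "g = reflection a b"
    have gR: "g \<in> R" using root_reflection[OF R aR less(2)] by (simp add: g_def)
    have g: "g = (\<Sum>x\<in>\<Delta>. of_int ((k(a := k a - c)) x) *\<^sub>R x)"
      unfolding sum_int_comb_upd[OF fin a(1)] less(3)[symmetric] by (simp add: g_def reflection_def c)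
    obtain l :: "'a \<Rightarrow> int" where l: "g = (\<Sum>x\<in>\<Delta>. of_int (l x) *\<^sub>R x)"
      "(\<forall>a\<in>\<Delta>. 0 \<le> l a) \<or> (\<forall>a\<in>\<Delta>. l a \<le> 0)" using base gR unfolding root_base_def by blast
    have lk: "l x = (k(a := k a - c)) x" if "x \<in> \<Delta>" for x
      using independent_int_comb_unique[OF ind _ that] l(1) g by metis
    have "0 < l a'" using lk[OF a'(1)] a' less(4)[OF a'(1)] by auto
    then have pos: "\<And>x. x \<in> \<Delta> \<Longrightarrow> 0 \<le> l x" using l(2) a' by force
    have "(\<Sum>x\<in>\<Delta>. l x) = (\<Sum>x\<in>\<Delta>. k x - (if x = a then c else 0))"
      by (intro sum.cong) (auto simp: lk)
    also have "\<dots> = (\<Sum>x\<in>\<Delta>. k x) - c" using fin a by (simp add: sum_subtractf)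
    finally have "nat (\<Sum>x\<in>\<Delta>. l x) < nat (\<Sum>x\<in>\<Delta>. k x)"
      using \<open>0 < c\<close> sum_nonneg[of \<Delta> l, OF pos] by linarith
    from less(1)[OF this gR l(1) pos] have rg: "reflection g \<in> refl_group \<Delta>" by simp
    have "reflection b = reflection a \<circ> (reflection g \<circ> reflection a)"
      using reflection_conj[OF linear_reflection reflection_isometry, of a g] by (simp add: fun_eq_iff g_def)
    then show ?thesis using refl_group_comp rg refl_group_reflection[OF a(1)] by metis
  qed
qed

lemma refl_group_root_base:
  assumes R: "root_system R" and red: "reduced_roots R" and base: "root_base R \<Delta>"
  shows "refl_group R = refl_group \<Delta>"
proof
  have sub: "\<Delta> \<subseteq> R" using base by (auto simp: root_base_def)
  then show "refl_group \<Delta> \<subseteq> refl_group R" by (rule refl_group_mono)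
  show "refl_group R \<subseteq> refl_group \<Delta>"
  proof (rule refl_group_subset)
    fix b assume b: "b \<in> R"
    then obtain k :: "'a \<Rightarrow> int" where k: "b = (\<Sum>x\<in>\<Delta>. of_int (k x) *\<^sub>R x)"
      "(\<forall>a\<in>\<Delta>. 0 \<le> k a) \<or> (\<forall>a\<in>\<Delta>. k a \<le> 0)" using base unfolding root_base_def by blast
    from k(2) show "reflection b \<in> refl_group \<Delta>"
    proof
      assume "\<forall>a\<in>\<Delta>. 0 \<le> k a"
      then show ?thesis by (intro reflection_generated[OF R red base b k(1)]) blast
    next
      assume "\<forall>a\<in>\<Delta>. k a \<le> 0"
      moreover have "- b = (\<Sum>x\<in>\<Delta>. of_int (- k x) *\<^sub>R x)"
        by (subst k(1)) (simp add: sum_negf)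
      ultimately have "reflection (- b) \<in> refl_group \<Delta>"
        using reflection_generated[OF R red base root_uminus[OF R b], of "\<lambda>x. - k x"] by simp
      then show ?thesis by (simp add: reflection_uminus)
    qed
  qed
qed

lemma root_base_pair:
  assumes R: "root_system R" and base: "root_base R \<Delta>" and ab: "a \<in> \<Delta>" "b \<in> \<Delta>" "a \<noteq> b"
  shows "\<exists>x y. cartan b a = - real_of_int x \<and> cartan a b = - real_of_int y \<and>
    (x, y) \<in> {(0,0), (1,1), (1,2), (2,1), (1,3), (3,1)}"
proof -
  have ind: "independent \<Delta>" and aR: "a \<in> R" "b \<in> R" using base ab by (auto simp: root_base_def)
  have nz: "a \<noteq> 0" "b \<noteq> 0" using R aR root_nonzero by blast+
  obtain x' y' where "cartan b a = of_int x'" "cartan a b = of_int y'"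
    using cartan_Ints[OF R aR] cartan_Ints[OF R aR(2,1)] by (auto elim!: Ints_cases)
  then obtain x y where xy: "cartan b a = - real_of_int x" "cartan a b = - real_of_int y"
    by (metis minus_minus of_int_minus)
  have "a \<bullet> b \<le> 0" by (rule root_base_obtuse[OF R base ab])
  then have "cartan b a \<le> 0" "cartan a b \<le> 0" using nz by (auto simp: cartan_nonpos_iff inner_commute)
  then have nn: "0 \<le> x" "0 \<le> y" using xy by auto
  have "a \<noteq> t *\<^sub>R b" for t
  proof
    assume "a = t *\<^sub>R b"
    then have "a \<in> span (\<Delta> - {a})" using span_mul[OF span_base[of b "\<Delta> - {a}"]] ab by simp
    then show False using ind ab by (auto simp: dependent_def)
  qed
  then have "cartan a b * cartan b a < 4" using cartan_product_less_4 nz by blast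
  then have "real_of_int (x * y) < 4" using xy by (simp add: mult.commute)
  then have "x * y < 4" by linarith
  moreover have "x = 0 \<longleftrightarrow> y = 0"
    using cartan_eq_0_iff[OF nz(1), of b] cartan_eq_0_iff[OF nz(2), of a] xy by (simp add: inner_commute)
  ultimately show ?thesis using int_product_less_4[OF nn] xy by blast
qed

section \<open>A concrete model of dihedral groups\<close>

text \<open>The dihedral group of order \<open>2 * m\<close>, with \<open>(i, b)\<close> standing
  for the i-th power of a rotation, times a reflection if \<open>b\<close> holds. The factor
  \<open>m - 1\<close> plays the role of -1, keeping exponents natural. The cases
  \<open>dih 1\<close> (order two) and \<open>dih 2\<close> (Klein four-group) serve the types A1
  and 2 A1.\<close>

definition dih :: "nat \<Rightarrow> (nat \<times> bool) monoid" where
  "dih m = \<lparr>carrier = {..<m} \<times> UNIV,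
     mult = (\<lambda>(i, b) (j, c). ((i + (if b then (m - 1) * j else j)) mod m, b \<noteq> c)),
     one = (0, False)\<rparr>"

definition dih_map :: "('g, 'x) monoid_scheme \<Rightarrow> 'g \<Rightarrow> 'g \<Rightarrow> nat \<times> bool \<Rightarrow> 'g" where
  "dih_map G r s = (\<lambda>(i, b). r [^]\<^bsub>G\<^esub> i \<otimes>\<^bsub>G\<^esub> (if b then s else \<one>\<^bsub>G\<^esub>))"

lemma carrier_dih: "carrier (dih m) = {..<m} \<times> UNIV"
  by (simp add: dih_def)

lemma dih_mult_closed: "p \<in> carrier (dih m) \<Longrightarrow> q \<in> carrier (dih m) \<Longrightarrow> p \<otimes>\<^bsub>dih m\<^esub> q \<in> carrier (dih m)"
  by (auto simp: dih_def)

context monoid begin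

lemma nat_pow_mod:
  assumes "r \<in> carrier G" "r [^] (m::nat) = \<one>" shows "r [^] (k mod m) = r [^] k"
proof -
  have "r [^] k = r [^] (m * (k div m) + k mod m)" by simp
  also have "\<dots> = (r [^] m) [^] (k div m) \<otimes> r [^] (k mod m)"
    using assms(1) by (metis nat_pow_mult nat_pow_pow)
  finally show ?thesis using assms by (simp add: nat_pow_one)
qed

lemma dih_map_hom:
  assumes rs: "r \<in> carrier G" "s \<in> carrier G" and rm: "r [^] m = \<one>" and ss: "s \<otimes> s = \<one>"
    and sr: "s \<otimes> r = r [^] (m - 1) \<otimes> s"
  shows "dih_map G r s \<in> hom (dih m) G"
proof (rule homI)
  fix p assume "p \<in> carrier (dih m)"
  then show "dih_map G r s p \<in> carrier G" using rs by (cases p) (auto simp: dih_map_def)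
next
  have s_pow: "s \<otimes> r [^] j = r [^] ((m - 1) * j) \<otimes> s" for j :: nat
  proof (induction j)
    case (Suc j)
    have "s \<otimes> r [^] Suc j = (s \<otimes> r [^] j) \<otimes> r" using rs by (simp add: m_assoc)
    also have "\<dots> = r [^] ((m - 1) * j) \<otimes> (r [^] (m - 1) \<otimes> s)" using rs Suc sr by (simp add: m_assoc)
    also have "\<dots> = r [^] ((m - 1) * Suc j) \<otimes> s"
      using rs by (simp add: m_assoc[symmetric] nat_pow_mult add.commute)
    finally show ?case .
  qed (use rs in simp)
  fix p q assume "p \<in> carrier (dih m)" "q \<in> carrier (dih m)"
  obtain i b j c where pq: "p = (i, b)" "q = (j, c)" by (metis surj_pair)
  define t where "t = (\<lambda>b. if b then s else \<one>)"
  have t: "t b \<in> carrier G" for b using rs by (simp add: t_def)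
  have tt: "t b \<otimes> t c = t (b \<noteq> c)" using rs ss by (cases b; cases c) (auto simp: t_def)
  have dt: "dih_map G r s (k, d) = r [^] k \<otimes> t d" for k d by (simp add: dih_map_def t_def)
  have "dih_map G r s p \<otimes> dih_map G r s q = r [^] i \<otimes> (t b \<otimes> r [^] j) \<otimes> t c"
    using rs t by (simp add: dt pq m_assoc)
  also have "t b \<otimes> r [^] j = r [^] (if b then (m - 1) * j else j) \<otimes> t b"
    using rs s_pow by (simp add: t_def)
  also have "r [^] i \<otimes> (r [^] (if b then (m - 1) * j else j) \<otimes> t b) \<otimes> t c =
      (r [^] i \<otimes> r [^] (if b then (m - 1) * j else j)) \<otimes> (t b \<otimes> t c)"
    using rs t by (simp add: m_assoc)
  also have "\<dots> = dih_map G r s (p \<otimes>\<^bsub>dih m\<^esub> q)"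
    unfolding tt using nat_pow_mod[OF rs(1) rm] rs
    by (simp add: dt dih_def pq nat_pow_mult)
  finally show "dih_map G r s (p \<otimes>\<^bsub>dih m\<^esub> q) = dih_map G r s p \<otimes> dih_map G r s q" by simp
qed

end

lemma (in monoid) product_hom:
  assumes f: "f \<in> hom M G" and g: "g \<in> hom N G"
    and comm: "\<And>p q. p \<in> carrier M \<Longrightarrow> q \<in> carrier N \<Longrightarrow> f p \<otimes> g q = g q \<otimes> f p"
  shows "(\<lambda>(p, q). f p \<otimes> g q) \<in> hom (M \<times>\<times> N) G"
proof (rule homI)
  note c = hom_in_carrier[OF f] hom_in_carrier[OF g]
  show "(\<lambda>(p, q). f p \<otimes> g q) z \<in> carrier G" if "z \<in> carrier (M \<times>\<times> N)" for z
    using that c by (auto simp: DirProd_def)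
  fix z z' assume "z \<in> carrier (M \<times>\<times> N)" "z' \<in> carrier (M \<times>\<times> N)"
  then obtain p q p' q' where z: "z = (p, q)" "z' = (p', q')" "p \<in> carrier M" "p' \<in> carrier M"
    "q \<in> carrier N" "q' \<in> carrier N" by (auto simp: DirProd_def)
  have "f p \<otimes> f p' \<otimes> (g q \<otimes> g q') = f p \<otimes> (f p' \<otimes> g q) \<otimes> g q'" using z c by (simp add: m_assoc)
  also have "\<dots> = f p \<otimes> g q \<otimes> (f p' \<otimes> g q')"
    unfolding comm[OF z(4,5)] using z c by (simp add: m_assoc)
  finally show "(\<lambda>(p, q). f p \<otimes> g q) (z \<otimes>\<^bsub>M \<times>\<times> N\<^esub> z') = (\<lambda>(p, q). f p \<otimes> g q) z \<otimes> (\<lambda>(p, q). f p \<otimes> g q) z'"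
    using hom_mult[OF f z(3,4)] hom_mult[OF g z(5,6)] by (simp add: z)
qed

lemma (in group) dih_map_inj:
  assumes rs: "r \<in> carrier G" "s \<in> carrier G" and rm: "r [^] m = \<one>"
    and ord: "\<And>i. 0 < i \<Longrightarrow> i < m \<Longrightarrow> r [^] i \<noteq> \<one>" and s: "\<And>i. i < m \<Longrightarrow> s \<noteq> r [^] i"
  shows "inj_on (dih_map G r s) (carrier (dih m))"
proof -
  have le: "\<not> i < j" if "r [^] i = r [^] j" "j < m" for i j :: nat
  proof
    assume "i < j"
    then have "r [^] i \<otimes> r [^] (j - i) = r [^] j"
      using rs nat_pow_mult[of r i "j - i"] by simp
    then have "r [^] i \<otimes> \<one> = r [^] i \<otimes> r [^] (j - i)" using that rs by simp
    then have "r [^] (j - i) = \<one>" using rs l_cancel nat_pow_closed one_closed by metis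
    then show False using ord[of "j - i"] \<open>i < j\<close> that by simp
  qed
  \<comment> \<open>Multiplying by the \<open>(m - i)\<close>-th power of \<open>r\<close> would
    exhibit \<open>s\<close> as a power of \<open>r\<close>.\<close>
  have mixed: False if e: "r [^] i \<otimes> s = r [^] j" "i < m" for i j :: nat
  proof -
    have "r [^] (m - i) \<otimes> (r [^] i \<otimes> s) = r [^] (m - i + j)" unfolding e(1) using rs by (simp add: nat_pow_mult)
    also have "r [^] (m - i) \<otimes> (r [^] i \<otimes> s) = s"
      using e(2) rs rm by (simp add: m_assoc[symmetric] nat_pow_mult)
    finally have "s = r [^] ((m - i + j) mod m)" using nat_pow_mod[OF rs(1) rm] by simp
    moreover have "(m - i + j) mod m < m" using e(2) by simp
    ultimately show False using s by blast
  qed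
  show ?thesis
  proof (rule inj_onI)
    fix p q assume c: "p \<in> carrier (dih m)" "q \<in> carrier (dih m)" and e: "dih_map G r s p = dih_map G r s q"
    obtain i b j c where pq: "p = (i, b)" "q = (j, c)" by (metis surj_pair)
    have ij: "i < m" "j < m" using c pq by (auto simp: carrier_dih)
    have bc: "b = c"
    proof (rule ccontr)
      assume "b \<noteq> c"
      then show False using e rs mixed[of i j] mixed[of j i] ij
        by (cases b; cases c) (auto simp: pq dih_map_def)
    qed
    have "r [^] i = r [^] j" using e rs bc by (cases c) (auto simp: pq dih_map_def)
    then have "i = j" using le[of i j] le[of j i] ij by (metis linorder_neqE_nat)
    then show "p = q" using bc pq by simp
  qed
qed

subsection \<open>Pairs of simple roots\<close>

text \<open>The Cartan product of two simple roots is \<open>4 * (cos (pi / m))^2\<close>, which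
  takes the values 0, 1, 2, 3 for m = 2, 3, 4, 6; the last branch is meant for 3.\<close>

definition pair_order :: "int \<Rightarrow> nat" where
  "pair_order p = (if p = 0 then 2 else if p = 1 then 3 else if p = 2 then 4 else 6)"

text \<open>The effect of the product of two reflections, on coefficients of \<open>a\<close> and \<open>b\<close> in a coset
  \<open>z + span {a, b}\<close>, where \<open>u, v\<close> are the Cartan numbers of \<open>z\<close>.\<close>

definition rot_coeff :: "int \<Rightarrow> int \<Rightarrow> real \<Rightarrow> real \<Rightarrow> real \<times> real \<Rightarrow> real \<times> real" where
  "rot_coeff x y u v = (\<lambda>(p, q). let q' = of_int y * p - v - q in (of_int x * q' - u - p, q'))"

text \<open>The vector \<open>z\<close> is arbitrary in the whole space, so periods of the rotation
  can be read off globally and not just on the plane of \<open>a\<close> and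
  \<open>b\<close>.\<close>

lemma rot_coeff_funpow:
  assumes "a \<noteq> 0" "b \<noteq> 0" "cartan b a = - of_int x" "cartan a b = - of_int y"
  shows "((reflection a \<circ> reflection b) ^^ k) (z + p *\<^sub>R a + q *\<^sub>R b) =
    z + fst ((rot_coeff x y (cartan z a) (cartan z b) ^^ k) (p, q)) *\<^sub>R a
      + snd ((rot_coeff x y (cartan z a) (cartan z b) ^^ k) (p, q)) *\<^sub>R b"
proof (induction k)
  case (Suc k)
  have rb: "reflection b (z + p *\<^sub>R a + q *\<^sub>R b) = z + p *\<^sub>R a + (of_int y * p - cartan z b - q) *\<^sub>R b" for p q
  proof -
    have "cartan (z + p *\<^sub>R a + q *\<^sub>R b) b = cartan z b - of_int y * p + 2 * q"
      using assms by (simp add: cartan_linear cartan_self)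
    then have "reflection b (z + p *\<^sub>R a + q *\<^sub>R b) =
        z + p *\<^sub>R a + (q - (cartan z b - of_int y * p + 2 * q)) *\<^sub>R b"
      unfolding reflection_def by (metis add_diff_eq scaleR_left_diff_distrib)
    moreover have "q - (cartan z b - of_int y * p + 2 * q) = of_int y * p - cartan z b - q" by simp
    ultimately show ?thesis by metis
  qed
  have e: "u + v + w - t = u + (v - t) + w" for u v w t :: 'a by simp
  have ra: "reflection a (z + p *\<^sub>R a + q *\<^sub>R b) = z + (of_int x * q - cartan z a - p) *\<^sub>R a + q *\<^sub>R b" for p q
  proof -
    have "cartan (z + p *\<^sub>R a + q *\<^sub>R b) a = cartan z a - of_int x * q + 2 * p"
      using assms by (simp add: cartan_linear cartan_self)
    then have "reflection a (z + p *\<^sub>R a + q *\<^sub>R b) =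
        z + (p *\<^sub>R a - (cartan z a - of_int x * q + 2 * p) *\<^sub>R a) + q *\<^sub>R b"
      unfolding reflection_def using e[of z "p *\<^sub>R a" "q *\<^sub>R b"] by simp
    also have "p *\<^sub>R a - (cartan z a - of_int x * q + 2 * p) *\<^sub>R a =
        (p - (cartan z a - of_int x * q + 2 * p)) *\<^sub>R a"
      by (simp only: scaleR_left_diff_distrib)
    also have "p - (cartan z a - of_int x * q + 2 * p) = of_int x * q - cartan z a - p" by simp
    finally show ?thesis .
  qed
  have step: "reflection a (reflection b (z + p *\<^sub>R a + q *\<^sub>R b)) =
    z + fst (rot_coeff x y (cartan z a) (cartan z b) (p, q)) *\<^sub>R a
      + snd (rot_coeff x y (cartan z a) (cartan z b) (p, q)) *\<^sub>R b" for p q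
    unfolding rb ra by (simp add: rot_coeff_def Let_def algebra_simps)
  have fS: "((reflection a \<circ> reflection b) ^^ Suc k) w =
      reflection a (reflection b (((reflection a \<circ> reflection b) ^^ k) w))" for w by simp
  show ?case unfolding fS Suc step by simp
qed simp

definition pair_list :: "(int \<times> int) set" where
  "pair_list = {(0,0), (1,1), (1,2), (2,1), (1,3), (3,1)}"

text \<open>The recursion is affine in \<open>u\<close> and \<open>v\<close>; for each of the six
  pairs the period is an identity in these two unknowns.\<close>

lemma rot_coeff_period:
  assumes "(x, y) \<in> pair_list" shows "(rot_coeff x y u v ^^ pair_order (x * y)) (0, 0) = (0, 0)"
  using assms by (auto simp: pair_list_def pair_order_def rot_coeff_def eval_nat_numeral Let_def)

lemma less_6_cases: "i < (6::nat) \<Longrightarrow> i = 0 \<or> i = 1 \<or> i = 2 \<or> i = 3 \<or> i = 4 \<or> i = 5"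
  by linarith

text \<open>The parameters 2 and \<open>-y\<close> are the Cartan numbers of \<open>a\<close>
  itself, so this says that smaller powers of the rotation already move \<open>a\<close>.\<close>

lemma rot_coeff_order:
  assumes "(x, y) \<in> pair_list" "0 < i" "i < pair_order (x * y)"
  shows "(rot_coeff x y 2 (- of_int y) ^^ i) (0, 0) \<noteq> (0, 0)"
proof -
  have "i < 6" using assms(3) by (auto simp: pair_order_def split: if_splits)
  from less_6_cases[OF this] show ?thesis
    using assms by (auto simp: pair_list_def pair_order_def rot_coeff_def eval_nat_numeral Let_def)
qed

text \<open>For the parameters of \<open>a\<close>, the value \<open>(-2, 0)\<close> means that
  \<open>a\<close> goes to \<open>-a\<close>; for those of \<open>b\<close>, the value
  \<open>(x, 0)\<close> means that \<open>b\<close> goes to \<open>b + x a\<close>. A power of the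
  rotation with both properties would agree with the reflection in \<open>a\<close> on the
  plane.\<close>

lemma rot_coeff_no_reflection:
  assumes "(x, y) \<in> pair_list" "i < pair_order (x * y)"
    "(rot_coeff x y 2 (- of_int y) ^^ i) (0, 0) = (-2, 0)"
  shows "(rot_coeff x y (- of_int x) 2 ^^ i) (0, 0) \<noteq> (of_int x, 0)"
proof -
  have "i < 6" using assms(2) by (auto simp: pair_order_def split: if_splits)
  from less_6_cases[OF this] show ?thesis
    using assms by (auto simp: pair_list_def pair_order_def rot_coeff_def eval_nat_numeral Let_def)
qed

lemma independent_pair_coeff:
  fixes a b :: "'a::euclidean_space"
  assumes "independent {a, b}" "a \<noteq> b" "p *\<^sub>R a + q *\<^sub>R b = 0" shows "p = 0 \<and> q = 0"
  using independentD[OF assms(1), of "{a, b}" "\<lambda>x. if x = a then p else q"] assms(2,3) by force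

text \<open>\<open>x\<close> and \<open>y\<close> are the negated Cartan numbers, hence nonnegative,
  as is natural for two simple roots at an obtuse or right angle.\<close>

locale root_pair =
  fixes a b :: "'a::euclidean_space" and x y :: int
  assumes ind: "independent {a, b}" and neq: "a \<noteq> b"
    and cart: "cartan b a = - of_int x" "cartan a b = - of_int y" and xy: "(x, y) \<in> pair_list"
begin

abbreviation rot :: "'a \<Rightarrow> 'a" where "rot \<equiv> reflection a \<circ> reflection b"
abbreviation m :: nat where "m \<equiv> pair_order (x * y)"

lemma nz: "a \<noteq> 0" "b \<noteq> 0"
  using ind dependent_zero by auto

lemma m_pos: "0 < m"
  by (simp add: pair_order_def)

lemma rot_funpow: "(rot ^^ k) z = z + fst ((rot_coeff x y (cartan z a) (cartan z b) ^^ k) (0, 0)) *\<^sub>R a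
      + snd ((rot_coeff x y (cartan z a) (cartan z b) ^^ k) (0, 0)) *\<^sub>R b"
  using rot_coeff_funpow[OF nz cart, of k z 0 0] by simp

lemma rot_order: "rot ^^ m = id"
  by (simp add: fun_eq_iff rot_funpow rot_coeff_period[OF xy])

lemma rot_order_min:
  assumes "0 < i" "i < m" shows "rot ^^ i \<noteq> id"
proof
  assume "rot ^^ i = id"
  then have "(rot ^^ i) a = a" by simp
  then have "fst ((rot_coeff x y 2 (- of_int y) ^^ i) (0, 0)) *\<^sub>R a
      + snd ((rot_coeff x y 2 (- of_int y) ^^ i) (0, 0)) *\<^sub>R b = 0"
    unfolding rot_funpow by (simp add: cartan_self nz cart)
  from independent_pair_coeff[OF ind neq this] rot_coeff_order[OF xy assms]
  show False by (simp add: prod_eq_iff)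
qed

lemma reflection_neq_rot:
  assumes "i < m" shows "reflection a \<noteq> rot ^^ i"
proof
  assume e: "reflection a = rot ^^ i"
  have 1: "(rot ^^ i) a = - a" unfolding e[symmetric] by (rule reflection_self)
  let ?A = "(rot_coeff x y 2 (- of_int y) ^^ i) (0, 0)" and ?B = "(rot_coeff x y (- of_int x) 2 ^^ i) (0, 0)"
  have "(fst ?A + 2) *\<^sub>R a + snd ?A *\<^sub>R b = 0"
    using 1 unfolding rot_funpow by (simp add: cartan_self nz cart algebra_simps scaleR_2)
  from independent_pair_coeff[OF ind neq this] have A: "?A = (-2, 0)" by (simp add: prod_eq_iff)
  have 2: "(rot ^^ i) b = b + of_int x *\<^sub>R a" unfolding e[symmetric] by (simp add: reflection_def cart)
  have "(fst ?B - of_int x) *\<^sub>R a + snd ?B *\<^sub>R b = 0"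
    using 2 unfolding rot_funpow by (simp add: cartan_self nz cart algebra_simps)
  from independent_pair_coeff[OF ind neq this] have "?B = (of_int x, 0)" by (simp add: prod_eq_iff)
  then show False using rot_coeff_no_reflection[OF xy assms A] by simp
qed

lemma rot_refl_group: "rot \<in> refl_group {a, b}"
  by (intro refl_group_comp refl_group_reflection) auto

context
  fixes R assumes abR: "{a, b} \<subseteq> R"
begin

abbreviation pair_map :: "nat \<times> bool \<Rightarrow> 'a \<Rightarrow> 'a" where
  "pair_map \<equiv> dih_map (weyl_group R) rot (reflection a)"

lemma sub: "refl_group {a, b} \<subseteq> refl_group R"
  using refl_group_mono[OF abR] .

lemma rot_in: "rot \<in> refl_group R" and refl_in: "reflection a \<in> refl_group R" "reflection b \<in> refl_group R"
  using sub rot_refl_group abR refl_group_reflection by auto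

lemma pair_map_simp: "pair_map (i, c) = (rot ^^ i) \<circ> (if c then reflection a else id)"
  using rot_in refl_in
  by (simp add: dih_map_def weyl_group_pow weyl_group_one weyl_group_mult refl_group_funpow refl_group_id)

lemma rot_inverse: "rot ^^ (m - 1) = reflection b \<circ> reflection a"
proof -
  have "(rot ^^ (m - 1)) \<circ> rot = id"
    using rot_order m_pos by (metis Suc_diff_1 funpow_Suc_right)
  then have "(rot ^^ (m - 1)) \<circ> rot \<circ> (reflection b \<circ> reflection a) = reflection b \<circ> reflection a" by simp
  then show ?thesis by (simp add: fun_eq_iff)
qed

lemma pair_map_hom: "pair_map \<in> hom (dih m) (weyl_group R)"
proof -
  interpret group "weyl_group R" by (rule group_weyl_group)
  show ?thesis
  proof (rule dih_map_hom)
    show "reflection a \<otimes>\<^bsub>weyl_group R\<^esub> rot = rot [^]\<^bsub>weyl_group R\<^esub> (m - 1) \<otimes>\<^bsub>weyl_group R\<^esub> reflection a"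
      using rot_in refl_in rot_inverse
      by (simp add: weyl_group_mult weyl_group_pow refl_group_comp) (simp add: fun_eq_iff)
  qed (use rot_in refl_in rot_order in
    \<open>simp_all add: carrier_weyl_group weyl_group_pow weyl_group_mult weyl_group_one\<close>)
qed

lemma pair_map_inj: "inj_on pair_map (carrier (dih m))"
proof -
  interpret group "weyl_group R" by (rule group_weyl_group)
  show ?thesis
    by (rule dih_map_inj)
      (use rot_in refl_in rot_order rot_order_min reflection_neq_rot in
        \<open>simp_all add: carrier_weyl_group weyl_group_pow weyl_group_mult weyl_group_one\<close>)
qed

lemma pair_map_image: "pair_map ` carrier (dih m) = refl_group {a, b}"
proof
  show "pair_map ` carrier (dih m) \<subseteq> refl_group {a, b}"
  proof clarify
    fix i c
    have "(if c then reflection a else id) \<in> refl_group {a, b}"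
      by (cases c) (simp_all only: if_True if_False refl_group_reflection insertI1 refl_group_id)
    then show "pair_map (i, c) \<in> refl_group {a, b}"
      unfolding pair_map_simp by (rule refl_group_comp[OF refl_group_funpow[OF rot_refl_group]])
  qed
  have c0: "(0, True) \<in> carrier (dih m)" and c1: "(1, True) \<in> carrier (dih m)"
    by (auto simp: carrier_dih pair_order_def)
  have r: "pair_map (0, True) = reflection a" by (simp add: pair_map_simp fun_eq_iff)
  have cb: "(m - 1, True) \<in> carrier (dih m)" using m_pos by (simp add: carrier_dih)
  \<comment> \<open>The inverse rotation followed on the right by the reflection in \<open>a\<close>
    is the reflection in \<open>b\<close>, so both generators lie in the image.\<close>
  have rb: "pair_map (m - 1, True) = reflection b"
    unfolding pair_map_simp rot_inverse by (simp add: fun_eq_iff)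
  show "refl_group {a, b} \<subseteq> pair_map ` carrier (dih m)"
  proof
    fix w assume "w \<in> refl_group {a, b}"
    then show "w \<in> pair_map ` carrier (dih m)"
    proof induction
      case refl_group_id
      have "pair_map (0, False) = id" by (simp add: pair_map_simp fun_eq_iff)
      moreover have "(0, False) \<in> carrier (dih m)" using m_pos by (simp add: carrier_dih)
      ultimately show ?case by (metis image_eqI)
    next
      case (refl_group_step c w)
      then obtain p where p: "p \<in> carrier (dih m)" "w = pair_map p" by blast
      obtain q where q: "q \<in> carrier (dih m)" "reflection c = pair_map q"
        using refl_group_step(1) r rb c0 cb by (metis insertE singletonD)
      have "w \<in> refl_group R" using refl_group_step sub by blast
      moreover have "reflection c \<in> refl_group R" using refl_group_step(1) refl_in by blast
      ultimately have "reflection c \<circ> w = pair_map (q \<otimes>\<^bsub>dih m\<^esub> p)"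
        using hom_mult[OF pair_map_hom q(1) p(1)] p q by (simp add: weyl_group_mult)
      then show ?case using dih_mult_closed[OF q(1) p(1)] by blast
    qed
  qed
qed

end

lemma card_refl_group_pair: "card (refl_group {a, b}) = 2 * m"
proof -
  have "card (refl_group {a, b}) = card (carrier (dih m))"
    using card_image[OF pair_map_inj[OF subset_refl]] pair_map_image[OF subset_refl] by simp
  then show ?thesis by (simp add: carrier_dih card_cartesian_product card_UNIV_bool)
qed

text \<open>Rotations have order dividing \<open>m\<close>, all other elements are involutions;
  hence the two divisibility conditions on \<open>e\<close>.\<close>

lemma refl_group_pair_exponent:
  assumes w: "w \<in> refl_group {a, b}" and e: "m dvd e" "even e" shows "w ^^ e = id"
proof -
  obtain i c where ic: "(i, c) \<in> carrier (dih m)" "w = pair_map {a, b} (i, c)"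
    using w pair_map_image[OF subset_refl] by (metis imageE surj_pair)
  show ?thesis
  proof (cases c)
    case False
    then have "w = rot ^^ i" using ic(2) by (simp add: pair_map_simp[OF subset_refl])
    obtain k where k: "e = m * k" using e by blast
    have "w ^^ e = rot ^^ (i * e)" unfolding \<open>w = rot ^^ i\<close> funpow_mult by (simp add: mult.commute)
    also have "\<dots> = (rot ^^ m) ^^ (k * i)" unfolding funpow_mult k by (simp add: ac_simps)
    finally show ?thesis by (simp add: rot_order)
  next
    case True
    have "i + (m - 1) * i = m * i" using m_pos by (cases m) auto
    then have "(i, c) \<otimes>\<^bsub>dih m\<^esub> (i, c) = (0, False)" using True by (simp add: dih_def)
    then have "w \<circ> w = pair_map {a, b} (0, False)"
      using hom_mult[OF pair_map_hom[OF subset_refl] ic(1) ic(1)] ic(2) w by (simp add: weyl_group_mult)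
    then have "w \<circ> w = id" by (simp add: pair_map_simp[OF subset_refl] fun_eq_iff)
    then have "w ^^ 2 = id" by (simp add: eval_nat_numeral fun_eq_iff)
    obtain k where k: "e = 2 * k" using e by blast
    have "w ^^ e = (w ^^ 2) ^^ k" unfolding funpow_mult k by (simp add: mult.commute)
    then show ?thesis unfolding \<open>w ^^ 2 = id\<close> by simp
  qed
qed

end

lemma root_base_root_pair:
  assumes R: "root_system R" and base: "root_base R \<Delta>" and ab: "a \<in> \<Delta>" "b \<in> \<Delta>" "a \<noteq> b"
  shows "\<exists>x y. root_pair a b x y"
proof -
  have "independent \<Delta>" using base by (simp add: root_base_def)
  then have "independent {a, b}" by (rule independent_mono) (use ab in auto)
  then show ?thesis using root_base_pair[OF R base ab] ab(3)
    by (auto simp: root_pair_def pair_list_def)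
qed

lemma card_refl_group_single:
  assumes "a \<noteq> 0" shows "card (refl_group {a}) = 2"
proof -
  have "w \<in> {id, reflection a}" if "w \<in> refl_group {a}" for w
    using that by induction (auto simp: fun_eq_iff)
  then have "refl_group {a} = {id, reflection a}"
    using refl_group_id refl_group_reflection[of a "{a}"] by blast
  moreover have "reflection a a \<noteq> a"
  proof
    assume "reflection a a = a"
    then have "2 *\<^sub>R a = 0" by (metis reflection_self add.right_inverse scaleR_2)
    then show False using assms by simp
  qed
  then have "reflection a \<noteq> id" by (metis id_apply)
  ultimately show ?thesis by (metis card_2_iff)
qed

text \<open>Every further independent vector at least doubles the order.\<close>

lemma refl_group_card_ge:
  fixes A :: "'a::euclidean_space set"
  assumes "independent A" "finite (refl_group A)" shows "2 ^ card A \<le> card (refl_group A)"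
  using finiteI_independent[OF assms(1)] assms
proof (induction A rule: finite_induct)
  case (insert a A)
  have ind: "independent ({a} \<union> A)" and fin: "finite (refl_group ({a} \<union> A))" using insert by auto
  have "finite (refl_group A)" "independent A"
    using insert refl_group_mono[of A "insert a A"] finite_subset independent_mono subset_insertI by metis+
  then have IH: "2 ^ card A \<le> card (refl_group A)" using insert by blast
  have "a \<noteq> 0" using insert dependent_zero by blast
  then have "2 * card (refl_group A) \<le> card (refl_group (insert a A))"
    using refl_group_card_mult[OF ind _ fin] insert by (simp add: card_refl_group_single)
  then show ?case using IH insert by simp
next
  case empty
  have "finite (refl_group ({} :: 'a set))" "id \<in> refl_group ({} :: 'a set)"
    using empty by (auto intro: refl_group_id simp del: id_apply)
  then have "0 < card (refl_group ({} :: 'a set))" by (metis card_gt_0_iff empty_iff)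
  then show ?case by simp
qed

lemma span_scaleR_iff:
  fixes x :: "'a::real_vector"
  shows "c *\<^sub>R x \<in> span S \<longleftrightarrow> c = 0 \<or> x \<in> span S"
  using span_scale[of "c *\<^sub>R x" S "inverse c"] span_scale[of x S c]
  by (cases "c = 0") (auto simp: span_zero)

text \<open>"iso" means isolated: \<open>a\<close> and \<open>b\<close> form a connected component
  of the Dynkin diagram.\<close>

definition iso_pair :: "'a::euclidean_space set \<Rightarrow> 'a \<Rightarrow> 'a \<Rightarrow> bool" where
  "iso_pair \<Delta> a b \<longleftrightarrow> a \<in> \<Delta> \<and> b \<in> \<Delta> \<and> a \<noteq> b \<and> a \<bullet> b \<noteq> 0 \<and>
     (\<forall>d\<in>\<Delta> - {a, b}. d \<bullet> a = 0 \<and> d \<bullet> b = 0)"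

lemma funpow_comp_commute: "u \<circ> v = v \<circ> u \<Longrightarrow> (u \<circ> v) ^^ k = u ^^ k \<circ> v ^^ k"
proof (induction k)
  case (Suc k)
  have c: "v \<circ> u ^^ k = u ^^ k \<circ> v"
  proof (induction k)
    case (Suc k)
    then show ?case using \<open>u \<circ> v = v \<circ> u\<close> by (metis comp_assoc funpow.simps(2))
  qed simp
  have "(u \<circ> v) ^^ Suc k = (u \<circ> v) \<circ> (u ^^ k \<circ> v ^^ k)"
    by (simp only: funpow.simps Suc.IH[OF Suc.prems])
  also have "\<dots> = u \<circ> (v \<circ> u ^^ k) \<circ> v ^^ k" by (simp only: comp_assoc)
  also have "\<dots> = (u \<circ> u ^^ k) \<circ> (v \<circ> v ^^ k)" unfolding c by (simp only: comp_assoc)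
  finally show ?case by (simp only: funpow.simps)
qed simp

text \<open>The group splits into the dihedral group of the pair and a commuting factor that fixes
  \<open>a\<close>.\<close>

lemma iso_pair_exponent:
  assumes iso: "iso_pair \<Delta> a b" and pair: "root_pair a b x y" and w: "w \<in> refl_group \<Delta>"
    and e: "pair_order (x * y) dvd e" "even e"
  shows "(w ^^ e) a = a"
proof -
  have orth: "\<And>s t. s \<in> {a, b} \<Longrightarrow> t \<in> \<Delta> - {a, b} \<Longrightarrow> s \<bullet> t = 0"
    using iso by (auto simp: iso_pair_def inner_commute)
  have "\<Delta> = {a, b} \<union> (\<Delta> - {a, b})" using iso by (auto simp: iso_pair_def)
  then obtain u v where uv: "u \<in> refl_group {a, b}" "v \<in> refl_group (\<Delta> - {a, b})" "w = u \<circ> v"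
    using refl_group_mult_surj[of "{a, b}" "\<Delta> - {a, b}" w] orth w by metis
  have c: "u \<circ> v = v \<circ> u" using refl_group_commute[OF orth uv(1,2)] by blast
  have "w ^^ e = v ^^ e"
    unfolding uv(3) funpow_comp_commute[OF c] root_pair.refl_group_pair_exponent[OF pair uv(1) e] by simp
  moreover have "(v ^^ e) a = a"
    using orth by (intro refl_group_orthogonal[OF refl_group_funpow[OF uv(2)]]) blast
  ultimately show ?thesis by simp
qed

lemma even_funpow_sign:
  fixes a :: "'a::real_vector"
  assumes "linear c" "c a = a \<or> c a = - a" "even e" shows "(c ^^ e) a = a"
proof -
  obtain k where k: "e = 2 * k" using assms(3) by blast
  have "c (c a) = a" using assms(1,2) by (metis linear_neg minus_minus)
  then have "(c ^^ 2) a = a" by (simp add: eval_nat_numeral)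
  then have "((c ^^ 2) ^^ k) a = a" by (induction k) auto
  then show ?thesis unfolding funpow_mult k by (simp add: mult.commute)
qed

lemma exists_funpow_eq_id:
  assumes "finite C" "bij r" "\<And>i. r ^^ i \<in> C" shows "\<exists>m>0. r ^^ m = id"
proof -
  have "\<not> inj (\<lambda>i. r ^^ i)"
    using finite_subset[OF _ assms(1), of "range (\<lambda>i. r ^^ i)"] assms(3) finite_imageD[of "\<lambda>i. r ^^ i" UNIV] by blast
  then obtain i j where ij: "i < j" "r ^^ i = r ^^ j"
    unfolding inj_def by (metis linorder_neqE_nat)
  then have "r ^^ i \<circ> id = r ^^ i \<circ> r ^^ (j - i)" by (metis comp_id funpow_add le_add_diff_inverse less_imp_le)
  moreover have "inj (r ^^ i)" using assms(2) bij_is_inj inj_fn by blast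
  ultimately have "r ^^ (j - i) = id" by (metis fun.inj_map_strong inj_eq fun_eq_iff comp_apply)
  then show ?thesis using ij by (intro exI[of _ "j - i"]) auto
qed

text \<open>With \<open>m\<close> the order of \<open>r\<close>, the powers of \<open>r\<close> are
  \<open>m\<close> distinct solutions of \<open>c ^^ m = id\<close>, and no more are
  allowed.\<close>

lemma root_of_unity_power:
  assumes fin: "finite C" and r: "bij r" "\<And>i. r ^^ i \<in> C"
    and few: "\<And>m. 0 < m \<Longrightarrow> card {c\<in>C. c ^^ m = id} \<le> m"
  shows "\<exists>m>0. r ^^ m = id \<and> (\<forall>c\<in>C. c ^^ m = id \<longrightarrow> (\<exists>i. c = r ^^ i))"
proof -
  define m where "m = (LEAST m. 0 < m \<and> r ^^ m = id)"
  have m: "0 < m \<and> r ^^ m = id"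
    unfolding m_def by (rule LeastI_ex) (use exists_funpow_eq_id[OF fin r] in blast)
  have least: "r ^^ k \<noteq> id" if "0 < k" "k < m" for k
    using not_less_Least[of k "\<lambda>m. 0 < m \<and> r ^^ m = id"] that unfolding m_def by blast
  have ne: "r ^^ i \<noteq> r ^^ j" if "i < j" "j < m" for i j
  proof
    assume "r ^^ i = r ^^ j"
    then have "r ^^ i \<circ> id = r ^^ i \<circ> r ^^ (j - i)" using that by (metis comp_id funpow_add le_add_diff_inverse less_imp_le)
    moreover have "inj (r ^^ i)" using r bij_is_inj inj_fn by blast
    ultimately have "r ^^ (j - i) = id" by (metis inj_eq fun_eq_iff comp_apply)
    then show False using least[of "j - i"] that by simp
  qed
  have "inj_on (\<lambda>i. r ^^ i) {..<m}"
    by (rule inj_onI) (metis lessThan_iff linorder_neqE_nat ne)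
  then have card: "card ((\<lambda>i. r ^^ i) ` {..<m}) = m" by (simp add: card_image)
  have "(\<lambda>i. r ^^ i) ` {..<m} \<subseteq> {c\<in>C. c ^^ m = id}"
  proof clarify
    fix i
    have "(r ^^ i) ^^ m = (r ^^ m) ^^ i" by (simp add: funpow_mult mult.commute)
    then show "r ^^ i \<in> C \<and> (r ^^ i) ^^ m = id" using m r(2) by simp
  qed
  then have "(\<lambda>i. r ^^ i) ` {..<m} = {c\<in>C. c ^^ m = id}"
    by (rule card_seteq[rotated]) (use fin few[of m] m card in auto)
  then show ?thesis using m by blast
qed

section \<open>Bounding the rank by counting\<close>

text \<open>This is what the field contributes: \<open>C_roots\<close> because elements of
  \<open>C\<close> act as scalars, \<open>W_card\<close> because there are at most as many
  automorphism parts as the degree, \<open>C_cube\<close> because a cubic field contains no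
  primitive cube root of unity. From here on the forward direction is geometry and counting.\<close>

locale weyl_cyclic =
  fixes R \<Delta> :: "'a::euclidean_space set" and C :: "('a \<Rightarrow> 'a) set"
  assumes R: "root_system R" and red: "reduced_roots R" and base: "root_base R \<Delta>"
    and normal: "C \<lhd> weyl_group R"
    and C_roots: "\<And>m. 0 < m \<Longrightarrow> card {c\<in>C. c ^^ m = id} \<le> m"
    and W_card: "card (refl_group R) \<le> card \<Delta> * card C"
    and C_cube: "\<And>c. card \<Delta> = 3 \<Longrightarrow> c \<in> C \<Longrightarrow> c ^^ 3 = id \<Longrightarrow> c = id"
begin

lemma W: "refl_group R = refl_group \<Delta>"
  by (rule refl_group_root_base[OF R red base])

lemma C_sub: "C \<subseteq> refl_group R" and C_id: "id \<in> C"
  and C_comp: "c \<in> C \<Longrightarrow> d \<in> C \<Longrightarrow> c \<circ> d \<in> C"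
  and C_inv: "c \<in> C \<Longrightarrow> \<exists>d\<in>C. c \<circ> d = id \<and> d \<circ> c = id"
  and C_normal: "c \<in> C \<Longrightarrow> w \<in> refl_group R \<Longrightarrow> v \<in> refl_group R \<Longrightarrow> v \<circ> w = id \<Longrightarrow> w \<circ> c \<circ> v \<in> C"
proof -
  interpret C: normal C "weyl_group R" by (rule normal)
  note C = subgroup.one_closed[OF C.subgroup_axioms] subgroup.m_closed[OF C.subgroup_axioms]
    subgroup.m_inv_closed[OF C.subgroup_axioms]
  have sub: "c \<in> refl_group R" if "c \<in> C" for c using C.mem_carrier[OF that] by (simp add: carrier_weyl_group)
  then show "C \<subseteq> refl_group R" by blast
  show "id \<in> C" using C(1) unfolding weyl_group_one .
  show "c \<in> C \<Longrightarrow> d \<in> C \<Longrightarrow> c \<circ> d \<in> C" using C(2)[of c d] weyl_group_mult[of c R d] sub by simp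
  show "c \<in> C \<Longrightarrow> \<exists>d\<in>C. c \<circ> d = id \<and> d \<circ> c = id"
    using C.r_inv[of c] C.l_inv[of c] C(3)[of c] sub weyl_group_mult
    by (metis C.mem_carrier weyl_group_one)
  show "w \<circ> c \<circ> v \<in> C" if c: "c \<in> C" and w: "w \<in> refl_group R" "v \<in> refl_group R" "v \<circ> w = id"
  proof -
    have "inv\<^bsub>weyl_group R\<^esub> w = v"
      using w by (intro C.inv_equality) (simp_all add: weyl_group_mult weyl_group_one carrier_weyl_group)
    moreover have "w \<circ> c \<in> refl_group R" by (rule refl_group_comp[OF w(1) sub[OF c]])
    ultimately show ?thesis
      using C.inv_op_closed2[of w c] c w sub by (simp add: weyl_group_mult carrier_weyl_group)
  qed
qed

lemma fin_W: "finite (refl_group \<Delta>)"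
  using finite_refl_group[OF R] W by simp

lemma fin_C: "finite C"
  using C_sub fin_W W finite_subset by metis

lemma indep: "independent \<Delta>" and span_D: "span \<Delta> = UNIV" and D_sub: "\<Delta> \<subseteq> R" and fin_D: "finite \<Delta>"
  using base root_base_finite by (auto simp: root_base_def)

lemma D_nonzero: "a \<in> \<Delta> \<Longrightarrow> a \<noteq> 0"
  using D_sub root_nonzero[OF R] by blast

lemma C_funpow: "c \<in> C \<Longrightarrow> c ^^ k \<in> C"
  by (induction k) (simp_all only: funpow.simps C_id C_comp)

text \<open>Elements of \<open>C\<close> are isometries, so this says that \<open>C\<close>
  preserves the line through \<open>a\<close>.\<close>

definition good :: "'a \<Rightarrow> bool" where
  "good a \<longleftrightarrow> (\<forall>c\<in>C. c a = a \<or> c a = - a)"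

lemmas exists_root_pair = root_base_root_pair[OF R base]

text \<open>The conjugate of \<open>?r\<close> by \<open>w\<close> lies in \<open>C\<close> and is
  killed by the same power, hence is a power of \<open>?r\<close>. So \<open>w\<close> carries
  displacements under \<open>?r\<close> to displacements under a power of \<open>?r\<close>, which
  stay within \<open>span {a, c a}\<close>. It remains to write a nonzero multiple of
  \<open>a\<close> as a displacement under \<open>?r\<close>.\<close>

lemma bad_span_invariant:
  assumes a: "a \<in> \<Delta>" and c: "c \<in> C" "c a \<noteq> a" "c a \<noteq> - a" and w: "w \<in> refl_group \<Delta>"
  shows "w a \<in> span {a, c a}"
proof -
  let ?s = "reflection a"
  let ?r = "?s \<circ> reflection (c a)"
  have sR: "?s \<in> refl_group R" using a D_sub by (auto intro: refl_group_reflection)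
  have cW: "c \<in> refl_group R" using c C_sub by blast
  obtain d where d: "d \<in> C" "c \<circ> d = id" "d \<circ> c = id" using C_inv c by blast
  have "reflection (c a) = c \<circ> ?s \<circ> d"
  proof
    fix z
    have "c (?s (d z)) = reflection (c a) (c (d z))"
      by (rule reflection_conj[OF refl_group_linear[OF cW] refl_group_isometry[OF cW]])
    then show "reflection (c a) z = (c \<circ> ?s \<circ> d) z" using d(2) by (simp add: fun_eq_iff)
  qed
  \<comment> \<open>In this form \<open>?r\<close> is visibly the product of a conjugate of
    \<open>c\<close> and the inverse of \<open>c\<close>.\<close>
  then have "?r = (?s \<circ> c \<circ> ?s) \<circ> d" by (simp only: comp_assoc)
  moreover have "?s \<circ> c \<circ> ?s \<in> C" using C_normal[OF c(1) sR sR] by simp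
  ultimately have rC: "?r \<in> C" using C_comp d by simp
  have r_pow: "?r ^^ i \<in> C" for i using C_funpow[OF rC] .
  have "bij ?r" using rC C_sub refl_group_bij by blast
  from root_of_unity_power[OF fin_C this r_pow C_roots] obtain m where
    m: "0 < m" "?r ^^ m = id" "\<And>c. c \<in> C \<Longrightarrow> c ^^ m = id \<Longrightarrow> \<exists>i. c = ?r ^^ i" by blast
  obtain v where v: "v \<in> refl_group \<Delta>" "v \<circ> w = id" "w \<circ> v = id" using refl_group_inverse[OF w] by blast
  have conj_pow: "(w \<circ> ?r \<circ> v) ^^ k = w \<circ> ?r ^^ k \<circ> v" for k
  proof (induction k)
    case (Suc k)
    have "(w \<circ> ?r \<circ> v) ^^ Suc k = (w \<circ> ?r \<circ> v) \<circ> (w \<circ> ?r ^^ k \<circ> v)"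
      unfolding funpow.simps Suc ..
    also have "\<dots> = w \<circ> ?r \<circ> (v \<circ> w) \<circ> ?r ^^ k \<circ> v" by (simp only: comp_assoc)
    also have "\<dots> = w \<circ> (?r \<circ> ?r ^^ k) \<circ> v" unfolding v(2) comp_id by (simp only: comp_assoc)
    finally show ?case by (simp only: funpow.simps)
  next
    case 0
    show ?case using v(3) by (simp only: funpow.simps comp_id)
  qed
  have "w \<circ> ?r \<circ> v \<in> C" using C_normal[OF rC] w v W by metis
  moreover have "(w \<circ> ?r \<circ> v) ^^ m = id" unfolding conj_pow m(2) comp_id by (rule v(3))
  ultimately obtain i where i: "w \<circ> ?r \<circ> v = ?r ^^ i" using m(3) by blast
  have "w \<circ> ?r = (w \<circ> ?r \<circ> v) \<circ> w" using v(2) by (metis comp_assoc comp_id)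
  then have wr: "w (?r z) = (?r ^^ i) (w z)" for z unfolding i by (metis comp_apply)
  have rP: "?r ^^ i \<in> refl_group {a, c a}"
    by (intro refl_group_funpow refl_group_comp refl_group_reflection) auto
  have moved: "w (?r z) - w z \<in> span {a, c a}" for z
    unfolding wr using refl_group_moves[OF rP] .
  define g where "g = c a"
  have gg: "g \<bullet> g = a \<bullet> a" using refl_group_isometry[OF cW] by (simp add: g_def)
  have a0: "a \<noteq> 0" using a D_nonzero by blast
  then have g0: "g \<noteq> 0" using gg by auto
  have np: "a \<noteq> t *\<^sub>R g" for t
  proof
    assume t: "a = t *\<^sub>R g"
    then have "t * t * (g \<bullet> g) = g \<bullet> g" using gg by (metis inner_scaleR_left inner_scaleR_right mult.assoc)
    then have "t * t = 1" using g0 by simp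
    then have "t = 1 \<or> t = -1" by (simp add: square_eq_1_iff)
    then show False using t c by (metis g_def scaleR_one scaleR_minus1_left minus_minus)
  qed
  \<comment> \<open>The part of \<open>a\<close> orthogonal to \<open>c a\<close>. By the strict
    Cauchy-Schwarz inequality it is not orthogonal to \<open>a\<close>, so \<open>?r\<close>
    displaces it by a nonzero multiple of \<open>a\<close>.\<close>
  define z where "z = a - ((a \<bullet> g) / (g \<bullet> g)) *\<^sub>R g"
  have zg: "z \<bullet> g = 0" using g0 by (simp add: z_def inner_diff_left)
  have "z \<bullet> a = (a \<bullet> a) - (a \<bullet> g)\<^sup>2 / (g \<bullet> g)"
    by (simp add: z_def inner_diff_left inner_commute[of g a] power2_eq_square)
  moreover have "(a \<bullet> g)\<^sup>2 / (g \<bullet> g) < a \<bullet> a"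
    using Cauchy_Schwarz_strict[OF g0 np] g0 by (simp add: divide_less_eq)
  ultimately have za: "cartan z a \<noteq> 0" using a0 by (simp add: cartan_eq_0_iff)
  have lw: "linear w" by (rule refl_group_linear[OF w])
  have "?r z = z - cartan z a *\<^sub>R a"
    using reflection_orthogonal[OF zg] by (simp add: g_def[symmetric] reflection_def[of a])
  then have "w (?r z) - w z = - (cartan z a *\<^sub>R w a)" using lw by (simp add: linear_diff linear_cmul)
  then have "cartan z a *\<^sub>R w a \<in> span {a, c a}" using moved[of z] span_neg by (metis minus_minus)
  then show ?thesis using za by (metis span_scaleR_iff)
qed

text \<open>The orbit of \<open>a\<close> lies in the plane of \<open>a\<close> and
  \<open>c a\<close>. Applying the reflection in a simple root \<open>d\<close> to these two vectors
  shows that \<open>d\<close> is in the plane or orthogonal to it, and a plane has room for only two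
  simple roots.\<close>

lemma good_or_iso_pair:
  assumes a: "a \<in> \<Delta>" and bad: "\<not> good a" shows "\<exists>b. iso_pair \<Delta> a b"
proof -
  obtain c where c: "c \<in> C" "c a \<noteq> a" "c a \<noteq> - a" using bad by (auto simp: good_def)
  define P where "P = span {a, c a}"
  have cW: "c \<in> refl_group \<Delta>" using c C_sub W by blast
  have orbit: "w a \<in> P" if "w \<in> refl_group \<Delta>" for w
    unfolding P_def by (rule bad_span_invariant[OF a c that])
  have aP: "a \<in> P" and caP: "c a \<in> P" by (auto simp: P_def span_base)
  have split: "d \<in> P \<or> z \<bullet> d = 0" if d: "d \<in> \<Delta>" and z: "z \<in> {a, c a}" for d z
  proof -
    have "reflection d z \<in> P"
      using z orbit[OF refl_group_reflection[OF d]] orbit[OF refl_group_step[OF d cW]] by auto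
    moreover have "z \<in> P" using z aP caP by blast
    ultimately have "cartan z d *\<^sub>R d \<in> P"
      unfolding P_def reflection_def by (metis diff_diff_eq2 add_diff_cancel_left' span_diff)
    then have "cartan z d = 0 \<or> d \<in> P" unfolding P_def by (metis span_scaleR_iff)
    then show ?thesis using cartan_eq_0_iff[OF D_nonzero[OF d]] by blast
  qed
  \<comment> \<open>If \<open>a\<close> were orthogonal to all other simple roots, its orbit would
    consist of \<open>a\<close> and \<open>-a\<close>, against the choice of
    \<open>c\<close>.\<close>
  obtain b where b: "b \<in> \<Delta>" "b \<noteq> a" "a \<bullet> b \<noteq> 0"
  proof (rule ccontr)
    assume "\<not> thesis"
    with that have o: "\<And>d. d \<in> \<Delta> \<Longrightarrow> d \<noteq> a \<Longrightarrow> a \<bullet> d = 0" by blast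
    have "w a = a \<or> w a = - a" if "w \<in> refl_group \<Delta>" for w
      using that
    proof induction
      case (refl_group_step d w)
      then show ?case
        using o[of d] by (cases "d = a")
          (auto simp: reflection_self reflection_orthogonal linear_neg[OF linear_reflection])
    qed simp
    then show False using c cW by blast
  qed
  have bP: "b \<in> P" using split[of b a] b by blast
  have rest: "d \<bullet> a = 0 \<and> d \<bullet> b = 0" if d: "d \<in> \<Delta> - {a, b}" for d
  proof -
    have "d \<notin> P"
    proof
      assume "d \<in> P"
      then have "{a, b, d} \<subseteq> span {a, c a}" using aP bP by (auto simp: P_def)
      moreover have "independent {a, b, d}" using a b d by (intro independent_mono[OF indep]) auto
      ultimately have "card {a, b, d} \<le> card {a, c a}"
        using independent_span_bound[of "{a, c a}" "{a, b, d}"] by auto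
      moreover have "card {a, b, d} = 3" using b d by auto
      moreover have "card {a, c a} \<le> 2" by (simp add: card_insert_if)
      ultimately show False by simp
    qed
    then have "\<And>z. z \<in> {a, c a} \<Longrightarrow> orthogonal d z" using split[of d] d by (auto simp: orthogonal_def inner_commute)
    then have "orthogonal d z" if "z \<in> P" for z
      using orthogonal_to_span that unfolding P_def by blast
    then show ?thesis using aP bP by (auto simp: orthogonal_def)
  qed
  show ?thesis using a b rest by (intro exI[of _ b]) (auto simp: iso_pair_def)
qed

text \<open>Each element of \<open>C\<close> has its \<open>e\<close>-th power fixing every simple
  root: by sign on good ones, by the dihedral exponent on the others. So all of \<open>C\<close>
  solves \<open>c ^^ e = id\<close>, and \<open>C_roots\<close> bounds it.\<close>

lemma card_C_le:
  assumes "\<And>a. a \<in> \<Delta> \<Longrightarrow> good a \<or> (\<exists>b x y. iso_pair \<Delta> a b \<and> root_pair a b x y \<and> pair_order (x * y) dvd e)"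
    and e: "even e" "0 < e"
  shows "card C \<le> e" "\<And>c. c \<in> C \<Longrightarrow> c ^^ e = id"
proof -
  show id: "c ^^ e = id" if c: "c \<in> C" for c
  proof (rule linear_eq_on_spanning[OF _ linear_id span_D])
    have cW: "c \<in> refl_group \<Delta>" using c C_sub W by blast
    show "linear (c ^^ e)" using refl_group_linear[OF refl_group_funpow[OF cW]] .
    fix a assume "a \<in> \<Delta>"
    then consider "good a" | b x y where "iso_pair \<Delta> a b" "root_pair a b x y" "pair_order (x * y) dvd e"
      using assms(1) by blast
    then show "(c ^^ e) a = id a"
    proof cases
      case 1
      then show ?thesis using even_funpow_sign[OF refl_group_linear[OF cW] _ e(1)] c by (simp add: good_def)
    next
      case 2
      then show ?thesis using iso_pair_exponent[OF 2(1,2) cW 2(3) e(1)] by simp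
    qed
  qed
  then have "{c\<in>C. c ^^ e = id} = C" by blast
  then show "card C \<le> e" using C_roots[OF e(2)] by simp
qed

text \<open>The first inequality excludes rank above 2 when all simple roots are good or when the
  only bad component has type B2 or G2; the second treats a single component A2, the third two
  components of rank 2.\<close>

lemma pow_gt_linear:
  fixes n :: nat
  shows "3 \<le> n \<Longrightarrow> 2 * n < 2 ^ n" "5 \<le> n \<Longrightarrow> 4 * n < 2 ^ n" "5 \<le> n \<Longrightarrow> 16 * n < 3 * 2 ^ n"
proof -
  show "3 \<le> n \<Longrightarrow> 2 * n < 2 ^ n" by (induction n rule: dec_induct) auto
  show "5 \<le> n \<Longrightarrow> 4 * n < 2 ^ n" by (induction n rule: dec_induct) auto
  show "5 \<le> n \<Longrightarrow> 16 * n < 3 * 2 ^ n" by (induction n rule: dec_induct) auto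
qed

lemma root_pair_sym: "root_pair a b x y \<Longrightarrow> root_pair b a y x"
  by (auto simp: root_pair_def pair_list_def insert_commute)

lemma iso_pair_sym: "iso_pair \<Delta> a b \<Longrightarrow> iso_pair \<Delta> b a"
  by (auto simp: iso_pair_def inner_commute)

lemma root_pair_iso:
  assumes "iso_pair \<Delta> a b" "root_pair a b x y"
  shows "x * y = 1 \<and> x = 1 \<and> y = 1 \<or> x * y = 2 \<or> x * y = 3"
proof -
  interpret root_pair a b x y by fact
  have "b \<bullet> a \<noteq> 0" using assms by (simp add: iso_pair_def inner_commute)
  then have "x \<noteq> 0" using cart(1) cartan_eq_0_iff[OF nz(1), of b] by (metis of_int_0 minus_zero)
  then show ?thesis using xy by (auto simp: pair_list_def)
qed

lemma card_refl_group_ge_pair: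
  assumes "A \<subseteq> \<Delta>" "a \<in> A" "b \<in> A" "root_pair a b x y"
  shows "2 * pair_order (x * y) * card (refl_group (A - {a, b})) \<le> card (refl_group A)"
proof -
  have A: "A = {a, b} \<union> (A - {a, b})" using assms by blast
  have "card (refl_group {a, b}) * card (refl_group (A - {a, b})) \<le> card (refl_group ({a, b} \<union> (A - {a, b})))"
  proof (rule refl_group_card_mult)
    show "independent ({a, b} \<union> (A - {a, b}))" using A assms(1) independent_mono[OF indep] by metis
    show "finite (refl_group ({a, b} \<union> (A - {a, b})))"
      using A assms(1) refl_group_mono finite_subset[OF _ fin_W] by metis
  qed blast
  then show ?thesis using root_pair.card_refl_group_pair[OF assms(4)] A by simp
qed

lemma card_refl_group_ge_power: "A \<subseteq> \<Delta> \<Longrightarrow> 2 ^ card A \<le> card (refl_group A)"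
  using refl_group_card_ge independent_mono[OF indep] finite_subset[OF refl_group_mono fin_W] by blast

lemma W_le: "card (refl_group \<Delta>) \<le> card \<Delta> * card C"
  using W_card W by simp

text \<open>\<open>C\<close> has exponent 6, 4 or 6 when the pair has type A2, B2 or G2. With
  \<open>r\<close> the order of the group of the remaining simple roots, comparison with
  \<open>W_le\<close> gives \<open>r \<le> N\<close> for A2 and \<open>2 * r \<le> N\<close> for B2
  and G2, while \<open>r\<close> is at least \<open>2 ^ (N - 2)\<close>. Only A2 survives beyond
  rank 2.\<close>

lemma one_iso_pair:
  assumes iso: "iso_pair \<Delta> a b" and rp: "root_pair a b x y" and rest: "\<And>d. d \<in> \<Delta> - {a, b} \<Longrightarrow> good d"
  shows "card \<Delta> \<le> 2 \<or> (x = 1 \<and> y = 1 \<and> (\<exists>c d. \<Delta> = {a, b, c, d} \<and> card \<Delta> = 4 \<and> c \<bullet> d = 0))"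
proof -
  define N where "N = card \<Delta>"
  define B where "B = \<Delta> - {a, b}"
  define r where "r = card (refl_group B)"
  have ab: "a \<in> \<Delta>" "b \<in> \<Delta>" "a \<noteq> b" using iso by (auto simp: iso_pair_def)
  have N2: "N = card B + 2"
  proof -
    have "card {a, b} = 2" "{a, b} \<subseteq> \<Delta>" using ab by auto
    then show ?thesis using fin_D card_mono[of \<Delta> "{a, b}"] unfolding N_def B_def by (simp add: card_Diff_subset)
  qed
  have r_ge: "2 ^ card B \<le> r" unfolding r_def by (rule card_refl_group_ge_power) (auto simp: B_def)
  have low: "2 * pair_order (x * y) * r \<le> N * card C"
    using card_refl_group_ge_pair[OF subset_refl ab(1,2) rp] W_le unfolding r_def B_def N_def by linarith
  have C: "card C \<le> e" "\<And>c. c \<in> C \<Longrightarrow> c ^^ e = id"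
    if e: "pair_order (x * y) dvd e" "even e" "0 < e" for e
  proof -
    have "good z \<or> (\<exists>b x y. iso_pair \<Delta> z b \<and> root_pair z b x y \<and> pair_order (x * y) dvd e)" if "z \<in> \<Delta>" for z
    proof -
      have "pair_order (y * x) dvd e" using e by (simp add: mult.commute)
      then show ?thesis using rest[of z] that iso rp iso_pair_sym[OF iso] root_pair_sym[OF rp] e(1) by blast
    qed
    from card_C_le[OF this e(2,3)] show "card C \<le> e" "\<And>c. c \<in> C \<Longrightarrow> c ^^ e = id" by blast+
  qed
  consider "x * y = 1" "x = 1" "y = 1" | "x * y = 2" | "x * y = 3" using root_pair_iso[OF iso rp] by blast
  then show ?thesis
  proof cases
    case 1
    then have m: "pair_order (x * y) = 3" by (simp add: pair_order_def)
    have "card C \<le> 6" using C(1)[of 6] m by simp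
    then have "N * card C \<le> N * 6" by simp
    then have rN: "r \<le> N" using low[unfolded m] by linarith
    have "N \<le> 4"
    proof (rule ccontr)
      assume "\<not> N \<le> 4"
      then have "4 * N < 2 ^ N" by (intro pow_gt_linear) simp
      moreover have "(2::nat) ^ N = 4 * 2 ^ card B" unfolding N2 by (simp add: power_add)
      ultimately show False using r_ge rN by linarith
    qed
    then consider "N \<le> 2" | "N = 3" | "N = 4" by linarith
    then show ?thesis
    proof cases
      case 1
      then show ?thesis by (simp add: N_def)
    next
      case 2
      \<comment> \<open>Rank 3: here \<open>C\<close> has at least 4 elements, but at most 2 of them
        have square \<open>id\<close>. The square of another one is a nontrivial cube root of the
        identity, which \<open>C_cube\<close> forbids.\<close>
      then have "2 \<le> r" using r_ge N2 by simp
      then have "4 \<le> card C" using low[unfolded m] 2 by simp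
      moreover have "card {c\<in>C. c ^^ 2 = id} \<le> 2" using C_roots[of 2] by simp
      ultimately have "{c\<in>C. c ^^ 2 = id} \<noteq> C" by auto
      then obtain c where c: "c \<in> C" "c ^^ 2 \<noteq> id" by blast
      have "(c ^^ 2) ^^ 3 = c ^^ 6" by (simp add: funpow_mult)
      also have "\<dots> = id" using C(2)[of 6] m c(1) by simp
      finally have "(c ^^ 2) ^^ 3 = id" .
      moreover have "card \<Delta> = 3" using 2 by (simp add: N_def)
      ultimately have "c ^^ 2 = id" using C_cube C_funpow[OF c(1)] by metis
      then show ?thesis using c(2) by metis
    next
      case 3
      then have "card B = 2" using N2 by simp
      then obtain c d where cd: "B = {c, d}" "c \<noteq> d" by (meson card_2_iff)
      then have D: "\<Delta> = {a, b, c, d}" using ab unfolding B_def by blast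
      \<comment> \<open>A non-orthogonal second pair would generate a dihedral group of order at
        least 6, whereas \<open>r \<le> 4\<close>.\<close>
      have "c \<bullet> d = 0"
      proof (rule ccontr)
        assume "c \<bullet> d \<noteq> 0"
        obtain u v where uv: "root_pair c d u v" using exists_root_pair[of c d] D cd by blast
        have "3 \<le> pair_order (u * v)"
        proof -
          interpret root_pair c d u v by fact
          have "u \<noteq> 0" using cart(1) cartan_eq_0_iff[OF nz(1), of d] \<open>c \<bullet> d \<noteq> 0\<close>
            by (metis inner_commute of_int_0 minus_zero)
          then show ?thesis using xy by (auto simp: pair_list_def pair_order_def)
        qed
        then have "6 \<le> r" using root_pair.card_refl_group_pair[OF uv] cd by (simp add: r_def)
        then show False using rN 3 by simp
      qed
      then show ?thesis using D 3 \<open>x = 1\<close> \<open>y = 1\<close> by (auto simp: N_def)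
    qed
  next
    case 2
    then have m: "pair_order (x * y) = 4" by (simp add: pair_order_def)
    have "card C \<le> 4" using C(1)[of 4] m by simp
    then have "N * card C \<le> N * 4" by simp
    then have "2 * r \<le> N" using low[unfolded m] by linarith
    moreover have "(2::nat) ^ N = 4 * 2 ^ card B" unfolding N2 by (simp add: power_add)
    ultimately show ?thesis using pow_gt_linear(1)[of N] r_ge by (fold N_def) linarith
  next
    case 3
    then have m: "pair_order (x * y) = 6" by (simp add: pair_order_def)
    have "card C \<le> 6" using C(1)[of 6] m by simp
    then have "N * card C \<le> N * 6" by simp
    then have "2 * r \<le> N" using low[unfolded m] by linarith
    moreover have "(2::nat) ^ N = 4 * 2 ^ card B" unfolding N2 by (simp add: power_add)
    ultimately show ?thesis using pow_gt_linear(1)[of N] r_ge by (fold N_def) linarith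
  qed
qed

text \<open>A second rank 2 component multiplies the order of the Weyl group by at least 6, while
  the exponent of \<open>C\<close> grows only to a common multiple of the rotation orders. A2 with
  B2 is the single combination whose least common multiple 12 reaches the product of the two
  orders.\<close>

lemma two_iso_pairs:
  assumes iso: "iso_pair \<Delta> a b" and rp: "root_pair a b x y"
    and iso': "iso_pair \<Delta> c d" and rp': "root_pair c d u v" and c: "c \<notin> {a, b}"
  shows "\<Delta> = {a, b, c, d} \<and> card \<Delta> = 4 \<and> (x * y = 1 \<and> u * v = 2 \<or> x * y = 2 \<and> u * v = 1)"
proof -
  define N where "N = card \<Delta>"
  define B where "B = \<Delta> - {a, b}"
  have ab: "a \<in> \<Delta>" "b \<in> \<Delta>" "a \<noteq> b" and cd: "c \<in> \<Delta>" "d \<in> \<Delta>" "c \<noteq> d" "c \<bullet> d \<noteq> 0"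
    using iso iso' by (auto simp: iso_pair_def)
  have "c \<bullet> a = 0" "c \<bullet> b = 0" using iso c cd by (auto simp: iso_pair_def)
  then have d: "d \<notin> {a, b}" using cd by auto
  then have cB: "c \<in> B" "d \<in> B" using c cd by (auto simp: B_def)
  have card4: "card {a, b, c, d} = 4" using ab cd c d by auto
  have sub4: "{a, b, c, d} \<subseteq> \<Delta>" using ab cd by auto
  have N4: "N = card (B - {c, d}) + 4"
  proof -
    have "B - {c, d} = \<Delta> - {a, b, c, d}" by (auto simp: B_def)
    then show ?thesis using card_Diff_subset[OF _ sub4] card_mono[OF fin_D sub4] card4 by (simp add: N_def)
  qed
  let ?m = "pair_order (x * y)" and ?m' = "pair_order (u * v)"
  have "2 ^ (N - 4) \<le> card (refl_group (B - {c, d}))"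
    using card_refl_group_ge_power[of "B - {c, d}"] N4 by (auto simp: B_def)
  then have "2 * ?m' * 2 ^ (N - 4) \<le> 2 * ?m' * card (refl_group (B - {c, d}))" by simp
  also have "\<dots> \<le> card (refl_group B)"
    by (rule card_refl_group_ge_pair[OF _ cB rp']) (auto simp: B_def)
  finally have "2 * ?m * (2 * ?m' * 2 ^ (N - 4)) \<le> 2 * ?m * card (refl_group B)" by simp
  also have "\<dots> \<le> N * card C"
    using card_refl_group_ge_pair[OF subset_refl ab(1,2) rp] W_le unfolding B_def N_def by linarith
  finally have low: "2 * ?m * (2 * ?m' * 2 ^ (N - 4)) \<le> N * card C" .
  have m: "?m = 3 \<and> x * y = 1 \<or> ?m = 4 \<and> x * y = 2 \<or> ?m = 6 \<and> x * y = 3"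
    using root_pair_iso[OF iso rp] by (auto simp: pair_order_def)
  have m': "?m' = 3 \<and> u * v = 1 \<or> ?m' = 4 \<and> u * v = 2 \<or> ?m' = 6 \<and> u * v = 3"
    using root_pair_iso[OF iso' rp'] by (auto simp: pair_order_def)
  \<comment> \<open>12 is a common multiple of all possible orders 3, 4 and 6, so this covers
    further components of rank 2 as well.\<close>
  have C12: "card C \<le> 12"
  proof (rule card_C_le(1))
    fix z assume z: "z \<in> \<Delta>"
    show "good z \<or> (\<exists>b x y. iso_pair \<Delta> z b \<and> root_pair z b x y \<and> pair_order (x * y) dvd 12)"
    proof (cases "good z")
      case False
      then obtain w where w: "iso_pair \<Delta> z w" using good_or_iso_pair z by blast
      then obtain s t where st: "root_pair z w s t" using exists_root_pair[of z w] by (auto simp: iso_pair_def)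
      have "pair_order (s * t) dvd 12" using root_pair_iso[OF w st] by (auto simp: pair_order_def)
      then show ?thesis using w st by blast
    qed simp
  qed auto
  have N: "N = 4"
  proof (rule ccontr)
    assume "N \<noteq> 4"
    then have "16 * N < 3 * 2 ^ N" using N4 by (intro pow_gt_linear) simp
    moreover have "(2::nat) ^ N = 16 * 2 ^ (N - 4)" using N4 by (simp add: power_add)
    moreover have "N * card C \<le> N * 12" using C12 by simp
    \<comment> \<open>Both rotation orders are at least 3, so the two components account for at
      least 6 * 6 = 36 elements.\<close>
    moreover have "9 \<le> ?m * ?m'" using m m' by auto
    then have "36 * 2 ^ (N - 4) \<le> 2 * ?m * (2 * ?m' * 2 ^ (N - 4))"
      using mult_le_mono1[of 9 "?m * ?m'" "4 * 2 ^ (N - 4)"] by (simp add: ac_simps)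
    ultimately show False using low by linarith
  qed
  then have D: "\<Delta> = {a, b, c, d}" using card4 card_subset_eq[OF fin_D sub4] by (simp add: N_def)
  have C: "card C \<le> e" if e: "?m dvd e" "?m' dvd e" "even e" "0 < e" for e
  proof (rule card_C_le(1)[OF _ e(3,4)])
    have "pair_order (y * x) dvd e" "pair_order (v * u) dvd e" using e by (simp_all add: mult.commute)
    then show "good z \<or> (\<exists>b x y. iso_pair \<Delta> z b \<and> root_pair z b x y \<and> pair_order (x * y) dvd e)" if "z \<in> \<Delta>" for z
      using that iso rp iso' rp' e iso_pair_sym[OF iso] root_pair_sym[OF rp] iso_pair_sym[OF iso'] root_pair_sym[OF rp']
      unfolding D by blast
  qed
  have low4: "?m * ?m' \<le> card C" using low N by simp
  \<comment> \<open>In rank 4 the order comparison becomes \<open>?m * ?m' \<le> card C\<close>.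
    This fails for A2 twice (9 > 6), B2 twice (16 > 4), and for every combination with G2, where the
    product is at least 18 and exceeds 12.\<close>
  have "x * y = 1 \<and> u * v = 2 \<or> x * y = 2 \<and> u * v = 1"
    using m m' C[of 6] C[of 4] C12 low4 by auto
  then show ?thesis using D N N_def by blast
qed

text \<open>Rank at most 2 is left undivided since all its types are admissible. In rank 4 one
  component is A2, and the other two simple roots are orthogonal (2 A1) or form B2.\<close>

theorem base_classification:
  "card \<Delta> \<le> 2 \<or> (\<exists>a b c d x y. \<Delta> = {a, b, c, d} \<and> card \<Delta> = 4 \<and> iso_pair \<Delta> a b \<and> root_pair a b 1 1 \<and>
     (c \<bullet> d = 0 \<or> root_pair c d x y \<and> x * y = 2))"
proof (cases "\<forall>a\<in>\<Delta>. good a")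
  case True
  then have "card C \<le> 2" using card_C_le(1)[of 2] by simp
  then have "card \<Delta> * card C \<le> card \<Delta> * 2" by simp
  moreover have "2 ^ card \<Delta> \<le> card (refl_group \<Delta>)" by (rule card_refl_group_ge_power) simp
  ultimately have "2 ^ card \<Delta> \<le> 2 * card \<Delta>" using W_le by linarith
  then show ?thesis using pow_gt_linear(1)[of "card \<Delta>"] by linarith
next
  case False
  then obtain a b where iso: "iso_pair \<Delta> a b" using good_or_iso_pair by blast
  then obtain x y where rp: "root_pair a b x y" using exists_root_pair[of a b] by (auto simp: iso_pair_def)
  show ?thesis
  proof (cases "\<forall>d\<in>\<Delta> - {a, b}. good d")
    case True
    with one_iso_pair[OF iso rp] have "card \<Delta> \<le> 2 \<or>
      (x = 1 \<and> y = 1 \<and> (\<exists>c d. \<Delta> = {a, b, c, d} \<and> card \<Delta> = 4 \<and> c \<bullet> d = 0))" by blast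
    then show ?thesis using iso rp by blast
  next
    case False
    then obtain c where c: "c \<in> \<Delta>" "c \<notin> {a, b}" "\<not> good c" by blast
    then obtain d where iso': "iso_pair \<Delta> c d" using good_or_iso_pair by blast
    then obtain u v where rp': "root_pair c d u v" using exists_root_pair[of c d] by (auto simp: iso_pair_def)
    have D: "\<Delta> = {a, b, c, d}" "card \<Delta> = 4" "x * y = 1 \<and> u * v = 2 \<or> x * y = 2 \<and> u * v = 1"
      using two_iso_pairs[OF iso rp iso' rp' c(2)] by blast+
    from D(3) show ?thesis
    proof
      assume h: "x * y = 1 \<and> u * v = 2"
      then have "x = 1 \<and> y = 1" using root_pair_iso[OF iso rp] by auto
      then show ?thesis using D iso rp rp' h by blast
    next
      assume h: "x * y = 2 \<and> u * v = 1"
      then have "u = 1 \<and> v = 1" using root_pair_iso[OF iso' rp'] by auto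
      moreover have "\<Delta> = {c, d, a, b}" using D by auto
      ultimately show ?thesis using D iso' rp rp' h by blast
    qed
  qed
qed

end

section \<open>Reading types from bases and bases from types\<close>

lemma edges_diagram_self: "edges (dynkin_diagram \<Delta>) a a = 0"
  and arrow_diagram_self: "\<not> arrow (dynkin_diagram \<Delta>) a a"
  and verts_diagram: "verts (dynkin_diagram \<Delta>) = \<Delta>"
  by (auto simp: dynkin_diagram_def)

context root_pair begin

lemma diagram_edges: "edges (dynkin_diagram \<Delta>) a b = nat (x * y)"
  "edges (dynkin_diagram \<Delta>) b a = nat (x * y)"
proof -
  have "cartan a b * cartan b a = of_int (x * y)" "cartan b a * cartan a b = of_int (x * y)"
    by (simp_all add: cart)
  then show "edges (dynkin_diagram \<Delta>) a b = nat (x * y)" "edges (dynkin_diagram \<Delta>) b a = nat (x * y)"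
    using neq neq[symmetric] by (simp_all only: dynkin_diagram_def dynkin.simps if_False floor_of_int)
qed

lemma orthogonal_iff: "a \<bullet> b = 0 \<longleftrightarrow> x * y = 0"
proof -
  have "a \<bullet> b = 0 \<longleftrightarrow> cartan a b = 0" using cartan_eq_0_iff[OF nz(2), of a] by simp
  then show ?thesis using cart xy by (auto simp: pair_list_def)
qed

text \<open>\<open>cartan b a * (a \<bullet> a)\<close> and
  \<open>cartan a b * (b \<bullet> b)\<close> agree, so for a non-orthogonal pair the squared
  lengths are inversely proportional to \<open>x\<close> and \<open>y\<close>.\<close>

lemma diagram_arrow: "arrow (dynkin_diagram \<Delta>) a b \<longleftrightarrow> x < y" "arrow (dynkin_diagram \<Delta>) b a \<longleftrightarrow> y < x"
proof -
  have "cartan b a * (a \<bullet> a) = cartan a b * (b \<bullet> b)"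
    using nz by (simp add: cartan_def inner_commute)
  then have n: "of_int x * (norm a)\<^sup>2 = of_int y * (norm b)\<^sup>2" by (simp add: cart power2_norm_eq_inner)
  have lt: "norm s < norm t \<longleftrightarrow> (norm s)\<^sup>2 < (norm t)\<^sup>2" for s t :: 'a
    by (metis norm_ge_zero power2_less_imp_less power_strict_mono zero_less_numeral)
  have p: "0 < (norm a)\<^sup>2" "0 < (norm b)\<^sup>2" using nz by simp_all
  have c: "(x * y \<noteq> 0 \<and> B < A) = (x < y) \<and> (x * y \<noteq> 0 \<and> A < B) = (y < x)"
    if "0 < A" "0 < B" "of_int x * A = of_int y * B" for A B :: real
    using xy that by (auto simp: pair_list_def)
  show "arrow (dynkin_diagram \<Delta>) a b \<longleftrightarrow> x < y" "arrow (dynkin_diagram \<Delta>) b a \<longleftrightarrow> y < x"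
    using c[OF p n] orthogonal_iff by (simp_all add: dynkin_diagram_def lt inner_commute[of b a])
qed

lemma product_nonneg: "0 \<le> x * y"
proof -
  have "x = 0 \<and> y = 0 \<or> x = 1 \<and> y = 1 \<or> x = 1 \<and> y = 2 \<or> x = 2 \<and> y = 1 \<or> x = 1 \<and> y = 3 \<or> x = 3 \<and> y = 1"
    using xy by (simp add: pair_list_def)
  then show ?thesis by (elim disjE) simp_all
qed

lemmas diagram = diagram_edges diagram_arrow

end

lemma has_type_A1I: "root_base R {a} \<Longrightarrow> has_type R type_A1"
  unfolding has_type_def dynkin_iso_def
  by (intro exI[of _ "{a}"] conjI exI[of _ "\<lambda>_. True"])
    (auto simp: type_A1_def verts_diagram edges_diagram_self arrow_diagram_self bij_betw_def)

text \<open>In the types B2 and G2 the arrow leaves the vertex \<open>True\<close>, so the longer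
  root must go there: \<open>a\<close> if \<open>x < y\<close>, otherwise \<open>b\<close>.\<close>

lemma has_type_pairI:
  assumes base: "root_base R {a, b}" and rp: "root_pair a b x y"
  shows "has_type R type_A2 \<or> has_type R type_B2 \<or> has_type R type_G2 \<or> has_type R (type_A1 \<boxplus> type_A1)"
proof -
  interpret root_pair a b x y by fact
  note data = type_A1_def type_A2_def type_B2_def type_G2_def dynkin_sum_def verts_diagram edges_diagram_self
    arrow_diagram_self diagram bij_betw_def UNIV_bool inj_on_def
  have neq': "b \<noteq> a" using neq by simp
  have C: "has_type R D" if "bij_betw f {a, b} (verts D)"
    "\<forall>u\<in>{a, b}. \<forall>v\<in>{a, b}. edges D (f u) (f v) = edges (dynkin_diagram {a, b}) u v \<and>
      arrow D (f u) (f v) = arrow (dynkin_diagram {a, b}) u v" for f and D :: "'d dynkin"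
    using that base unfolding has_type_def dynkin_iso_def by (auto simp: verts_diagram)
  from xy consider "x = 0" "y = 0" | "x = 1" "y = 1" | "x = 1" "y = 2" | "x = 2" "y = 1"
    | "x = 1" "y = 3" | "x = 3" "y = 1" by (auto simp: pair_list_def)
  then show ?thesis
  proof cases
    case 1
    have "has_type R (type_A1 \<boxplus> type_A1)"
      by (rule C[of "\<lambda>z. if z = a then Inl True else Inr True"]) (use 1 neq neq' in \<open>auto simp: data\<close>)
    then show ?thesis by blast
  next
    case 2
    have "has_type R type_A2"
      by (rule C[of "\<lambda>z. z = a"]) (use 2 neq neq' in \<open>auto simp: data\<close>)
    then show ?thesis by blast
  next
    case 3
    have "has_type R type_B2"
      by (rule C[of "\<lambda>z. z = a"]) (use 3 neq neq' in \<open>auto simp: data\<close>)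
    then show ?thesis by blast
  next
    case 4
    have "has_type R type_B2"
      by (rule C[of "\<lambda>z. z = b"]) (use 4 neq neq' in \<open>auto simp: data\<close>)
    then show ?thesis by blast
  next
    case 5
    have "has_type R type_G2"
      by (rule C[of "\<lambda>z. z = a"]) (use 5 neq neq' in \<open>auto simp: data\<close>)
    then show ?thesis by blast
  next
    case 6
    have "has_type R type_G2"
      by (rule C[of "\<lambda>z. z = b"]) (use 6 neq neq' in \<open>auto simp: data\<close>)
    then show ?thesis by blast
  qed
qed

lemma root_pair_orthogonal:
  assumes "root_pair a b x y" "a \<bullet> b = 0" shows "x = 0 \<and> y = 0"
proof -
  interpret root_pair a b x y by fact
  show ?thesis using orthogonal_iff assms(2) xy by (auto simp: pair_list_def)
qed

lemma has_type_quadI: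
  assumes R: "root_system R" and base: "root_base R {a, b, c, d}" and card: "card {a, b, c, d} = 4"
    and ab: "root_pair a b 1 1" and cd: "root_pair c d u v"
    and orth: "a \<bullet> c = 0" "a \<bullet> d = 0" "b \<bullet> c = 0" "b \<bullet> d = 0"
  shows "u * v = 0 \<Longrightarrow> has_type R (type_A1 \<boxplus> type_A1 \<boxplus> type_A2)"
    and "u * v = 2 \<Longrightarrow> has_type R (type_A2 \<boxplus> type_B2)"
proof -
  have dist: "a \<noteq> b" "a \<noteq> c" "a \<noteq> d" "b \<noteq> c" "b \<noteq> d" "c \<noteq> d"
    using card by (auto simp: card_insert_if split: if_splits)
  note dist' = dist dist[symmetric]
  have zero: "root_pair s t 0 0" if "s \<in> {a, b}" "t \<in> {c, d}" for s t
  proof -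
    have "s \<noteq> t" "s \<bullet> t = 0" using that dist orth by auto
    then show ?thesis using root_base_root_pair[OF R base, of s t] root_pair_orthogonal that by blast
  qed
  interpret ab: root_pair a b 1 1 by fact
  interpret cd: root_pair c d u v by fact
  interpret ac: root_pair a c 0 0 by (rule zero) simp_all
  interpret ad: root_pair a d 0 0 by (rule zero) simp_all
  interpret bc: root_pair b c 0 0 by (rule zero) simp_all
  interpret bd: root_pair b d 0 0 by (rule zero) simp_all
  note data = type_A1_def type_A2_def type_B2_def dynkin_sum_def verts_diagram edges_diagram_self
    arrow_diagram_self bij_betw_def UNIV_bool inj_on_def ab.diagram cd.diagram ac.diagram ad.diagram
    bc.diagram bd.diagram
  have C: "has_type R D" if "bij_betw f {a, b, c, d} (verts D)"
    "\<forall>s\<in>{a, b, c, d}. \<forall>t\<in>{a, b, c, d}. edges D (f s) (f t) = edges (dynkin_diagram {a, b, c, d}) s t \<and>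
      arrow D (f s) (f t) = arrow (dynkin_diagram {a, b, c, d}) s t" for f and D :: "'d dynkin"
    using that base unfolding has_type_def dynkin_iso_def
    by (intro exI[of _ "{a, b, c, d}"] conjI exI[of _ f]) (simp_all only: verts_diagram)
  show "has_type R (type_A1 \<boxplus> type_A1 \<boxplus> type_A2)" if uv: "u * v = 0"
  proof (rule C[of "\<lambda>z. if z = a then Inr True else if z = b then Inr False
      else if z = c then Inl (Inl True) else Inl (Inr True)"])
  qed (use uv cd.xy dist' in \<open>auto simp: data pair_list_def\<close>)
  assume uv: "u * v = 2"
  then consider "u = 1" "v = 2" | "u = 2" "v = 1" using cd.xy by (auto simp: pair_list_def)
  then show "has_type R (type_A2 \<boxplus> type_B2)"
  proof cases
    case 1
    show ?thesis
    proof (rule C[of "\<lambda>z. if z = a then Inl True else if z = b then Inl False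
        else if z = c then Inr True else Inr False"])
    qed (use 1 dist' in \<open>auto simp: data\<close>)
  next
    case 2
    show ?thesis
    proof (rule C[of "\<lambda>z. if z = a then Inl True else if z = b then Inl False
        else if z = c then Inr False else Inr True"])
    qed (use 2 dist' in \<open>auto simp: data\<close>)
  qed
qed

text \<open>Inverting the isomorphism lets the vertices of the given diagram index the simple roots.
  Only edges are transferred: they determine the rotation orders, and with them the Weyl
  group.\<close>

lemma has_typeE:
  assumes "has_type R D"
  obtains g where "root_base R (g ` verts D)" "inj_on g (verts D)"
    "\<And>u v. u \<in> verts D \<Longrightarrow> v \<in> verts D \<Longrightarrow> edges (dynkin_diagram (g ` verts D)) (g u) (g v) = edges D u v"
proof -
  obtain \<Delta> f where base: "root_base R \<Delta>" and f: "bij_betw f \<Delta> (verts D)"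
    and e: "\<And>u v. u \<in> \<Delta> \<Longrightarrow> v \<in> \<Delta> \<Longrightarrow> edges D (f u) (f v) = edges (dynkin_diagram \<Delta>) u v"
    using assms unfolding has_type_def dynkin_iso_def by (auto simp: verts_diagram)
  define g where "g = inv_into \<Delta> f"
  have g: "bij_betw g (verts D) \<Delta>" using bij_betw_inv_into[OF f] by (simp add: g_def)
  have img: "g ` verts D = \<Delta>" using g by (simp add: bij_betw_def)
  show ?thesis
  proof (rule that[of g])
    fix u v assume uv: "u \<in> verts D" "v \<in> verts D"
    then have "g u \<in> \<Delta>" "g v \<in> \<Delta>" "f (g u) = u" "f (g v) = v"
      using f img by (auto simp: g_def bij_betw_inv_into_right)
    then show "edges (dynkin_diagram (g ` verts D)) (g u) (g v) = edges D u v"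
      using e[of "g u" "g v"] img by simp
  qed (use base img g in \<open>simp_all add: bij_betw_def\<close>)
qed

lemma root_pair_of_edges:
  assumes R: "root_system R" and base: "root_base R \<Delta>" and ab: "a \<in> \<Delta>" "b \<in> \<Delta>" "a \<noteq> b"
    and e: "edges (dynkin_diagram \<Delta>) a b = p"
  shows "\<exists>x y. root_pair a b x y \<and> x * y = int p"
proof -
  obtain x y where rp: "root_pair a b x y" using root_base_root_pair[OF R base ab] by blast
  interpret root_pair a b x y by fact
  note product_nonneg
  moreover have "nat (x * y) = p" using e diagram_edges(1)[of \<Delta>] by metis
  ultimately have "x * y = int p" by simp
  then show ?thesis using rp by blast
qed

lemma orthogonal_of_edges:
  assumes R: "root_system R" and base: "root_base R \<Delta>" and ab: "a \<in> \<Delta>" "b \<in> \<Delta>" "a \<noteq> b"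
    and e: "edges (dynkin_diagram \<Delta>) a b = 0"
  shows "a \<bullet> b = 0"
  using root_pair_of_edges[OF assms] root_pair.orthogonal_iff by fastforce

lemma has_type_A1D:
  assumes "has_type R type_A1" shows "\<exists>a. root_base R {a}"
proof -
  obtain g where "root_base R (g ` verts type_A1)" using assms by (rule has_typeE) blast
  then show ?thesis by (auto simp: type_A1_def)
qed

lemma has_type_two_vertices:
  assumes R: "root_system R" and D: "has_type R D" "verts D = {s, t}" "s \<noteq> t" "edges D s t = p"
  shows "\<exists>a b x y. root_base R {a, b} \<and> root_pair a b x y \<and> x * y = int p"
proof -
  obtain g where base: "root_base R (g ` verts D)" and inj: "inj_on g (verts D)"
    and e: "\<And>u v. u \<in> verts D \<Longrightarrow> v \<in> verts D \<Longrightarrow> edges (dynkin_diagram (g ` verts D)) (g u) (g v) = edges D u v"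
    using D(1) by (rule has_typeE) blast
  have "g s \<noteq> g t" using inj D(2,3) by (auto simp: inj_on_def)
  moreover have "s \<in> verts D" "t \<in> verts D" using D(2) by simp_all
  ultimately obtain x y where "root_pair (g s) (g t) x y" "x * y = int p"
    using root_pair_of_edges[OF R base, of "g s" "g t" p] e[of s t] D(4) by auto
  moreover have "root_base R {g s, g t}" using base D(2) by simp
  ultimately show ?thesis by blast
qed

lemma has_type_pairD:
  assumes R: "root_system R"
    and "has_type R type_A2 \<and> p = 1 \<or> has_type R type_B2 \<and> p = 2 \<or> has_type R type_G2 \<and> p = 3 \<or>
      has_type R (type_A1 \<boxplus> type_A1) \<and> p = 0"
  shows "\<exists>a b x y. root_base R {a, b} \<and> root_pair a b x y \<and> x * y = int p"
proof -
  note data = type_A1_def type_A2_def type_B2_def type_G2_def dynkin_sum_def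
  from assms(2) show ?thesis
  proof (elim disjE conjE)
    assume "has_type R type_A2" "p = 1"
    then show ?thesis by (intro has_type_two_vertices[OF R, of type_A2 True False]) (auto simp: data)
  next
    assume "has_type R type_B2" "p = 2"
    then show ?thesis by (intro has_type_two_vertices[OF R, of type_B2 True False]) (auto simp: data)
  next
    assume "has_type R type_G2" "p = 3"
    then show ?thesis by (intro has_type_two_vertices[OF R, of type_G2 True False]) (auto simp: data)
  next
    assume "has_type R (type_A1 \<boxplus> type_A1)" "p = 0"
    then show ?thesis
      by (intro has_type_two_vertices[OF R, of "type_A1 \<boxplus> type_A1" "Inl True" "Inr True"]) (auto simp: data)
  qed
qed

lemma has_type_four_vertices:
  assumes R: "root_system R" and D: "has_type R D" "verts D = {r, s, t, q}" "distinct [r, s, t, q]"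
    and zero: "edges D r t = 0" "edges D r q = 0" "edges D s t = 0" "edges D s q = 0"
  shows "\<exists>a b c d x y u v. root_base R {a, b, c, d} \<and> root_pair a b x y \<and> x * y = int (edges D r s) \<and>
    root_pair c d u v \<and> u * v = int (edges D t q) \<and> {a, b} \<inter> {c, d} = {} \<and>
    a \<bullet> c = 0 \<and> a \<bullet> d = 0 \<and> b \<bullet> c = 0 \<and> b \<bullet> d = 0"
proof -
  obtain g where base: "root_base R (g ` verts D)" and inj: "inj_on g (verts D)"
    and e: "\<And>u v. u \<in> verts D \<Longrightarrow> v \<in> verts D \<Longrightarrow> edges (dynkin_diagram (g ` verts D)) (g u) (g v) = edges D u v"
    using D(1) by (rule has_typeE) blast
  have ne: "g u \<noteq> g v" if "u \<in> verts D" "v \<in> verts D" "u \<noteq> v" for u v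
    using inj that by (auto simp: inj_on_def)
  have mem: "r \<in> verts D" "s \<in> verts D" "t \<in> verts D" "q \<in> verts D" by (auto simp: D(2))
  have pair: "\<exists>x y. root_pair (g u) (g v) x y \<and> x * y = int (edges D u v)"
    if "u \<in> verts D" "v \<in> verts D" "u \<noteq> v" for u v
    using root_pair_of_edges[OF R base _ _ ne[OF that] e[OF that(1,2)]] that by blast
  have orth: "g u \<bullet> g v = 0" if "u \<in> verts D" "v \<in> verts D" "u \<noteq> v" "edges D u v = 0" for u v
    using orthogonal_of_edges[OF R base _ _ ne[OF that(1-3)]] e[OF that(1,2)] that by simp
  obtain x y u v where p: "root_pair (g r) (g s) x y" "x * y = int (edges D r s)"
    "root_pair (g t) (g q) u v" "u * v = int (edges D t q)"
    using pair[OF mem(1,2)] pair[OF mem(3,4)] D(3) by auto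
  have b: "root_base R {g r, g s, g t, g q}" using base by (simp only: D(2) image_insert image_empty)
  have d: "{g r, g s} \<inter> {g t, g q} = {}" using ne mem D(3) by auto
  have o: "g r \<bullet> g t = 0" "g r \<bullet> g q = 0" "g s \<bullet> g t = 0" "g s \<bullet> g q = 0"
    using orth mem zero D(3) by simp_all
  show ?thesis using b p d o by (intro exI conjI)
qed

lemma has_type_quadD:
  assumes R: "root_system R"
    and "has_type R (type_A1 \<boxplus> type_A1 \<boxplus> type_A2) \<and> p = 0 \<or> has_type R (type_A2 \<boxplus> type_B2) \<and> p = 2"
  shows "\<exists>a b c d x y u v. root_base R {a, b, c, d} \<and> root_pair a b x y \<and> x * y = 1 \<and>
    root_pair c d u v \<and> u * v = int p \<and> {a, b} \<inter> {c, d} = {} \<and>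
    a \<bullet> c = 0 \<and> a \<bullet> d = 0 \<and> b \<bullet> c = 0 \<and> b \<bullet> d = 0"
proof -
  note data = type_A1_def type_A2_def type_B2_def dynkin_sum_def UNIV_bool
  from assms(2) show ?thesis
  proof (elim disjE conjE)
    assume "has_type R (type_A1 \<boxplus> type_A1 \<boxplus> type_A2)" "p = 0"
    then show ?thesis
      using has_type_four_vertices[OF R, of "type_A1 \<boxplus> type_A1 \<boxplus> type_A2" "Inr True" "Inr False" "Inl (Inl True)" "Inl (Inr True)"]
      by (simp add: data insert_commute)
  next
    assume "has_type R (type_A2 \<boxplus> type_B2)" "p = 2"
    then show ?thesis
      using has_type_four_vertices[OF R, of "type_A2 \<boxplus> type_B2" "Inl True" "Inl False" "Inr True" "Inr False"]
      by (simp add: data insert_commute)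
  qed
qed

subsection \<open>Dihedral models of the Weyl groups\<close>

text \<open>The group of order two appears as a dihedral group with trivial rotation, in line with
  the other types.\<close>

lemma weyl_iso_dih_1:
  assumes R: "root_system R" "reduced_roots R" and base: "root_base R {a}"
  shows "\<exists>f. f \<in> iso (dih 1) (weyl_group R)"
proof -
  interpret group "weyl_group R" by (rule group_weyl_group)
  have W: "refl_group R = refl_group {a}" by (rule refl_group_root_base[OF R base])
  have s: "reflection a \<in> refl_group R" unfolding W by (auto intro: refl_group_reflection)
  have a0: "a \<noteq> 0" using base root_nonzero[OF R(1)] by (auto simp: root_base_def)
  let ?f = "dih_map (weyl_group R) \<one>\<^bsub>weyl_group R\<^esub> (reflection a)"
  have h: "?f \<in> hom (dih 1) (weyl_group R)"
    by (rule dih_map_hom) (use s refl_group_id[of R] in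
      \<open>simp_all add: carrier_weyl_group weyl_group_mult weyl_group_one\<close>)
  have "reflection a \<noteq> id"
  proof
    assume "reflection a = id"
    then have "2 *\<^sub>R a = 0" by (metis id_apply reflection_self add.right_inverse scaleR_2)
    then show False using a0 by simp
  qed
  then have i: "inj_on ?f (carrier (dih 1))"
    by (intro dih_map_inj) (use s refl_group_id[of R] in
      \<open>simp_all add: carrier_weyl_group weyl_group_one\<close>)
  have "?f ` carrier (dih 1) \<subseteq> carrier (weyl_group R)" using h by (auto simp: hom_def)
  moreover have "finite (carrier (weyl_group R))"
    unfolding carrier_weyl_group by (rule finite_refl_group[OF R(1)])
  moreover have "card (?f ` carrier (dih 1)) = card (carrier (weyl_group R))"
    unfolding card_image[OF i] unfolding carrier_weyl_group W card_refl_group_single[OF a0]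
    by (simp add: carrier_dih card_cartesian_product card_UNIV_bool)
  ultimately have "?f ` carrier (dih 1) = carrier (weyl_group R)" using card_subset_eq by blast
  then show ?thesis using h i by (auto simp: iso_def bij_betw_def)
qed

lemma weyl_iso_dih:
  assumes R: "root_system R" "reduced_roots R" and base: "root_base R {a, b}" and rp: "root_pair a b x y"
  shows "\<exists>f. f \<in> iso (dih (pair_order (x * y))) (weyl_group R)"
proof -
  interpret root_pair a b x y by fact
  have sub: "{a, b} \<subseteq> R" using base by (simp add: root_base_def)
  show ?thesis
    using pair_map_hom[OF sub] pair_map_inj[OF sub] pair_map_image[OF sub]
    unfolding refl_group_root_base[OF R base, symmetric] iso_def bij_betw_def carrier_weyl_group by blast
qed

text \<open>Orthogonality of the pairs gives commuting factors and surjectivity; independence of the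
  whole base gives injectivity.\<close>

lemma weyl_iso_dih_product:
  assumes R: "root_system R" "reduced_roots R" and base: "root_base R {a, b, c, d}"
    and ab: "root_pair a b x y" and cd: "root_pair c d u v" and disj: "{a, b} \<inter> {c, d} = {}"
    and orth: "a \<bullet> c = 0" "a \<bullet> d = 0" "b \<bullet> c = 0" "b \<bullet> d = 0"
  shows "\<exists>f. f \<in> iso (dih (pair_order (x * y)) \<times>\<times> dih (pair_order (u * v))) (weyl_group R)"
proof -
  interpret G: group "weyl_group R" by (rule group_weyl_group)
  interpret ab: root_pair a b x y by fact
  interpret cd: root_pair c d u v by fact
  have sub: "{a, b} \<subseteq> R" "{c, d} \<subseteq> R" using base by (auto simp: root_base_def)
  let ?f = "ab.pair_map R" and ?g = "cd.pair_map R"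
  let ?M = "dih ab.m" and ?N = "dih cd.m"
  have W: "refl_group R = refl_group ({a, b} \<union> {c, d})"
    using refl_group_root_base[OF R base] by (simp add: insert_commute)
  have o: "\<And>s t. s \<in> {a, b} \<Longrightarrow> t \<in> {c, d} \<Longrightarrow> s \<bullet> t = 0" using orth by auto
  have "{a, b} \<union> {c, d} = {a, b, c, d}" by auto
  then have ind: "independent ({a, b} \<union> {c, d})" using base by (metis root_base_def)
  have fin: "?f p \<in> refl_group {a, b}" if "p \<in> carrier ?M" for p
    using ab.pair_map_image[OF sub(1)] that by blast
  have gin: "?g q \<in> refl_group {c, d}" if "q \<in> carrier ?N" for q
    using cd.pair_map_image[OF sub(2)] that by blast
  have fR: "?f p \<in> refl_group R" if "p \<in> carrier ?M" for p
    using fin[OF that] refl_group_mono[OF sub(1)] by blast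
  have gR: "?g q \<in> refl_group R" if "q \<in> carrier ?N" for q
    using gin[OF that] refl_group_mono[OF sub(2)] by blast
  define h where "h = (\<lambda>(p, q). ?f p \<otimes>\<^bsub>weyl_group R\<^esub> ?g q)"
  have h: "h (p, q) = ?f p \<circ> ?g q" if "p \<in> carrier ?M" "q \<in> carrier ?N" for p q
    using that fR gR by (simp add: h_def weyl_group_mult)
  have "?f p \<otimes>\<^bsub>weyl_group R\<^esub> ?g q = ?g q \<otimes>\<^bsub>weyl_group R\<^esub> ?f p"
    if "p \<in> carrier ?M" "q \<in> carrier ?N" for p q
    using refl_group_commute[OF o fin[OF that(1)] gin[OF that(2)]] that fR gR by (simp add: weyl_group_mult)
  from G.product_hom[OF ab.pair_map_hom[OF sub(1)] cd.pair_map_hom[OF sub(2)] this]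
  have "h \<in> hom (?M \<times>\<times> ?N) (weyl_group R)" unfolding h_def .
  moreover have "inj_on h (carrier (?M \<times>\<times> ?N))"
  proof (rule inj_onI)
    fix z z' assume "z \<in> carrier (?M \<times>\<times> ?N)" "z' \<in> carrier (?M \<times>\<times> ?N)" and e: "h z = h z'"
    then obtain p q p' q' where z: "z = (p, q)" "z' = (p', q')" "p \<in> carrier ?M" "p' \<in> carrier ?M"
      "q \<in> carrier ?N" "q' \<in> carrier ?N" by (auto simp: DirProd_def)
    have "(?f p, ?g q) = (?f p', ?g q')"
      by (rule inj_onD[OF refl_group_mult_inj[OF ind disj]]) (use e z h fin gin in simp_all)
    then have "?f p = ?f p'" "?g q = ?g q'" by simp_all
    then have "p = p'" "q = q'"
      using inj_onD[OF ab.pair_map_inj[OF sub(1)] _ z(3,4)] inj_onD[OF cd.pair_map_inj[OF sub(2)] _ z(5,6)]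
      by simp_all
    then show "z = z'" using z by simp
  qed
  moreover have "carrier (weyl_group R) \<subseteq> h ` carrier (?M \<times>\<times> ?N)"
  proof
    fix w assume "w \<in> carrier (weyl_group R)"
    then have "w \<in> refl_group ({a, b} \<union> {c, d})" by (simp only: carrier_weyl_group W)
    from refl_group_mult_surj[OF o this] obtain s t where
      st: "s \<in> refl_group {a, b}" "t \<in> refl_group {c, d}" "w = s \<circ> t" by blast
    obtain p where "p \<in> carrier ?M" "s = ?f p" using st(1) ab.pair_map_image[OF sub(1)] by blast
    moreover obtain q where "q \<in> carrier ?N" "t = ?g q" using st(2) cd.pair_map_image[OF sub(2)] by blast
    ultimately have "(p, q) \<in> carrier (?M \<times>\<times> ?N)" "w = h (p, q)"
      using st(3) by (simp_all add: DirProd_def h)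
    then show "w \<in> h ` carrier (?M \<times>\<times> ?N)" by blast
  qed
  ultimately show ?thesis unfolding iso_def bij_betw_def hom_def by blast
qed

section \<open>Roots of polynomials and roots of unity in a field\<close>

text \<open>A coefficient list may start with zeros, so it is normalized before roots are counted.
  The degree is one less than the length, whence the strict inequality.\<close>

lemma (in field) card_eval_zero:
  assumes p: "set p \<subseteq> carrier R" and nz: "c \<in> set p" "c \<noteq> \<zero>"
  shows "finite {x \<in> carrier R. eval p x = \<zero>}" "card {x \<in> carrier R. eval p x = \<zero>} < length p"
proof -
  define q where "q = normalize p"
  have q: "q \<in> carrier (poly_ring R)"
    using normalize_gives_polynomial[OF p] by (simp add: q_def univ_poly_carrier)
  have "q \<noteq> []"
  proof
    assume "q = []"
    then have "p = replicate (length p) \<zero>"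
      using normalize_def'[of p] unfolding q_def by (metis append_Nil2 diff_zero list.size(3))
    then have "c \<in> set (replicate (length p) \<zero>)" using nz(1) by simp
    then show False using nz(2) by (auto split: if_splits)
  qed
  then have e: "{x \<in> carrier R. eval p x = \<zero>} = set_mset (roots q)"
    using roots_mem_iff_is_root[OF q] eval_normalize[OF p] by (auto simp: is_root_def q_def)
  then show "finite {x \<in> carrier R. eval p x = \<zero>}" by simp
  have "card (set_mset (roots q)) \<le> size (roots q)"
  proof -
    have "card (set_mset (roots q)) = (\<Sum>x\<in>set_mset (roots q). 1)" by simp
    also have "\<dots> \<le> (\<Sum>x\<in>set_mset (roots q). count (roots q) x)"
      by (rule sum_mono) (metis One_nat_def Suc_leI count_greater_zero_iff)
    finally show ?thesis by (simp only: size_multiset_overloaded_eq)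
  qed
  also have "\<dots> \<le> length q - 1" using size_roots_le_degree[OF q] by simp
  also have "\<dots> < length q" using \<open>q \<noteq> []\<close> by (cases q) simp_all
  also have "\<dots> \<le> length p" unfolding q_def by (rule normalize_length_le)
  finally show "card {x \<in> carrier R. eval p x = \<zero>} < length p" unfolding e .
qed

lemma (in field) card_roots_of_unity:
  assumes "0 < m"
  shows "finite {x \<in> carrier R. x [^] (m::nat) = \<one>}" "card {x \<in> carrier R. x [^] m = \<one>} \<le> m"
proof -
  \<comment> \<open>The coefficients of X^m - 1, leading one first; the length is
    \<open>m + 1\<close>.\<close>
  define p where "p = \<one> # replicate (m - 1) \<zero> @ [\<ominus> \<one>]"
  have ev: "eval p x = x [^] m \<ominus> \<one>" if "x \<in> carrier R" for x
  proof -
    have "eval (replicate (m - 1) \<zero> @ [\<ominus> \<one>]) x = eval [\<ominus> \<one>] x"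
      by (rule eval_replicate) (use that in auto)
    then show ?thesis using that assms by (simp add: p_def minus_eq)
  qed
  have "{x \<in> carrier R. x [^] m = \<one>} = {x \<in> carrier R. eval p x = \<zero>}" using ev by auto
  moreover have "set p \<subseteq> carrier R" "\<one> \<in> set p" "\<one> \<noteq> \<zero>" by (auto simp: p_def)
  moreover have "length p = m + 1" using assms by (simp add: p_def)
  ultimately show "finite {x \<in> carrier R. x [^] (m::nat) = \<one>}" "card {x \<in> carrier R. x [^] m = \<one>} \<le> m"
    using card_eval_zero[of p \<one>] by auto
qed

section \<open>The rational subfield of a number field\<close>

abbreviation rat_ring :: "rat ring" where "rat_ring \<equiv> ring_of_type_algebra"

lemma type_ring_simps [simp]:
  "carrier (ring_of_type_algebra :: 'r::comm_ring_1 ring) = UNIV"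
  "x \<otimes>\<^bsub>ring_of_type_algebra\<^esub> y = x * (y :: 'r)"
  "x \<oplus>\<^bsub>ring_of_type_algebra\<^esub> y = x + (y :: 'r)"
  "\<one>\<^bsub>ring_of_type_algebra\<^esub> = (1 :: 'r)"
  "\<zero>\<^bsub>ring_of_type_algebra\<^esub> = (0 :: 'r)"
  by (simp_all add: ring_of_type_algebra_def)

text \<open>A homomorphism is forced on the integers and then on quotients. This both identifies
  \<open>rat_emb\<close> in concrete fields and shows that automorphisms fix the rationals.\<close>

lemma (in field) rat_hom_unique:
  assumes g: "g \<in> ring_hom rat_ring R" shows "rat_emb R = g"
proof
  fix q :: rat
  have gc: "g x \<in> carrier R" for x using ring_hom_memE(1)[OF g, of x] by simp
  have gm: "g (x * y) = g x \<otimes> g y" for x y using ring_hom_memE(2)[OF g, of x y] by simp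
  have ga: "g (x + y) = g x \<oplus> g y" for x y using ring_hom_memE(3)[OF g, of x y] by simp
  have g1: "g 1 = \<one>" using ring_hom_memE(4)[OF g] by simp
  have g0: "g 0 = \<zero>" using ga[of 0 0] gc[of 0] by (metis add.l_cancel_one' add_0)
  have gneg: "g (- x) = \<ominus> g x" for x
    using ga[of "- x" x] g0 gc by (metis add.left_inverse minus_equality)
  have gnat: "g (of_nat n) = add_pow R n \<one>" for n
    by (induction n) (simp_all add: g0 g1 ga gc add.nat_pow_Suc2 a_comm)
  have gint: "g (of_int a) = add_pow R a \<one>" for a
  proof (cases a rule: int_cases2)
    case (nonneg n)
    then show ?thesis using gnat[of n] by (simp add: add_pow_def int_pow_int)
  next
    case (nonpos n)
    have "add_pow R (- int n) \<one> = \<ominus> (add_pow R n \<one>)" using add.int_pow_neg_int[of \<one> n] by simp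
    then show ?thesis using gnat[of n] gneg[of "of_nat n"] nonpos by simp
  qed
  obtain a b where ab: "quotient_of q = (a, b)" by force
  then have q: "q = of_int a / of_int b" and b: "b > 0"
    using quotient_of_div quotient_of_denom_pos by blast+
  have "g (of_int b) \<otimes> g (1 / of_int b) = \<one>" using b by (simp add: gm[symmetric] g1)
  then have "inv (g (of_int b)) = g (1 / of_int b)" using gc by (metis comm_inv_char)
  then have "rat_emb R q = g (of_int a) \<otimes> g (1 / of_int b)"
    unfolding rat_emb_def ab by (simp add: gint)
  also have "\<dots> = g q" unfolding gm[symmetric] q by simp
  finally show "rat_emb R q = g q" .
qed

context number_field begin

lemma rat_emb_closed [simp]: "rat_emb K q \<in> carrier K"
  using ring_hom_memE(1)[OF rat_emb_hom, of q] by simp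

lemma rat_emb_mult: "rat_emb K (p * q) = rat_emb K p \<otimes> rat_emb K q"
  using ring_hom_memE(2)[OF rat_emb_hom, of p q] by simp

lemma rat_emb_one: "rat_emb K 1 = \<one>"
  using ring_hom_memE(4)[OF rat_emb_hom] by simp

lemma rat_emb_ring_hom_ring: "ring_hom_ring rat_ring K (rat_emb K)"
  by (intro ring_hom_ringI2 rat_emb_hom ring_axioms field.is_ring) auto

lemma rat_emb_inj: "inj (rat_emb K)" and subfield_rat: "subfield (rat_subfield K) K"
proof -
  interpret Q: field rat_ring by auto
  interpret h: ring_hom_ring rat_ring K "rat_emb K" by (rule rat_emb_ring_hom_ring)
  show "inj (rat_emb K)" "subfield (rat_subfield K) K"
    using h.img_is_subfield[OF Q.carrier_is_subfield] by simp_all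
qed

lemma dimension_degree: "dimension (field_degree K) (rat_subfield K) (carrier K)"
  using finite_dimensionE[OF subfield_rat finite_degree] by (simp add: field_degree_def over_def)

lemma field_degreeI: "dimension n (rat_subfield K) (carrier K) \<Longrightarrow> field_degree K = n"
  using dimI[OF subfield_rat] by (simp add: field_degree_def over_def)

text \<open>The composition of \<open>rat_emb K\<close> with \<open>s\<close> is again a
  homomorphism from the rationals.\<close>

lemma aut_rat_emb:
  assumes "s \<in> ring_hom K K" shows "s (rat_emb K q) = rat_emb K q"
  using rat_hom_unique[OF ring_hom_trans[OF rat_emb_hom assms]] by (simp add: fun_eq_iff)

subsection \<open>Semilinear maps\<close>

text \<open>A normal form for the elements of L(K), a multiplication after an automorphism. It is
  stable under products because an automorphism \<open>s\<close> followed past the multiplication by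
  \<open>b\<close> turns it into the multiplication by \<open>s b\<close>.\<close>

definition semilinear :: "('a \<Rightarrow> 'a) \<Rightarrow> bool" where
  "semilinear f \<longleftrightarrow> f \<in> extensional (carrier K) \<and>
     (\<exists>a\<in>carrier K - {\<zero>}. \<exists>s\<in>ring_iso K K. \<forall>x\<in>carrier K. f x = a \<otimes> s x)"

lemma aut_hom: "s \<in> ring_iso K K \<Longrightarrow> s \<in> ring_hom K K"
  by (simp add: ring_iso_def)

lemma mult_op_Bij:
  assumes "a \<in> carrier K - {\<zero>}" shows "bij_betw (\<lambda>x. a \<otimes> x) (carrier K) (carrier K)"
proof (rule bij_betw_byWitness[where f' = "\<lambda>x. inv a \<otimes> x"])
  have a: "a \<in> carrier K" "inv a \<in> carrier K" "inv a \<otimes> a = \<one>" "a \<otimes> inv a = \<one>"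
    using assms field_Units by (auto intro: Units_inv_closed)
  show "\<forall>x\<in>carrier K. inv a \<otimes> (a \<otimes> x) = x" "\<forall>x\<in>carrier K. a \<otimes> (inv a \<otimes> x) = x"
    using a by (simp_all add: m_assoc[symmetric])
  show "(\<lambda>x. a \<otimes> x) ` carrier K \<subseteq> carrier K" "(\<lambda>x. inv a \<otimes> x) ` carrier K \<subseteq> carrier K"
    using a by auto
qed

lemma semilinear_in_GL:
  assumes "semilinear f" shows "f \<in> carrier (GL_rat K)"
proof -
  obtain a s where a: "a \<in> carrier K - {\<zero>}" and s: "s \<in> ring_iso K K"
    and f: "\<And>x. x \<in> carrier K \<Longrightarrow> f x = a \<otimes> s x" and e: "f \<in> extensional (carrier K)"
    using assms by (auto simp: semilinear_def)
  have "bij_betw ((\<lambda>x. a \<otimes> x) \<circ> s) (carrier K) (carrier K)"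
    using bij_betw_trans[OF ring_iso_memE(5)[OF s] mult_op_Bij[OF a]] .
  then have b: "bij_betw f (carrier K) (carrier K)"
    using bij_betw_cong[of "carrier K" f "(\<lambda>x. a \<otimes> x) \<circ> s"] f by simp
  have "rat_linear K f"
    using f a ring_iso_memE(1-3)[OF s] aut_rat_emb[OF aut_hom[OF s]]
    by (simp add: rat_linear_def r_distr m_lcomm)
  then show ?thesis using e b by (simp add: GL_rat_def Bij_def)
qed

lemma semilinear_compose:
  assumes "semilinear f" "semilinear g" shows "semilinear (compose (carrier K) f g)"
proof -
  obtain a s where a: "a \<in> carrier K - {\<zero>}" and s: "s \<in> ring_iso K K"
    and f: "\<And>x. x \<in> carrier K \<Longrightarrow> f x = a \<otimes> s x"
    using assms(1) by (auto simp: semilinear_def)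
  obtain b t where b: "b \<in> carrier K - {\<zero>}" and t: "t \<in> ring_iso K K"
    and g: "\<And>x. x \<in> carrier K \<Longrightarrow> g x = b \<otimes> t x"
    using assms(2) by (auto simp: semilinear_def)
  have "s b \<noteq> \<zero>"
  proof
    assume "s b = \<zero>"
    moreover have "s \<zero> = \<zero>" using ring_hom_zero[OF aut_hom[OF s]] ring_axioms by blast
    ultimately show False using inj_onD[OF bij_betw_imp_inj_on[OF ring_iso_memE(5)[OF s]], of b \<zero>] b by simp
  qed
  then have "a \<otimes> s b \<in> carrier K - {\<zero>}" using a b ring_iso_memE(1)[OF s] by (auto simp: integral_iff)
  moreover have "s \<circ> t \<in> ring_iso K K" by (rule ring_iso_set_trans[OF t s])
  moreover have "compose (carrier K) f g x = a \<otimes> s b \<otimes> (s \<circ> t) x" if "x \<in> carrier K" for x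
    using that a b f g ring_iso_memE(1,2)[OF s] ring_iso_memE(1)[OF t] by (simp add: compose_eq m_assoc)
  ultimately show ?thesis unfolding semilinear_def by (blast intro: compose_extensional)
qed

lemma semilinear_inverse:
  assumes "semilinear f" shows "semilinear (\<lambda>x\<in>carrier K. inv_into (carrier K) f x)"
proof -
  obtain a s where a: "a \<in> carrier K - {\<zero>}" and s: "s \<in> ring_iso K K"
    and f: "\<And>x. x \<in> carrier K \<Longrightarrow> f x = a \<otimes> s x"
    using assms by (auto simp: semilinear_def)
  have inj: "inj_on f (carrier K)"
    using semilinear_in_GL[OF assms] by (auto simp: GL_rat_def Bij_def bij_betw_def)
  define t where "t = inv_into (carrier K) s"
  have t: "t \<in> ring_iso K K" unfolding t_def by (rule ring_iso_set_sym[OF ring_axioms s])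
  have st: "s (t x) = x" if "x \<in> carrier K" for x
    unfolding t_def using bij_betw_inv_into_right[OF ring_iso_memE(5)[OF s]] that by blast
  have ia: "inv a \<in> carrier K" "a \<otimes> inv a = \<one>" "a \<in> carrier K"
    using a field_Units by (auto intro: Units_inv_closed)
  then have ia0: "inv a \<noteq> \<zero>" by (metis r_null one_not_zero)
  \<comment> \<open>Solving \<open>x = a \<otimes> s y\<close> for \<open>y\<close>, with
    \<open>t\<close> the inverse of \<open>s\<close>.\<close>
  have "inv_into (carrier K) f x = t (inv a) \<otimes> t x" if x: "x \<in> carrier K" for x
  proof (rule inv_into_f_eq[OF inj])
    show c: "t (inv a) \<otimes> t x \<in> carrier K" using x ia ring_iso_memE(1)[OF t] by simp
    have "t (inv a) \<otimes> t x = t (inv a \<otimes> x)" using x ia ring_iso_memE(2)[OF t] by simp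
    then show "f (t (inv a) \<otimes> t x) = x"
      using f c st x ia by (simp add: m_assoc[symmetric])
  qed
  moreover have "t (inv a) \<noteq> \<zero>"
  proof
    assume "t (inv a) = \<zero>"
    moreover have "s \<zero> = \<zero>" using ring_hom_zero[OF aut_hom[OF s]] ring_axioms by blast
    ultimately show False using st[OF ia(1)] ia0 by simp
  qed
  ultimately show ?thesis unfolding semilinear_def
    using t ia ring_iso_memE(1)[OF t] by (intro conjI bexI[of _ "t (inv a)"] bexI[of _ t]) auto
qed

lemma group_GL_rat: "group (GL_rat K)"
proof -
  interpret B: group "BijGroup (carrier K)" by (rule group_BijGroup)
  have "subgroup {f \<in> Bij (carrier K). rat_linear K f} (BijGroup (carrier K))"
  proof
    fix f g assume fg: "f \<in> {f \<in> Bij (carrier K). rat_linear K f}" "g \<in> {f \<in> Bij (carrier K). rat_linear K f}"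
    then have "g x \<in> carrier K" if "x \<in> carrier K" for x
      using that Bij_imp_funcset by blast
    then have "rat_linear K (compose (carrier K) f g)"
      using fg by (simp add: rat_linear_def compose_eq)
    then show "f \<otimes>\<^bsub>BijGroup (carrier K)\<^esub> g \<in> {f \<in> Bij (carrier K). rat_linear K f}"
      using fg by (simp add: BijGroup_def compose_Bij)
  next
    fix f assume f: "f \<in> {f \<in> Bij (carrier K). rat_linear K f}"
    then have bij: "bij_betw f (carrier K) (carrier K)" by (simp add: Bij_def)
    let ?g = "inv_into (carrier K) f"
    have gc: "?g x \<in> carrier K" if "x \<in> carrier K" for x
      using Bij_inv_into_mem[of f "carrier K" x] f that by simp
    have fg: "f (?g x) = x" if "x \<in> carrier K" for x
      by (rule bij_betw_inv_into_right[OF bij that])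
    have inj: "inj_on f (carrier K)" using bij by (simp add: bij_betw_def)
    have "rat_linear K (\<lambda>x\<in>carrier K. ?g x)"
      unfolding rat_linear_def
    proof (intro conjI ballI allI)
      fix x y assume xy: "x \<in> carrier K" "y \<in> carrier K"
      have "f (?g x \<oplus> ?g y) = x \<oplus> y" using f xy gc fg by (simp add: rat_linear_def)
      then have "?g (x \<oplus> y) = ?g x \<oplus> ?g y" using inj gc xy by (intro inv_into_f_eq) auto
      then show "(\<lambda>x\<in>carrier K. ?g x) (x \<oplus> y) = (\<lambda>x\<in>carrier K. ?g x) x \<oplus> (\<lambda>x\<in>carrier K. ?g x) y"
        using xy by simp
    next
      fix q x assume x: "x \<in> carrier K"
      have "f (rat_emb K q \<otimes> ?g x) = rat_emb K q \<otimes> x" using f x gc fg by (simp add: rat_linear_def)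
      then have "?g (rat_emb K q \<otimes> x) = rat_emb K q \<otimes> ?g x" using inj gc x by (intro inv_into_f_eq) auto
      then show "(\<lambda>x\<in>carrier K. ?g x) (rat_emb K q \<otimes> x) = rat_emb K q \<otimes> (\<lambda>x\<in>carrier K. ?g x) x"
        using x by simp
    qed
    then show "inv\<^bsub>BijGroup (carrier K)\<^esub> f \<in> {f \<in> Bij (carrier K). rat_linear K f}"
      using f by (simp add: inv_BijGroup restrict_inv_into_Bij)
  qed (auto simp: BijGroup_def id_Bij rat_linear_def)
  then show ?thesis unfolding GL_rat_def by (rule B.subgroup_imp_group)
qed

lemma carrier_GL: "carrier (GL_rat K) = {f \<in> Bij (carrier K). rat_linear K f}"
  by (simp add: GL_rat_def)

lemma GL_mult: "f \<in> carrier (GL_rat K) \<Longrightarrow> g \<in> carrier (GL_rat K) \<Longrightarrow>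
    f \<otimes>\<^bsub>GL_rat K\<^esub> g = compose (carrier K) f g"
  by (simp add: GL_rat_def BijGroup_def)

lemma GL_one: "\<one>\<^bsub>GL_rat K\<^esub> = (\<lambda>x\<in>carrier K. x)"
  by (simp add: GL_rat_def BijGroup_def)

lemma GL_inv:
  assumes "f \<in> carrier (GL_rat K)" "(\<lambda>x\<in>carrier K. inv_into (carrier K) f x) \<in> carrier (GL_rat K)"
  shows "inv\<^bsub>GL_rat K\<^esub> f = (\<lambda>x\<in>carrier K. inv_into (carrier K) f x)"
  using assms by (intro group.inv_equality[OF group_GL_rat])
    (auto simp: GL_mult GL_one carrier_GL Bij_compose_restrict_eq)

lemma mult_op_semilinear:
  assumes "a \<in> carrier K - {\<zero>}" shows "semilinear (mult_op K a)"
proof -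
  have "id \<in> ring_iso K K" by (rule ring_iso_set_refl)
  then show ?thesis unfolding semilinear_def using assms
    by (intro conjI bexI[of _ a] bexI[of _ id]) (auto simp: mult_op_def)
qed

lemma aut_semilinear:
  assumes "s \<in> field_Aut K" shows "semilinear s"
  unfolding semilinear_def using assms ring_iso_memE(1)[of s K K]
  by (intro conjI bexI[of _ \<one>] bexI[of _ s]) (auto simp: field_Aut_def)

abbreviation L :: "('a \<Rightarrow> 'a) monoid" where "L \<equiv> L_group K"
abbreviation L_op :: "('a \<Rightarrow> 'a) \<Rightarrow> ('a \<Rightarrow> 'a) \<Rightarrow> 'a \<Rightarrow> 'a"  (infixl \<open>\<star>\<close> 70)
  where "f \<star> g \<equiv> f \<otimes>\<^bsub>L\<^esub> g"
abbreviation mult_ops :: "('a \<Rightarrow> 'a) set" where "mult_ops \<equiv> mult_op K ` (carrier K - {\<zero>})"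

lemma group_L: "group L"
  unfolding L_group_def by (rule group.group_subgroup_generated[OF group_GL_rat])

lemma L_one: "\<one>\<^bsub>L\<^esub> = (\<lambda>x\<in>carrier K. x)"
  by (simp add: L_group_def GL_one)

lemma L_semilinear:
  assumes "f \<in> carrier L" shows "semilinear f"
proof -
  interpret GL: group "GL_rat K" by (rule group_GL_rat)
  have "subgroup {f. semilinear f} (GL_rat K)"
  proof
    show "{f. semilinear f} \<subseteq> carrier (GL_rat K)" using semilinear_in_GL by blast
    show "f \<otimes>\<^bsub>GL_rat K\<^esub> g \<in> {f. semilinear f}" if "f \<in> {f. semilinear f}" "g \<in> {f. semilinear f}" for f g
      using that semilinear_in_GL semilinear_compose by (simp add: GL_mult)
    show "\<one>\<^bsub>GL_rat K\<^esub> \<in> {f. semilinear f}"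
    proof -
      have "mult_op K \<one> = (\<lambda>x\<in>carrier K. x)" by (auto simp: mult_op_def)
      then show ?thesis using mult_op_semilinear[of \<one>] by (simp add: GL_one)
    qed
    show "inv\<^bsub>GL_rat K\<^esub> f \<in> {f. semilinear f}" if "f \<in> {f. semilinear f}" for f
      using that semilinear_in_GL semilinear_inverse by (simp add: GL_inv)
  qed
  moreover have "field_Aut K \<union> mult_ops \<subseteq> {f. semilinear f}"
    using mult_op_semilinear aut_semilinear by blast
  ultimately have "carrier L \<subseteq> {f. semilinear f}"
    unfolding L_group_def by (rule GL.subgroup_generated_minimal)
  then show ?thesis using assms by blast
qed

lemma L_generators:
  "s \<in> field_Aut K \<Longrightarrow> s \<in> carrier L"
  "a \<in> carrier K - {\<zero>} \<Longrightarrow> mult_op K a \<in> carrier L"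
  using semilinear_in_GL[OF aut_semilinear] semilinear_in_GL[OF mult_op_semilinear]
  unfolding L_group_def carrier_subgroup_generated by (auto intro!: generate.incl)

lemma L_mult: "f \<in> carrier L \<Longrightarrow> g \<in> carrier L \<Longrightarrow>
    f \<star> g = compose (carrier K) f g"
  using semilinear_in_GL[OF L_semilinear] by (simp add: L_group_def GL_mult)

end

section \<open>Automorphisms of number fields and cube roots of unity in cubic fields\<close>

context number_field begin

lemma hom_ring_hom_ring: "s \<in> ring_hom K K \<Longrightarrow> ring_hom_ring K K s"
  by (intro ring_hom_ringI2 ring_axioms)

lemma aut_eq_on_Span:
  assumes s: "s \<in> ring_hom K K" and t: "t \<in> ring_hom K K"
    and "set Ks \<subseteq> rat_subfield K" "set Us \<subseteq> carrier K" "\<And>u. u \<in> set Us \<Longrightarrow> s u = t u"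
  shows "s (combine Ks Us) = t (combine Ks Us)"
  using assms(3-5)
proof (induction Ks Us rule: combine.induct)
  case (1 k Ks u Us)
  then have c: "k \<in> carrier K" "u \<in> carrier K" "combine Ks Us \<in> carrier K"
    by (auto intro!: combine_in_carrier)
  have k: "s k = k" "t k = k" using 1(2) aut_rat_emb[OF s] aut_rat_emb[OF t] by auto
  then show ?case using 1 c ring_hom_memE(2,3)[OF s] ring_hom_memE(2,3)[OF t] by simp
qed (use ring_hom_zero[OF s ring_axioms ring_axioms] ring_hom_zero[OF t ring_axioms ring_axioms] in simp_all)

lemma eval_map_diff:
  assumes "\<And>u. u \<in> set Us \<Longrightarrow> s u \<in> carrier K" "\<And>u. u \<in> set Us \<Longrightarrow> t u \<in> carrier K" "x \<in> carrier K"
  shows "eval (map (\<lambda>u. s u \<ominus> t u) Us) x = eval (map s Us) x \<ominus> eval (map t Us) x"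
  using assms(1,2)
proof (induction Us)
  case (Cons u Us)
  have c: "eval (map s Us) x \<in> carrier K" "eval (map t Us) x \<in> carrier K" "s u \<in> carrier K" "t u \<in> carrier K"
    "x [^] length Us \<in> carrier K"
    using Cons assms(3) by (auto intro!: eval_in_carrier)
  have "(s u \<ominus> t u) \<otimes> x [^] length Us \<oplus> (eval (map s Us) x \<ominus> eval (map t Us) x) =
    s u \<otimes> x [^] length Us \<oplus> eval (map s Us) x \<ominus> (t u \<otimes> x [^] length Us \<oplus> eval (map t Us) x)"
    using c by algebra
  then show ?case using Cons by simp
qed (simp add: minus_eq)

text \<open>A rational value of the parameter of a curve in \<open>K\<close> that spans \<open>K\<close> gives a point whose
  images under finitely many automorphisms are distinct. These images are the roots of a polynomial
  over the rationals, of degree at most the degree of \<open>K\<close>.\<close>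

lemma card_automorphisms_le:
  assumes S: "S \<subseteq> field_Aut K" "finite S" shows "card S \<le> field_degree K"
proof (rule ccontr)
  assume "\<not> card S \<le> field_degree K"
  then have big: "field_degree K < card S" by simp
  have hom: "s \<in> ring_hom K K" if "s \<in> S" for s using that S by (auto simp: field_Aut_def aut_hom)
  have sc: "s x \<in> carrier K" if "s \<in> S" "x \<in> carrier K" for s x
    using that ring_hom_memE(1)[OF hom] by blast
  obtain Us where Us: "set Us \<subseteq> carrier K" "Span (rat_subfield K) Us = carrier K"
    using exists_base[OF subfield_rat dimension_degree] by blast
  have separate: "\<exists>u\<in>set Us. s u \<noteq> t u" if st: "s \<in> S" "t \<in> S" "s \<noteq> t" for s t
  proof (rule ccontr)
    assume "\<not> (\<exists>u\<in>set Us. s u \<noteq> t u)"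
    then have e: "\<And>u. u \<in> set Us \<Longrightarrow> s u = t u" by blast
    have "s x = t x" if "x \<in> carrier K" for x
    proof -
      have "x \<in> Span (rat_subfield K) Us" using that Us(2) by simp
      then obtain Ks where "x = combine Ks Us" "set Ks \<subseteq> rat_subfield K"
        unfolding Span_eq_combine_set[OF subfield_rat Us(1)] by blast
      then show ?thesis using aut_eq_on_Span[OF hom[OF st(1)] hom[OF st(2)] _ Us(1) e] by blast
    qed
    moreover have "s \<in> extensional (carrier K)" "t \<in> extensional (carrier K)"
      using st S by (auto simp: field_Aut_def)
    ultimately show False using st(3) extensionalityI by blast
  qed
  \<comment> \<open>Taking the spanning family \<open>Us\<close> as coefficients of a polynomial
    curve, \<open>d s t\<close> lists the coefficients of the difference of its images under
    \<open>s\<close> and \<open>t\<close>, and \<open>T\<close> collects the parameters at which two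
    images meet.\<close>
  define d where "d s t = map (\<lambda>u. s u \<ominus> t u) Us" for s t :: "'a \<Rightarrow> 'a"
  define T where "T = (\<Union>p\<in>{p\<in>S \<times> S. fst p \<noteq> snd p}. {x \<in> carrier K. eval (d (fst p) (snd p)) x = \<zero>})"
  have "finite {x \<in> carrier K. eval (d s t) x = \<zero>}" if st: "s \<in> S" "t \<in> S" "s \<noteq> t" for s t
  proof -
    obtain u where u: "u \<in> set Us" "s u \<noteq> t u" using separate[OF st] by blast
    have "s u \<ominus> t u \<noteq> \<zero>"
    proof
      assume "s u \<ominus> t u = \<zero>"
      then have "s u = t u" using sc st u(1) Us(1) r_right_minus_eq by blast
      then show False using u(2) by simp
    qed
    moreover have "s u \<ominus> t u \<in> set (d s t)" using u(1) by (simp add: d_def)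
    moreover have "set (d s t) \<subseteq> carrier K" using sc st Us(1) by (auto simp: d_def)
    ultimately show ?thesis using card_eval_zero(1) by blast
  qed
  then have "finite T" unfolding T_def using S(2) by (intro finite_UN_I) auto
  moreover have "infinite (range (rat_emb K))"
    using rat_emb_inj infinite_UNIV_char_0 finite_imageD by blast
  ultimately obtain q where q: "rat_emb K q \<notin> T" by (metis finite_subset rangeE subsetI)
  define c where "c = rat_emb K q"
  define z where "z = eval Us c"
  have c: "c \<in> carrier K" by (simp add: c_def)
  have z: "z \<in> carrier K" unfolding z_def by (rule eval_in_carrier[OF Us(1) c])
  have sz: "s z = eval (map s Us) c" if "s \<in> S" for s
  proof -
    interpret h: ring_hom_ring K K s by (rule hom_ring_hom_ring[OF hom[OF that]])
    have "s c = c" unfolding c_def by (rule aut_rat_emb[OF hom[OF that]])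
    then show ?thesis using h.eval_hom'[OF c Us(1)] by (simp add: z_def)
  qed
  have "inj_on (\<lambda>s. s z) S"
  proof (rule inj_onI)
    fix s t assume st: "s \<in> S" "t \<in> S" and e: "s z = t z"
    show "s = t"
    proof (rule ccontr)
      assume ne: "s \<noteq> t"
      have "eval (d s t) c = s z \<ominus> t z"
        unfolding sz[OF st(1)] sz[OF st(2)] d_def
        by (rule eval_map_diff) (use sc st Us(1) c in auto)
      also have "\<dots> = \<zero>" using e sc[OF st(2) z] by (simp add: r_right_minus_eq)
      finally have "c \<in> T" unfolding T_def using st ne c
        by (intro UN_I[of "(s, t)"]) auto
      then show False using q by (simp add: c_def)
    qed
  qed
  then have card: "card ((\<lambda>s. s z) ` S) = card S" by (rule card_image)
  let ?P = "exp_base z (card S)"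
  have P: "set ?P \<subseteq> carrier K" "length ?P = card S" using exp_base_closed[OF z] by (simp_all add: exp_base_def)
  \<comment> \<open>The first \<open>card S\<close> powers of \<open>z\<close> outnumber the degree,
    so \<open>z\<close> satisfies a nontrivial rational equation.\<close>
  have "\<not> independent (rat_subfield K) ?P"
  proof
    assume "independent (rat_subfield K) ?P"
    from independent_length_le_dimension[OF subfield_rat dimension_degree this P(1)]
    show False using P(2) big by simp
  qed
  then obtain Ks where Ks: "set Ks \<subseteq> rat_subfield K" "combine Ks ?P = \<zero>" "\<not> set (take (card S) Ks) \<subseteq> {\<zero>}"
    using trivial_combine_imp_independent[OF subfield_rat P(1)] P(2) by metis
  \<comment> \<open>The relation is cut or padded with zeros to exactly \<open>card S\<close>
    coefficients, so that it can be read as a polynomial with fewer than \<open>card S\<close>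
    roots.\<close>
  define p where "p = take (card S) Ks @ replicate (card S - length Ks) \<zero>"
  have len: "length p = card S" by (simp add: p_def)
  have "combine p ?P = combine (take (length ?P) Ks) ?P"
    unfolding p_def P(2) by (rule combine_append_replicate[OF P(1)])
  then have "combine p ?P = \<zero>" using combine_take Ks(2) by simp
  then have pz: "eval p z = \<zero>" using combine_eq_eval[of p z] len by simp
  have "\<zero> \<in> rat_subfield K" using subfield_rat by (meson subfieldE(1) subringE(2))
  then have pQ: "set p \<subseteq> rat_subfield K" using Ks(1) set_take_subset unfolding p_def by fastforce
  then have pK: "set p \<subseteq> carrier K" by auto
  obtain k where k: "k \<in> set p" "k \<noteq> \<zero>" using Ks(3) by (auto simp: p_def)
  have "(\<lambda>s. s z) ` S \<subseteq> {x \<in> carrier K. eval p x = \<zero>}"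
  proof clarify
    fix s assume s: "s \<in> S"
    interpret h: ring_hom_ring K K s by (rule hom_ring_hom_ring[OF hom[OF s]])
    have "map s p = p" using pQ aut_rat_emb[OF hom[OF s]] by (intro map_idI) auto
    then have "s (eval p z) = eval p (s z)" using h.eval_hom'[OF z pK] by simp
    then show "s z \<in> carrier K \<and> eval p (s z) = \<zero>" using pz sc[OF s z] by simp
  qed
  then have "card S \<le> card {x \<in> carrier K. eval p x = \<zero>}"
    using card_mono[OF card_eval_zero(1)[OF pK k], of "(\<lambda>s. s z) ` S"] card by simp
  then show False using card_eval_zero(2)[OF pK k] len by simp
qed

text \<open>A nontrivial \<open>x\<close> is a root of X^2 + X + 1 and is not rational, as 1 is the
  only rational cube root of 1. Its degree over the rationals is at most 2 and divides 3 by
  multiplicativity in towers, so it would be 1, although \<open>x\<close> and \<open>\<one>\<close>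
  are independent.\<close>

lemma cube_root_of_unity_cubic:
  assumes n: "field_degree K = 3" and x: "x \<in> carrier K" "x [^] (3::nat) = \<one>" shows "x = \<one>"
proof (rule ccontr)
  assume x1: "x \<noteq> \<one>"
  have q: "x \<otimes> x \<oplus> x \<oplus> \<one> = \<zero>"
  proof -
    have "(x \<ominus> \<one>) \<otimes> (x \<otimes> x \<oplus> x \<oplus> \<one>) = x \<otimes> x \<otimes> x \<ominus> \<one>" using x(1) by algebra
    also have "x \<otimes> x \<otimes> x = \<one>" using x by (simp add: eval_nat_numeral)
    finally have "(x \<ominus> \<one>) \<otimes> (x \<otimes> x \<oplus> x \<oplus> \<one>) = \<zero>" by (simp add: minus_eq r_neg)
    moreover have "x \<ominus> \<one> \<noteq> \<zero>" using x x1 by (simp add: r_right_minus_eq)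
    ultimately show ?thesis using x(1) by (simp add: integral_iff)
  qed
  have xQ: "x \<notin> rat_subfield K"
  proof
    assume "x \<in> rat_subfield K"
    then obtain r where r: "x = rat_emb K r" by blast
    have "rat_emb K (r * r * r) = x [^] (3::nat)"
      using x(1) by (simp add: rat_emb_mult r eval_nat_numeral)
    then have "rat_emb K (r * r * r) = rat_emb K 1" using x(2) by (simp add: rat_emb_one)
    then have "r * r * r = 1" using rat_emb_inj by (simp add: inj_eq)
    then have "r ^ 3 = 1" by (simp add: eval_nat_numeral)
    then have "r = 1" using power_eq_iff_eq_base[of 3 r 1] by (metis one_power2 power_one zero_less_numeral
        zero_le_one power_le_zero_eq not_one_le_zero linorder_le_cases odd_numeral) 
    then show False using r x1 by (simp add: rat_emb_one)
  qed
  define F where "F = rat_subfield K"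
  have F: "subfield F K" using subfield_rat by (simp add: F_def)
  have one: "\<one> \<in> F" "\<one> \<noteq> \<zero>" using F by (auto dest: subfieldE(1) subringE(3))
  have p: "[\<one>, \<one>, \<one>] \<in> carrier (F[X]\<^bsub>K\<^esub>)" "eval [\<one>, \<one>, \<one>] x = \<zero>"
  proof -
    show "[\<one>, \<one>, \<one>] \<in> carrier (F[X]\<^bsub>K\<^esub>)" using one by (simp add: univ_poly_carrier[symmetric] polynomial_def)
    show "eval [\<one>, \<one>, \<one>] x = \<zero>" using q x(1) by (simp add: eval_nat_numeral a_assoc)
  qed
  have alg: "(algebraic over F) x" by (rule algebraicI[OF p(1) _ p(2)]) simp
  let ?E = "simple_extension F x"
  have E: "subfield ?E K" using simple_extension_is_subfield[OF F x(1)] alg by blast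
  have dE: "dimension (degree (Irr F x)) F ?E" by (rule dimension_simple_extension[OF F x(1) alg])
  have "degree (Irr F x) \<le> degree [\<one>, \<one>, \<one>]"
    by (rule pdivides_imp_degree_le[OF subfieldE(1)[OF F] IrrE(1)[OF F x(1) alg] p(1) _ Irr_minimal[OF F x(1) alg p]]) simp
  then have d2: "degree (Irr F x) \<le> 2" by simp
  have "finite_dimension F (carrier K)" using finite_dimensionI[OF dimension_degree] by (simp add: F_def)
  then have "finite_dimension ?E (carrier K)"
  proof -
    obtain Us where Us: "set Us \<subseteq> carrier K" "Span F Us = carrier K"
      using exists_base[OF subfield_rat dimension_degree] F_def by blast
    have "F \<subseteq> ?E" using simple_extension_incl[OF subfieldE(3)[OF F] x(1)] .
    then have "Span F Us \<subseteq> Span ?E Us"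
      unfolding Span_eq_combine_set[OF F Us(1)] Span_eq_combine_set[OF E Us(1)] by blast
    then have "Span ?E Us = carrier K" using Us(2) Span_in_carrier[OF subfieldE(3)[OF E] Us(1)] by blast
    then show ?thesis using Span_finite_dimension[OF E Us(1)] by simp
  qed
  then have "(dim over F) (carrier K) = (dim over F) ?E * (dim over ?E) (carrier K)"
    by (rule telescopic_base_dim(2)[OF F E finite_dimensionI[OF dE]])
  then have "3 = degree (Irr F x) * (dim over ?E) (carrier K)"
    using dimI[OF F dE] n by (simp add: field_degree_def over_def F_def)
  then have "degree (Irr F x) dvd 3" by (metis dvd_triv_left)
  moreover have "degree (Irr F x) = 0 \<or> degree (Irr F x) = 1 \<or> degree (Irr F x) = 2" using d2 by linarith
  ultimately have "degree (Irr F x) = 1" by (elim disjE) simp_all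
  then have dE1: "dimension 1 F ?E" using dE by simp
  have xE: "x \<in> ?E" "\<one> \<in> ?E"
    using simple_extension_mem[OF subfieldE(1)[OF F] x(1)] subringE(3)[OF subfieldE(1)[OF E]] by auto
  have "independent F [x, \<one>]"
  proof (rule li_Cons[OF x(1)])
    have "Span F [\<one>] = F"
      using line_extension_mem_iff[of _ F \<one> "{\<zero>}"] subfieldE(3)[OF F] by (auto simp add: rev_subsetD)
    then show "x \<notin> Span F [\<one>]" using xQ by (simp add: F_def)
    show "independent F [\<one>]" using one by (intro li_Cons) auto
  qed
  then show False using independent_length_le_dimension[OF F dE1] xE by fastforce
qed

section \<open>Multiplication operators as a normal subgroup of small index\<close>

text \<open>Automorphisms fix \<open>\<one>\<close>, so the scalar is the value there. The
  automorphism is restricted to make it extensional, as \<open>field_Aut\<close> requires.\<close>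

lemma semilinear_scalar:
  assumes "semilinear f"
  obtains s where "s \<in> field_Aut K" "f \<one> \<in> carrier K - {\<zero>}" "\<And>x. x \<in> carrier K \<Longrightarrow> f x = f \<one> \<otimes> s x"
proof -
  obtain a s where a: "a \<in> carrier K - {\<zero>}" and s: "s \<in> ring_iso K K"
    and f: "\<And>x. x \<in> carrier K \<Longrightarrow> f x = a \<otimes> s x"
    using assms by (auto simp: semilinear_def)
  have f1: "f \<one> = a" using f[of \<one>] a ring_iso_memE(4)[OF s] by simp
  have "restrict s (carrier K) \<in> ring_iso K K" by (rule ring_iso_restrict[OF s]) simp
  then show ?thesis using that[of "restrict s (carrier K)"] a f f1 by (simp add: field_Aut_def)
qed

lemma mult_op_apply: "x \<in> carrier K \<Longrightarrow> mult_op K a x = a \<otimes> x"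
  by (simp add: mult_op_def)

lemma L_extensional: "f \<in> carrier L \<Longrightarrow> f \<in> extensional (carrier K)"
  using L_semilinear by (auto simp: semilinear_def)

lemma L_closed: "f \<in> carrier L \<Longrightarrow> x \<in> carrier K \<Longrightarrow> f x \<in> carrier K"
  using semilinear_in_GL[OF L_semilinear] Bij_imp_funcset by (fastforce simp: carrier_GL)

lemma L_eqI:
  "f \<in> carrier L \<Longrightarrow> g \<in> carrier L \<Longrightarrow> (\<And>x. x \<in> carrier K \<Longrightarrow> f x = g x) \<Longrightarrow> f = g"
  using extensionalityI[OF L_extensional L_extensional] by blast

lemma L_mult_apply:
  "f \<in> carrier L \<Longrightarrow> g \<in> carrier L \<Longrightarrow> x \<in> carrier K \<Longrightarrow>
    (f \<star> g) x = f (g x)"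
  by (simp add: L_mult compose_eq)

lemma mult_op_mult:
  assumes "a \<in> carrier K - {\<zero>}" "b \<in> carrier K - {\<zero>}"
  shows "mult_op K a \<star> mult_op K b = mult_op K (a \<otimes> b)"
proof -
  interpret L: group "L_group K" by (rule group_L)
  have "a \<otimes> b \<in> carrier K - {\<zero>}" using assms by (simp add: integral_iff)
  with assms show ?thesis
    by (intro L_eqI L.m_closed L_generators) (auto simp: L_mult_apply L_generators mult_op_apply m_assoc)
qed

lemma mult_op_one: "mult_op K \<one> = \<one>\<^bsub>L\<^esub>"
  by (auto simp: mult_op_def L_one)

lemma mult_op_eq_iff: "a \<in> carrier K \<Longrightarrow> b \<in> carrier K \<Longrightarrow> mult_op K a = mult_op K b \<longleftrightarrow> a = b"
  using mult_op_apply[of \<one>] by (metis one_closed r_one)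

lemma mult_op_pow:
  assumes a: "a \<in> carrier K - {\<zero>}" shows "mult_op K a [^]\<^bsub>L\<^esub> (m::nat) = mult_op K (a [^] m)"
proof (induction m)
  case (Suc m)
  have "a [^] m \<in> carrier K - {\<zero>}" using a by (induction m) (auto simp: integral_iff)
  then show ?case using Suc a by (simp add: mult_op_mult)
qed (simp add: mult_op_one)

lemma subgroup_mult_ops: "subgroup mult_ops L"
proof
  interpret L: group "L_group K" by (rule group_L)
  show "mult_ops \<subseteq> carrier L" using L_generators by blast
  fix f assume "f \<in> mult_ops"
  then obtain a where a: "a \<in> carrier K - {\<zero>}" "f = mult_op K a" by blast
  have ia: "inv a \<in> carrier K - {\<zero>}" "inv a \<otimes> a = \<one>"
    using a field_Units by (metis Units_inv_Units, metis Units_l_inv)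
  then have "mult_op K (inv a) \<star> f = \<one>\<^bsub>L\<^esub>"
    using a by (simp only: mult_op_mult mult_op_one)
  then have "inv\<^bsub>L\<^esub> f = mult_op K (inv a)"
    using L.inv_equality L_generators(2) a ia by metis
  then show "inv\<^bsub>L\<^esub> f \<in> mult_ops" using ia by blast
next
  show "f \<star> g \<in> mult_ops"
    if "f \<in> mult_ops" "g \<in> mult_ops" for f g
    using that by (auto simp: mult_op_mult integral_iff)
  show "\<one>\<^bsub>L\<^esub> \<in> mult_ops" using mult_op_one by force
qed

text \<open>Conjugating multiplication by \<open>a\<close> with an operator whose automorphism part
  is \<open>s\<close> yields multiplication by \<open>s a\<close>.\<close>

lemma mult_ops_normal:
  assumes g: "g \<in> carrier L" and c: "c \<in> mult_ops"
  shows "g \<star> c \<star> inv\<^bsub>L\<^esub> g \<in> mult_ops"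
proof -
  interpret L: group "L_group K" by (rule group_L)
  obtain a where a: "a \<in> carrier K - {\<zero>}" "c = mult_op K a" using c by blast
  obtain s where s: "s \<in> field_Aut K" "g \<one> \<in> carrier K - {\<zero>}" "\<And>x. x \<in> carrier K \<Longrightarrow> g x = g \<one> \<otimes> s x"
    using semilinear_scalar[OF L_semilinear[OF g]] by blast
  have si: "s \<in> ring_iso K K" using s(1) by (simp add: field_Aut_def)
  have cL: "c \<in> carrier L" using a L_generators by blast
  have sa: "s a \<in> carrier K" using a ring_iso_memE(1)[OF si] by simp
  have ga: "g a \<noteq> \<zero>"
  proof
    assume "g a = \<zero>"
    moreover have "g \<zero> = \<zero>" using s(2) s(3)[of \<zero>] ring_hom_zero[OF aut_hom[OF si]] ring_axioms by simp
    moreover have "inj_on g (carrier K)"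
      using semilinear_in_GL[OF L_semilinear[OF g]] by (auto simp: carrier_GL Bij_def bij_betw_def)
    ultimately show False using inj_onD[of g "carrier K" a \<zero>] a by auto
  qed
  then have sa0: "s a \<in> carrier K - {\<zero>}" using s(2) s(3)[of a] a sa by (auto simp: integral_iff)
  have "g \<star> c = mult_op K (s a) \<star> g"
  proof (rule L_eqI)
    fix x assume x: "x \<in> carrier K"
    have "g (a \<otimes> x) = g \<one> \<otimes> (s a \<otimes> s x)" using s(3)[of "a \<otimes> x"] a x ring_iso_memE(2)[OF si] by simp
    also have "\<dots> = s a \<otimes> g x" using s(2) s(3)[OF x] x sa ring_iso_memE(1)[OF si] by (simp add: m_lcomm)
    finally show "(g \<star> c) x = (mult_op K (s a) \<star> g) x"
      using g cL x a sa0 by (simp add: L_mult_apply L_generators mult_op_apply L_closed)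
  qed (use g cL sa0 in \<open>auto simp: L_generators\<close>)
  then have "g \<star> c \<star> inv\<^bsub>L\<^esub> g = mult_op K (s a)"
    using g sa0 L_generators(2) by (simp add: L.m_assoc)
  then show ?thesis using sa0 by blast
qed

text \<open>The fibres of the map to automorphism parts are cosets of the multiplications in
  \<open>G\<close>, and \<open>card_automorphisms_le\<close> bounds their number.\<close>

lemma card_le_mult_part:
  assumes G: "subgroup G L" "finite G"
  shows "card G \<le> field_degree K * card (G \<inter> mult_ops)"
proof -
  interpret L: group "L_group K" by (rule group_L)
  have GL: "f \<in> carrier L" if "f \<in> G" for f using that G(1) by (meson subgroup.mem_carrier)
  have "\<exists>s. s \<in> field_Aut K \<and> (\<forall>x\<in>carrier K. f x = f \<one> \<otimes> s x)" if "f \<in> G" for f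
    using semilinear_scalar[OF L_semilinear[OF GL[OF that]]] by metis
  then obtain s where s: "\<And>f. f \<in> G \<Longrightarrow> s f \<in> field_Aut K"
    "\<And>f x. f \<in> G \<Longrightarrow> x \<in> carrier K \<Longrightarrow> f x = f \<one> \<otimes> s f x" by metis
  have f1: "f \<one> \<in> carrier K - {\<zero>}" if "f \<in> G" for f
    using semilinear_scalar[OF L_semilinear[OF GL[OF that]]] by metis
  have same: "f \<star> inv\<^bsub>L\<^esub> g \<in> G \<inter> mult_ops" if f: "f \<in> G" and g: "g \<in> G" and e: "s f = s g" for f g
  proof -
    \<comment> \<open>With equal automorphism parts, \<open>f\<close> is \<open>g\<close> followed
      by multiplication by the quotient of their values at \<open>\<one>\<close>.\<close>
    define a where "a = f \<one> \<otimes> inv (g \<one>)"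
    have ig: "inv (g \<one>) \<in> carrier K - {\<zero>}" "inv (g \<one>) \<otimes> g \<one> = \<one>"
      using f1[OF g] field_Units by (metis Units_inv_Units, metis Units_l_inv)
    then have a: "a \<in> carrier K - {\<zero>}" using f1[OF f] by (simp add: a_def integral_iff)
    have "f = mult_op K a \<star> g"
    proof (rule L_eqI)
      fix x assume x: "x \<in> carrier K"
      have sx: "s g x \<in> carrier K" using s(1)[OF g] x ring_iso_memE(1) by (fastforce simp: field_Aut_def)
      have "a \<otimes> (g \<one> \<otimes> s g x) = f \<one> \<otimes> (inv (g \<one>) \<otimes> g \<one>) \<otimes> s g x"
        using f1[OF f] f1[OF g] ig(1) sx by (simp add: a_def m_assoc)
      also have "\<dots> = f x" using s(2)[OF f x] f1[OF f] sx e unfolding ig(2) by simp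
      finally have "a \<otimes> g x = f x" unfolding s(2)[OF g x, symmetric] .
      then show "f x = (mult_op K a \<star> g) x"
        using a g x by (simp add: L_mult_apply L_generators GL mult_op_apply L_closed)
    qed (use f g a in \<open>auto simp: GL L_generators\<close>)
    then have "f \<star> inv\<^bsub>L\<^esub> g = mult_op K a"
      using GL[OF g] L_generators(2)[OF a] by (simp add: L.m_assoc)
    moreover have "f \<star> inv\<^bsub>L\<^esub> g \<in> G"
      using f g G(1) by (meson subgroup.m_closed subgroup.m_inv_closed)
    ultimately show ?thesis using a by auto
  qed
  \<comment> \<open>One representative per automorphism part; dividing by it embeds \<open>G\<close>
    into pairs of an automorphism and a multiplication.\<close>
  define r where "r t = (SOME g. g \<in> G \<and> s g = t)" for t
  have r: "r (s f) \<in> G \<and> s (r (s f)) = s f" if "f \<in> G" for f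
    unfolding r_def by (rule someI[of _ f]) (use that in simp)
  define h where "h f = (s f, f \<star> inv\<^bsub>L\<^esub> (r (s f)))" for f
  have "inj_on h G"
  proof (rule inj_onI)
    fix f g assume fg: "f \<in> G" "g \<in> G" "h f = h g"
    then have "s f = s g" "f \<star> inv\<^bsub>L\<^esub> (r (s f)) = g \<star> inv\<^bsub>L\<^esub> (r (s f))"
      by (auto simp: h_def)
    then show "f = g" using L.r_cancel GL fg r[OF fg(1)] by (metis L.inv_closed)
  qed
  moreover have "h ` G \<subseteq> s ` G \<times> (G \<inter> mult_ops)"
    using same r by (auto simp: h_def)
  ultimately have "card G \<le> card (s ` G \<times> (G \<inter> mult_ops))"
    using card_inj_on_le G(2) by blast
  also have "\<dots> = card (s ` G) * card (G \<inter> mult_ops)" by (rule card_cartesian_product)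
  also have "\<dots> \<le> field_degree K * card (G \<inter> mult_ops)"
    using card_automorphisms_le[of "s ` G"] s(1) G(2) by (intro mult_le_mono1) auto
  finally show ?thesis .
qed

text \<open>These four facts become the arithmetic hypotheses of \<open>weyl_cyclic\<close>. The
  last two hold since \<open>\<phi>\<close> injects the solutions of \<open>w ^ m = 1\<close> in
  \<open>D\<close> into the \<open>m\<close>-th roots of unity of the field.\<close>

theorem mult_op_preimage:
  assumes W: "group W" "finite (carrier W)" and \<phi>: "\<phi> \<in> hom W L" "inj_on \<phi> (carrier W)"
    and D: "D = {w \<in> carrier W. \<phi> w \<in> mult_ops}"
  shows "D \<lhd> W" and "card (carrier W) \<le> field_degree K * card D"
    and "0 < m \<Longrightarrow> card {w\<in>D. w [^]\<^bsub>W\<^esub> (m::nat) = \<one>\<^bsub>W\<^esub>} \<le> m"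
    and "field_degree K = 3 \<Longrightarrow> w \<in> D \<Longrightarrow> w [^]\<^bsub>W\<^esub> (3::nat) = \<one>\<^bsub>W\<^esub> \<Longrightarrow> w = \<one>\<^bsub>W\<^esub>"
proof -
  interpret L: group L by (rule group_L)
  interpret W: group W by (rule W(1))
  interpret \<phi>: group_hom W L \<phi> by (simp add: group_hom_def group_hom_axioms_def W L.group_axioms \<phi>)
  note M = subgroup.m_closed[OF subgroup_mult_ops] subgroup.m_inv_closed[OF subgroup_mult_ops]
  have "subgroup D W"
    using subgroup.one_closed[OF subgroup_mult_ops] M by (intro W.subgroupI) (auto simp: D intro: exI[of _ "\<one>\<^bsub>W\<^esub>"])
  then show "D \<lhd> W"
    using mult_ops_normal by (auto simp: W.normal_inv_iff D)
  have inj: "inj_on \<phi> A" if "A \<subseteq> D" for A using \<phi>(2) that by (auto simp: D intro: inj_on_subset)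
  have "\<phi> ` carrier W \<inter> mult_ops = \<phi> ` D" by (auto simp: D)
  then show "card (carrier W) \<le> field_degree K * card D"
    using card_le_mult_part[OF \<phi>.img_is_subgroup] W(2) card_image[OF \<phi>(2)] card_image[OF inj[OF subset_refl]] by simp
  have root: "\<exists>a\<in>carrier K - {\<zero>}. \<phi> w = mult_op K a \<and> a [^] m = \<one>"
    if w: "w \<in> D" "w [^]\<^bsub>W\<^esub> m = \<one>\<^bsub>W\<^esub>" for w and m :: nat
  proof -
    obtain a where a: "a \<in> carrier K - {\<zero>}" "\<phi> w = mult_op K a" using w(1) by (auto simp: D)
    have "\<phi> w [^]\<^bsub>L\<^esub> m = \<one>\<^bsub>L\<^esub>" using \<phi>.hom_nat_pow[of w m] w by (simp add: D)
    then show ?thesis using a mult_op_eq_iff[of "a [^] m" \<one>] by (auto simp: mult_op_pow mult_op_one)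
  qed
  show "card {w\<in>D. w [^]\<^bsub>W\<^esub> (m::nat) = \<one>\<^bsub>W\<^esub>} \<le> m" if m: "0 < m"
  proof -
    have "\<phi> ` {w\<in>D. w [^]\<^bsub>W\<^esub> m = \<one>\<^bsub>W\<^esub>} \<subseteq> mult_op K ` {x \<in> carrier K. x [^] m = \<one>}" using root by fastforce
    then have "card {w\<in>D. w [^]\<^bsub>W\<^esub> m = \<one>\<^bsub>W\<^esub>} \<le> card (mult_op K ` {x \<in> carrier K. x [^] m = \<one>})"
      using inj card_roots_of_unity(1)[OF m] by (intro card_inj_on_le) auto
    also have "\<dots> \<le> m" using card_roots_of_unity[OF m] card_image_le le_trans by blast
    finally show ?thesis .
  qed
  show "w = \<one>\<^bsub>W\<^esub>" if h: "field_degree K = 3" "w \<in> D" "w [^]\<^bsub>W\<^esub> (3::nat) = \<one>\<^bsub>W\<^esub>"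
  proof -
    obtain a where a: "a \<in> carrier K" "\<phi> w = mult_op K a" "a [^] (3::nat) = \<one>"
      using root[OF h(2,3)] by blast
    have "\<phi> w = \<phi> \<one>\<^bsub>W\<^esub>"
      unfolding a(2) cube_root_of_unity_cubic[OF h(1) a(1,3)] by (simp add: mult_op_one)
    moreover have "w \<in> carrier W" using h(2) by (simp add: D)
    ultimately show ?thesis using inj_onD[OF \<phi>(2)] W.one_closed by blast
  qed
qed

end

section \<open>Copies of subfields of the complex numbers\<close>

text \<open>A primitive \<open>m\<close>-th root of unity \<open>z\<close> and a nontrivial
  involutive automorphism that inverts it: multiplication by \<open>z\<close> and \<open>s\<close>
  then generate a dihedral group of order \<open>2 * m\<close> in L(K).\<close>

definition dih_data :: "('k, 'x) ring_scheme \<Rightarrow> nat \<Rightarrow> 'k \<Rightarrow> ('k \<Rightarrow> 'k) \<Rightarrow> bool" where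
  "dih_data K m z s \<longleftrightarrow> z \<in> carrier K \<and> s \<in> field_Aut K \<and> z [^]\<^bsub>K\<^esub> m = \<one>\<^bsub>K\<^esub> \<and>
     (\<forall>i. 0 < i \<longrightarrow> i < m \<longrightarrow> z [^]\<^bsub>K\<^esub> i \<noteq> \<one>\<^bsub>K\<^esub>) \<and> s z = z [^]\<^bsub>K\<^esub> (m - 1) \<and>
     (\<exists>x\<in>carrier K. s x \<noteq> x) \<and> (\<forall>x\<in>carrier K. s (s x) = x)"

abbreviation cplx_ring :: "complex set \<Rightarrow> complex ring" where
  "cplx_ring S \<equiv> ring_of_type_algebra \<lparr>carrier := S\<rparr>"

text \<open>Being an involution makes the map bijective, so these conditions describe a field
  automorphism of \<open>S\<close> when \<open>S\<close> is a field.\<close>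

definition cplx_involution :: "complex set \<Rightarrow> (complex \<Rightarrow> complex) \<Rightarrow> bool" where
  "cplx_involution S \<alpha> \<longleftrightarrow> (\<forall>x\<in>S. \<alpha> x \<in> S \<and> \<alpha> (\<alpha> x) = x) \<and> \<alpha> 1 = 1 \<and>
     (\<forall>x\<in>S. \<forall>y\<in>S. \<alpha> (x + y) = \<alpha> x + \<alpha> y \<and> \<alpha> (x * y) = \<alpha> x * \<alpha> y)"

abbreviation cplx :: "complex ring" where "cplx \<equiv> ring_of_type_algebra"

lemma subfield_cplx_iff:
  "subfield S cplx \<longleftrightarrow> 1 \<in> S \<and> (\<forall>x\<in>S. - x \<in> S \<and> inverse x \<in> S) \<and> (\<forall>x\<in>S. \<forall>y\<in>S. x + y \<in> S \<and> x * y \<in> S)"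
    (is "_ \<longleftrightarrow> ?closed")
proof -
  interpret R: field cplx by auto
  have m: "a_inv cplx x = - x" for x
    by (rule R.minus_equality) simp_all
  have i: "m_inv cplx x = inverse x" if "x \<noteq> 0" for x
    using R.comm_inv_char[of x "inverse x"] that by simp
  show ?thesis
  proof
    assume S: "subfield S cplx"
    note c = subringE[OF subfieldE(1)[OF S], simplified]
    have "inverse x \<in> S" if "x \<in> S" for x
      using R.subfield_m_inv(1)[OF S, of x] that c(2) i[of x] by (cases "x = 0") auto
    then show ?closed using c m by auto
  next
    assume ?closed
    then show "subfield S cplx" by (intro R.subfieldI' R.subringI) (auto simp: m i)
  qed
qed

lemma subfield_Rats: "subfield \<rat> cplx"
  by (simp add: subfield_cplx_iff)

lemma field_cplx_ring: "subfield S cplx \<Longrightarrow> field (cplx_ring S)"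
  by (rule ring.subfield_iff(2)) auto

text \<open>The fields are computed inside the complex numbers and then carried into the prescribed
  type \<open>'k\<close>. Injectivity is asked on \<open>S\<close> only, so that an infinite
  \<open>'k\<close> has room for a countable \<open>S\<close>.\<close>

locale complex_copy =
  fixes S :: "complex set" and f :: "complex \<Rightarrow> 'k" and n :: nat
  assumes S: "subfield S cplx" and inj: "inj_on f S" and Rats_subset: "\<rat> \<subseteq> S"
    and dim: "ring.dimension cplx n \<rat> S"
begin

abbreviation K :: "'k ring" where "K \<equiv> image_ring f (cplx_ring S)"

lemma iso: "f \<in> ring_iso (cplx_ring S) K"
  by (rule inj_imp_image_ring_iso) (simp add: inj)

lemma carrier_K: "carrier K = f ` S"
  by (simp add: image_ring_carrier)

lemma one_S: "1 \<in> S" and zero_S: "0 \<in> S"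
  using Rats_subset by auto

lemma add_S: "x \<in> S \<Longrightarrow> y \<in> S \<Longrightarrow> x + y \<in> S" and mult_S: "x \<in> S \<Longrightarrow> y \<in> S \<Longrightarrow> x * y \<in> S"
  using S by (auto simp: subfield_cplx_iff)

lemma minus_one_S: "-1 \<in> S"
  using Rats_subset by auto

lemma f_mult: "x \<in> S \<Longrightarrow> y \<in> S \<Longrightarrow> f x \<otimes>\<^bsub>K\<^esub> f y = f (x * y)"
  and f_add: "x \<in> S \<Longrightarrow> y \<in> S \<Longrightarrow> f x \<oplus>\<^bsub>K\<^esub> f y = f (x + y)"
  and f_one: "\<one>\<^bsub>K\<^esub> = f 1"
  using ring_iso_memE(2-4)[OF iso] by simp_all

lemma f_eq_iff: "x \<in> S \<Longrightarrow> y \<in> S \<Longrightarrow> f x = f y \<longleftrightarrow> x = y"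
  using inj by (auto simp: inj_on_def)

lemma field_K: "field K"
  by (rule field.inj_imp_image_ring_is_field[OF field_cplx_ring[OF S]]) (simp add: inj)

lemma pow_S: "z \<in> S \<Longrightarrow> z ^ m \<in> S"
  by (induction m) (simp_all add: one_S mult_S)

lemma f_pow: "z \<in> S \<Longrightarrow> f z [^]\<^bsub>K\<^esub> (m::nat) = f (z ^ m)"
proof (induction m)
  case (Suc m)
  then show ?case by (simp add: pow_S f_mult mult.commute)
qed (simp add: f_one)

lemma number_field_K: "number_field K" and degree_K: "field_degree K = n"
proof -
  interpret R: field cplx by auto
  interpret S: field "cplx_ring S" by (rule field_cplx_ring[OF S])
  interpret K: field K by (rule field_K)
  interpret h: ring_hom_ring "cplx_ring S" K f
    using iso by (intro ring_hom_ringI2 S.ring_axioms K.ring_axioms) (simp add: ring_iso_def)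
  have "of_rat \<in> ring_hom rat_ring (cplx_ring S)"
    using Rats_subset by (intro ring_hom_memI) (auto simp: of_rat_add of_rat_mult)
  then have g: "f \<circ> of_rat \<in> ring_hom rat_ring K" by (rule ring_hom_trans[OF _ h.homh])
  \<comment> \<open>Uniqueness of the embedding locates the rational subfield of the copy as the
    image of the rationals.\<close>
  have r: "rat_emb K = f \<circ> of_rat" by (rule K.rat_hom_unique[OF g])
  then have range: "range (rat_emb K) = f ` \<rat>" by (simp add: Rats_def image_comp)
  have "subfield \<rat> (cplx_ring S)"
    using field_cplx_ring[OF subfield_Rats] Rats_subset by (intro S.subfield_iff(1)) simp_all
  \<comment> \<open>Dimension is known in the ring of all complex numbers; a basis of
    \<open>S\<close> there is also one inside the subring \<open>S\<close>.\<close>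
  moreover have "S.dimension n \<rat> S"
  proof -
    obtain Us where Us: "R.independent \<rat> Us" "length Us = n" "R.Span \<rat> Us = S"
      using R.exists_base[OF subfield_Rats dim] by blast
    then have "set Us \<subseteq> S" using R.Span_base_incl[OF subfield_Rats, of Us] by simp
    with Us(1) have "S.independent \<rat> Us"
      by (induction rule: R.independent.induct) (auto simp: R.Span_consistent[OF subfieldE(1)[OF S]] intro: S.li_Cons)
    then show ?thesis
      using S.dimension_independent Us by (metis R.Span_consistent subfieldE(1) S)
  qed
  ultimately have d: "K.dimension n (range (rat_emb K)) (carrier K)"
    using h.inj_hom_dimension[OF _ _ inj] unfolding range carrier_K by simp
  show nf: "number_field K"
    by (intro number_field.intro number_field_axioms.intro K.field_axioms)
      (use g r K.finite_dimensionI[OF d] in simp_all)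
  show "field_degree K = n" by (rule number_field.field_degreeI[OF nf d])
qed

definition copy :: "(complex \<Rightarrow> complex) \<Rightarrow> 'k \<Rightarrow> 'k" where
  "copy \<alpha> = restrict (f \<circ> \<alpha> \<circ> inv_into S f) (carrier K)"

lemma copy_apply: "x \<in> S \<Longrightarrow> copy \<alpha> (f x) = f (\<alpha> x)"
  using inj by (simp add: copy_def carrier_K)

lemma copy_aut:
  assumes "cplx_involution S \<alpha>" shows "copy \<alpha> \<in> field_Aut K"
proof -
  have a: "\<And>x. x \<in> S \<Longrightarrow> \<alpha> x \<in> S" "\<And>x. x \<in> S \<Longrightarrow> \<alpha> (\<alpha> x) = x"
    using assms by (auto simp: cplx_involution_def)
  have "copy \<alpha> \<in> ring_iso K K"
  proof (rule ring_iso_memI)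
    show "bij_betw (copy \<alpha>) (carrier K) (carrier K)"
      by (rule bij_betw_byWitness[where f' = "copy \<alpha>"]) (auto simp: carrier_K copy_apply a)
  qed (use assms in \<open>auto simp: carrier_K copy_apply a f_mult f_add f_one mult_S add_S one_S cplx_involution_def\<close>)
  then show ?thesis by (simp add: field_Aut_def copy_def)
qed

lemma dih_data_copy:
  assumes \<alpha>: "cplx_involution S \<alpha>" and z: "z \<in> S" "z ^ m = 1" "\<And>i. 0 < i \<Longrightarrow> i < m \<Longrightarrow> z ^ i \<noteq> 1"
    "\<alpha> z = z ^ (m - 1)" and x: "x \<in> S" "\<alpha> x \<noteq> x"
  shows "dih_data K m (f z) (copy \<alpha>)"
  unfolding dih_data_def
  using copy_aut[OF \<alpha>] assms
  by (auto simp: carrier_K f_pow f_one f_eq_iff pow_S one_S copy_apply cplx_involution_def intro!: bexI[of _ x])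

end

subsection \<open>The fields generated by roots of unity of order 4, 3 and 12\<close>

lemma sqrt_3_irrational: "sqrt 3 \<notin> \<rat>"
proof
  assume "sqrt 3 \<in> \<rat>"
  then obtain m n :: nat where n: "n \<noteq> 0" and mn: "\<bar>sqrt 3\<bar> = real m / real n" and co: "coprime m n"
    by (rule Rats_abs_nat_div_natE)
  from n mn have "real m = sqrt 3 * real n" by simp
  then have "(real m)\<^sup>2 = 3 * (real n)\<^sup>2" by (simp add: power_mult_distrib)
  then have "real (m\<^sup>2) = real (3 * n\<^sup>2)" by simp
  then have eq: "m\<^sup>2 = 3 * n\<^sup>2" by (simp only: of_nat_eq_iff)
  have p: "Factorial_Ring.prime (3::nat)" by simp
  then have "3 dvd m" using eq Factorial_Ring.prime_dvd_power by (metis dvd_triv_left)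
  then obtain k where "m = 3 * k" by blast
  then have "n\<^sup>2 = 3 * k\<^sup>2" using eq by (simp add: power_mult_distrib)
  then have "3 dvd n" using p Factorial_Ring.prime_dvd_power by (metis dvd_triv_left)
  then show False using \<open>3 dvd m\<close> co by (metis coprime_common_divisor_nat numeral_eq_one_iff semiring_norm(86))
qed

definition adjoin :: "complex \<Rightarrow> complex set \<Rightarrow> complex set" where
  "adjoin v F = {k * v + u | k u. k \<in> F \<and> u \<in> F}"

lemma adjoinI: "k \<in> F \<Longrightarrow> u \<in> F \<Longrightarrow> k * v + u \<in> adjoin v F"
  by (auto simp: adjoin_def)

lemma adjoinE:
  assumes "x \<in> adjoin v F" obtains k u where "x = k * v + u" "k \<in> F" "u \<in> F"
  using assms by (auto simp: adjoin_def)

lemma countable_adjoin: "countable F \<Longrightarrow> countable (adjoin v F)"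
proof -
  assume F: "countable F"
  have "adjoin v F = (\<lambda>(k, u). k * v + u) ` (F \<times> F)" by (auto simp: adjoin_def)
  then show ?thesis using F by simp
qed

locale quadratic_extension =
  fixes F :: "complex set" and v :: complex
  assumes F: "subfield F cplx" and v: "v \<notin> F" "v * v \<in> F"
begin

lemma F_closed: "0 \<in> F" "1 \<in> F" "x \<in> F \<Longrightarrow> - x \<in> F" "x \<in> F \<Longrightarrow> inverse x \<in> F"
  "x \<in> F \<Longrightarrow> y \<in> F \<Longrightarrow> x + y \<in> F" "x \<in> F \<Longrightarrow> y \<in> F \<Longrightarrow> x * y \<in> F" "x \<in> F \<Longrightarrow> y \<in> F \<Longrightarrow> x - y \<in> F"
proof -
  note c = F[unfolded subfield_cplx_iff]
  then show "1 \<in> F" "x \<in> F \<Longrightarrow> - x \<in> F" "x \<in> F \<Longrightarrow> inverse x \<in> F" "x \<in> F \<Longrightarrow> y \<in> F \<Longrightarrow> x + y \<in> F"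
    "x \<in> F \<Longrightarrow> y \<in> F \<Longrightarrow> x * y \<in> F" by auto
  show d: "x \<in> F \<Longrightarrow> y \<in> F \<Longrightarrow> x - y \<in> F" for x y using c by (metis uminus_add_conv_diff add.commute)
  show "0 \<in> F" using d[of 1 1] c by simp
qed

lemma subset_adjoin: "F \<subseteq> adjoin v F"
  using adjoinI[OF F_closed(1)] by force

lemma v_adjoin: "v \<in> adjoin v F"
  using adjoinI[OF F_closed(2,1)] by force

lemma adjoin_unique:
  assumes "k \<in> F" "u \<in> F" "l \<in> F" "w \<in> F" "k * v + u = l * v + w" shows "k = l \<and> u = w"
proof -
  have "k = l"
  proof (rule ccontr)
    assume "k \<noteq> l"
    have "(k - l) * v = w - u" using assms(5) by (simp add: algebra_simps)
    then have "v = inverse (k - l) * (w - u)" using \<open>k \<noteq> l\<close> by (simp add: field_simps)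
    then show False using v(1) assms F_closed by simp
  qed
  then show ?thesis using assms by simp
qed

text \<open>The nontrivial automorphism over \<open>F\<close>. The description is proper on
  \<open>adjoin v F\<close> because coordinates are unique there.\<close>

definition vconj :: "complex \<Rightarrow> complex" where
  "vconj z = (THE w. \<exists>k\<in>F. \<exists>u\<in>F. z = k * v + u \<and> w = (- k) * v + u)"

lemma vconj_eq: "k \<in> F \<Longrightarrow> u \<in> F \<Longrightarrow> vconj (k * v + u) = (- k) * v + u"
  unfolding vconj_def by (rule the_equality) (use adjoin_unique in blast)+

lemma vconj_simps: "u \<in> F \<Longrightarrow> vconj u = u" "vconj v = - v"
  using vconj_eq[of 0 u] vconj_eq[of 1 0] F_closed by auto

lemma adjoin_mult: "(k * v + u) * (l * v + w) = (k * w + u * l) * v + (k * l * (v * v) + u * w)"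
  by (simp add: algebra_simps)

lemma subfield_adjoin: "subfield (adjoin v F) cplx"
proof -
  have add: "x + y \<in> adjoin v F" if xy: "x \<in> adjoin v F" "y \<in> adjoin v F" for x y
  proof -
    obtain k u l w where "x = k * v + u" "y = l * v + w" "k \<in> F" "u \<in> F" "l \<in> F" "w \<in> F"
      using xy by (elim adjoinE)
    moreover from this have "x + y = (k + l) * v + (u + w)" by (simp add: algebra_simps)
    ultimately show ?thesis using F_closed by (simp only: adjoinI)
  qed
  have mult: "x * y \<in> adjoin v F" if xy: "x \<in> adjoin v F" "y \<in> adjoin v F" for x y
  proof -
    obtain k u l w where "x = k * v + u" "y = l * v + w" "k \<in> F" "u \<in> F" "l \<in> F" "w \<in> F"
      using xy by (elim adjoinE)
    then show ?thesis using F_closed v(2) by (simp only: adjoin_mult adjoinI)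
  qed
  have uminus: "- x \<in> adjoin v F" if "x \<in> adjoin v F" for x
    using mult[OF _ that, of "-1"] subset_adjoin F_closed(2,3) by auto
  have "inverse x \<in> adjoin v F" if xF: "x \<in> adjoin v F" for x
  proof (cases "x = 0")
    case False
    obtain k u where x: "x = k * v + u" "k \<in> F" "u \<in> F" using xF by (rule adjoinE)
    \<comment> \<open>Rationalizing the denominator: \<open>y\<close> is the conjugate of
      \<open>x\<close>, and the norm \<open>N\<close> lies in \<open>F\<close>.\<close>
    define y where "y = (- k) * v + u"
    define N where "N = k * (- k) * (v * v) + u * u"
    have xy: "x * y = N" unfolding x(1) y_def N_def adjoin_mult by simp
    have "y \<noteq> 0"
    proof
      assume "y = 0"
      then have "- k = 0 \<and> u = 0" using adjoin_unique[of "- k" u 0 0] x F_closed by (simp add: y_def)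
      then show False using False x by simp
    qed
    then have "inverse x = y * inverse N" using False by (simp add: field_simps flip: xy)
    moreover have "y \<in> adjoin v F" unfolding y_def using x F_closed(3) by (intro adjoinI)
    moreover have "inverse N \<in> F" unfolding N_def using x v(2) by (simp add: F_closed)
    then have "inverse N \<in> adjoin v F" using subset_adjoin by blast
    ultimately show ?thesis using mult by simp
  qed (use subset_adjoin F_closed in auto)
  then show ?thesis using add mult uminus subset_adjoin F_closed by (auto simp: subfield_cplx_iff)
qed

lemma dimension_adjoin:
  assumes "ring.dimension cplx n \<rat> F" shows "ring.dimension cplx (n * 2) \<rat> (adjoin v F)"
proof -
  interpret R: field cplx by auto
  have "R.line_extension F v F = adjoin v F"
    using R.line_extension_mem_iff[of _ F v F] by (auto simp: adjoin_def)
  then have "R.dimension 2 F (adjoin v F)"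
    using R.Suc_dim[OF _ v(1) R.dimension_one[OF F]] by (simp add: numeral_2_eq_2)
  then show ?thesis by (rule R.telescopic_base[OF subfield_Rats F assms])
qed

lemma involution_vconj: "cplx_involution (adjoin v F) vconj"
proof -
  have "vconj x \<in> adjoin v F \<and> vconj (vconj x) = x" if "x \<in> adjoin v F" for x
    using that
  proof (rule adjoinE)
    fix k u assume x: "x = k * v + u" and ku: "k \<in> F" "u \<in> F"
    then have k: "- k \<in> F" using F_closed(3) by blast
    show ?thesis unfolding x vconj_eq[OF ku] vconj_eq[OF k ku(2)] using adjoinI[OF k ku(2)] by simp
  qed
  moreover have "vconj (x + y) = vconj x + vconj y \<and> vconj (x * y) = vconj x * vconj y"
    if xy: "x \<in> adjoin v F" "y \<in> adjoin v F" for x y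
  proof -
    obtain k u l w where e: "x = k * v + u" "y = l * v + w" and c: "k \<in> F" "u \<in> F" "l \<in> F" "w \<in> F"
      using xy by (elim adjoinE)
    have "x + y = (k + l) * v + (u + w)" by (simp add: e algebra_simps)
    then have s: "vconj (x + y) = (- (k + l)) * v + (u + w)"
      using vconj_eq[of "k + l" "u + w"] c F_closed by simp
    have p: "vconj (x * y) = (- (k * w + u * l)) * v + (k * l * (v * v) + u * w)"
      unfolding e adjoin_mult using c F_closed v(2) by (intro vconj_eq) simp_all
    have q: "vconj x = (- k) * v + u" "vconj y = (- l) * v + w"
      unfolding e using c by (simp_all only: vconj_eq)
    show ?thesis unfolding s p q by (simp add: algebra_simps)
  qed
  ultimately show ?thesis using vconj_simps(1) F_closed(2) by (simp add: cplx_involution_def)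
qed

end

abbreviation sqrt_m3 :: complex where "sqrt_m3 \<equiv> Complex 0 (sqrt 3)"
abbreviation Qi :: "complex set" where "Qi \<equiv> adjoin \<i> \<rat>"
abbreviation Q3 :: "complex set" where "Q3 \<equiv> adjoin sqrt_m3 \<rat>"
abbreviation Q12 :: "complex set" where "Q12 \<equiv> adjoin sqrt_m3 Qi"

lemma complex_of_rat: "of_rat r = Complex (of_rat r) 0"
  by (cases r) (simp add: of_rat_rat complex_eq_iff)

interpretation Qi: quadratic_extension \<rat> \<i>
  by (intro quadratic_extension.intro subfield_Rats) (auto simp: complex_of_rat complex_eq_iff elim!: Rats_cases)

lemma Re_Im_Qi: "z \<in> Qi \<Longrightarrow> Re z \<in> \<rat> \<and> Im z \<in> \<rat>"
  by (auto simp: adjoin_def complex_of_rat elim!: Rats_cases)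

lemma cnj_sqrt_m3: "cnj sqrt_m3 = - sqrt_m3"
  by (simp add: complex_eq_iff)

lemma sqrt_m3_square: "sqrt_m3 * sqrt_m3 = -3"
  by (simp add: complex_eq_iff)

lemma sqrt_m3_notin_Qi: "sqrt_m3 \<notin> Qi"
  using Re_Im_Qi[of sqrt_m3] sqrt_3_irrational by auto

interpretation Q3: quadratic_extension \<rat> sqrt_m3
  using sqrt_m3_notin_Qi Qi.subset_adjoin
  by (intro quadratic_extension.intro subfield_Rats) (auto simp: sqrt_m3_square simp del: complex_mult)

interpretation Q12: quadratic_extension Qi sqrt_m3
  using sqrt_m3_notin_Qi Qi.subset_adjoin
  by (intro quadratic_extension.intro Qi.subfield_adjoin) (auto simp: sqrt_m3_square simp del: complex_mult)

lemma dimension_Rats: "ring.dimension cplx 1 \<rat> \<rat>"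
proof -
  interpret R: field cplx by auto
  show ?thesis by (rule R.dimension_one[OF subfield_Rats])
qed

lemma cnj_Qi:
  assumes "z \<in> Qi" shows "cnj z \<in> Qi"
proof -
  obtain a b where "z = of_rat a * \<i> + of_rat b" using assms by (auto simp: adjoin_def elim!: Rats_cases)
  then have "cnj z = of_rat (- a) * \<i> + of_rat b" by (simp add: complex_of_rat complex_eq_iff of_rat_minus)
  then show ?thesis by (metis adjoinI Rats_of_rat)
qed

lemma cnj_vconj_Q12:
  assumes "z \<in> Q12" shows "cnj z \<in> Q12 \<and> Q12.vconj (cnj z) = cnj (Q12.vconj z)"
proof -
  obtain k u where z: "z = k * sqrt_m3 + u" and c: "k \<in> Qi" "u \<in> Qi" using assms by (auto simp: adjoin_def)
  have cz: "cnj z = (- cnj k) * sqrt_m3 + cnj u" by (simp add: z cnj_sqrt_m3)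
  have "- cnj k \<in> Qi" "cnj u \<in> Qi" using c cnj_Qi Q12.F_closed(3) by blast+
  then show ?thesis
    unfolding z cz[unfolded z] Q12.vconj_eq[OF c] using adjoinI Q12.vconj_eq[of "- cnj k" "cnj u"]
    by (simp only: complex_cnj_add complex_cnj_mult complex_cnj_minus cnj_sqrt_m3 minus_mult_minus minus_minus)
qed

text \<open>On \<open>Q12\<close>, \<open>vconj\<close> negates \<open>sqrt_m3\<close> and fixes
  \<open>\<i>\<close>, while \<open>cnj\<close> negates both; the composition negates only
  \<open>\<i>\<close> and hence fixes \<open>omega\<close>.\<close>

lemma involution_cnj_vconj: "cplx_involution Q12 (cnj \<circ> Q12.vconj)"
  using Q12.involution_vconj cnj_vconj_Q12 by (simp add: cplx_involution_def)

definition omega :: complex where "omega = Complex (- 1 / 2) (sqrt 3 / 2)"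

lemma omega_eq: "omega = (1 / 2) * sqrt_m3 + (- 1 / 2)" "cnj omega = (- (1 / 2)) * sqrt_m3 + (- 1 / 2)"
  by (simp_all add: omega_def complex_eq_iff)

lemma omega_powers: "omega ^ 2 = cnj omega" "omega ^ 3 = 1" "omega \<noteq> 1" "cnj omega \<noteq> 1" "cnj omega \<noteq> omega"
proof -
  show 2: "omega ^ 2 = cnj omega" by (simp add: omega_def power2_eq_square complex_eq_iff)
  have "omega ^ 3 = omega * omega ^ 2" by (simp add: eval_nat_numeral)
  also have "\<dots> = 1" unfolding 2 by (simp add: omega_def complex_eq_iff)
  finally show "omega ^ 3 = 1" .
qed (simp_all add: omega_def complex_eq_iff)

lemma half_Qi: "1 / 2 \<in> Qi" "- 1 / 2 \<in> Qi"
  using Qi.subset_adjoin by auto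

lemma omega_adjoin: "omega \<in> Q3" "omega \<in> Q12"
  unfolding omega_eq by (intro adjoinI half_Qi; simp)+

lemma vconj_omega: "Q3.vconj omega = cnj omega" "Q12.vconj omega = cnj omega"
  using Q3.vconj_eq[of "1 / 2" "- 1 / 2"] Q12.vconj_eq[OF half_Qi] unfolding omega_eq by (simp_all add: cnj_sqrt_m3)

lemma vconj_i: "Qi.vconj \<i> = - \<i>" "Q12.vconj \<i> = \<i>"
  using Qi.vconj_simps(2) Q12.vconj_simps(1)[OF Qi.v_adjoin] by simp_all

lemma order_cases:
  "0 < i \<Longrightarrow> i < 2 \<Longrightarrow> i = (1::nat)" "0 < i \<Longrightarrow> i < 3 \<Longrightarrow> i = 1 \<or> i = (2::nat)"
  "0 < i \<Longrightarrow> i < 4 \<Longrightarrow> i = 1 \<or> i = 2 \<or> i = (3::nat)"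
  "0 < i \<Longrightarrow> i < 6 \<Longrightarrow> i = 1 \<or> i = 2 \<or> i = 3 \<or> i = 4 \<or> i = (5::nat)"
  by linarith+

lemma exists_inj_on:
  assumes "infinite (UNIV :: 'k set)" "countable S" shows "\<exists>f :: complex \<Rightarrow> 'k. inj_on f S"
proof -
  obtain g :: "nat \<Rightarrow> 'k" where "inj g" using infinite_countable_subset[OF assms(1)] by blast
  then have "inj_on (g \<circ> to_nat_on S) S"
    using inj_on_to_nat_on[OF assms(2)] by (auto intro: comp_inj_on inj_on_subset)
  then show ?thesis by blast
qed

context
  assumes infinite_type: "infinite (UNIV :: 'k set)"
begin

lemma exists_field_1: "\<exists>K :: 'k ring. number_field K \<and> field_degree K = 1"
proof -
  obtain f :: "complex \<Rightarrow> 'k" where f: "inj_on f \<rat>" using exists_inj_on[OF infinite_type countable_rat] by blast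
  interpret complex_copy \<rat> f 1
    by (intro complex_copy.intro subfield_Rats f subset_refl dimension_Rats)
  show ?thesis using number_field_K degree_K by blast
qed

text \<open>The roots of unity are -1 and \<open>\<i>\<close> in Q(i) for m = 2 and 4, and
  \<open>omega\<close> and \<open>- omega\<close> in Q(sqrt(-3)) for m = 3 and 6. In each case the
  nontrivial automorphism inverts them.\<close>

lemma exists_field_2:
  assumes "m \<in> {2, 3, 4, 6}"
  shows "\<exists>(K :: 'k ring) z s. number_field K \<and> field_degree K = 2 \<and> dih_data K m z s"
proof -
  obtain f g :: "complex \<Rightarrow> 'k" where f: "inj_on f Qi" and g: "inj_on g Q3"
    using exists_inj_on[OF infinite_type countable_adjoin[OF countable_rat]] by metis
  interpret i: complex_copy Qi f 2
    using Qi.dimension_adjoin[OF dimension_Rats] by (intro complex_copy.intro f Qi.subfield_adjoin Qi.subset_adjoin) simp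
  interpret w: complex_copy Q3 g 2
    using Q3.dimension_adjoin[OF dimension_Rats] by (intro complex_copy.intro g Q3.subfield_adjoin Q3.subset_adjoin) simp
  note iQ = Qi.v_adjoin
  have mw: "- omega \<in> Q3"
  proof -
    have "- omega = omega ^ 2 + 1" using omega_powers(1) by (simp add: omega_def complex_eq_iff)
    then show ?thesis using w.add_S[OF w.pow_S[OF omega_adjoin(1)] w.one_S] by simp
  qed
  consider "m = 2" | "m = 3" | "m = 4" | "m = 6" using assms by blast
  then show ?thesis
  proof cases
    case 1
    have "dih_data i.K 2 (f (-1)) (i.copy Qi.vconj)"
      by (rule i.dih_data_copy[OF Qi.involution_vconj _ _ _ _ iQ])
        (auto simp: i.minus_one_S Qi.vconj_simps vconj_i complex_eq_iff dest!: order_cases(1))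
    then show ?thesis using i.number_field_K i.degree_K 1 by blast
  next
    case 2
    have "dih_data w.K 3 (g omega) (w.copy Q3.vconj)"
      by (rule w.dih_data_copy[OF Q3.involution_vconj omega_adjoin(1) _ _ _ omega_adjoin(1)])
        (auto simp: omega_powers vconj_omega dest!: order_cases(2))
    then show ?thesis using w.number_field_K w.degree_K 2 by blast
  next
    case 3
    have "dih_data i.K 4 (f \<i>) (i.copy Qi.vconj)"
      by (rule i.dih_data_copy[OF Qi.involution_vconj iQ _ _ _ iQ])
        (auto simp: vconj_i power3_eq_cube dest!: order_cases(3), simp_all add: eval_nat_numeral complex_eq_iff)
    then show ?thesis using i.number_field_K i.degree_K 3 by blast
  next
    case 4
    have p: "(- omega) ^ 2 = cnj omega" "(- omega) ^ 3 = -1" "(- omega) ^ 4 = omega" "(- omega) ^ 5 = - cnj omega"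
      "(- omega) ^ 6 = 1"
    proof -
      show 2: "(- omega) ^ 2 = cnj omega" using omega_powers(1) by simp
      show 3: "(- omega) ^ 3 = -1" using omega_powers(2) by simp
      have "(- omega) ^ 4 = (- omega) ^ 3 * (- omega)" by (simp add: eval_nat_numeral)
      then show "(- omega) ^ 4 = omega" unfolding 3 by simp
      have "(- omega) ^ 5 = (- omega) ^ 3 * (- omega) ^ 2" by (simp only: power_add[symmetric]) simp
      then show "(- omega) ^ 5 = - cnj omega" unfolding 2 3 by simp
      have "(- omega) ^ 6 = (- omega) ^ 3 * (- omega) ^ 3" by (simp only: power_add[symmetric]) simp
      then show "(- omega) ^ 6 = 1" unfolding 3 by simp
    qed
    have n: "- omega \<noteq> 1" "- cnj omega \<noteq> 1" by (simp_all add: omega_def complex_eq_iff)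
    have "dih_data w.K 6 (g (- omega)) (w.copy Q3.vconj)"
    proof (rule w.dih_data_copy[OF Q3.involution_vconj mw p(5) _ _ omega_adjoin(1)])
      show "(- omega) ^ i \<noteq> 1" if "0 < i" "i < 6" for i
        using order_cases(4)[OF that] p n omega_powers by (elim disjE) simp_all
      have e: "- omega = (- (1 / 2)) * sqrt_m3 + 1 / 2" by (simp add: omega_eq(1))
      have "Q3.vconj (- omega) = (- (- (1 / 2))) * sqrt_m3 + 1 / 2" unfolding e by (rule Q3.vconj_eq) auto
      also have "\<dots> = - cnj omega" by (simp add: omega_eq(2))
      finally have "Q3.vconj (- omega) = - cnj omega" .
      then show "Q3.vconj (- omega) = (- omega) ^ (6 - 1)" using p(4) by simp
      show "Q3.vconj omega \<noteq> omega" by (simp add: vconj_omega omega_powers)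
    qed
    then show ?thesis using w.number_field_K w.degree_K 4 by blast
  qed
qed

text \<open>In Q(i, sqrt(-3)) the automorphism negating only sqrt(-3) inverts \<open>omega\<close>
  and fixes \<open>\<i>\<close>; the one negating only \<open>\<i>\<close> inverts
  \<open>\<i>\<close> and fixes \<open>omega\<close>. For \<open>m = 2\<close> the root of unity
  \<open>\<i>\<close> is replaced by -1.\<close>

lemma exists_field_4:
  assumes "m \<in> {2, 4}"
  shows "\<exists>(K :: 'k ring) z s w t. number_field K \<and> field_degree K = 4 \<and> dih_data K 3 z s \<and> dih_data K m w t \<and>
    s w = w \<and> t z = z \<and> (\<forall>x\<in>carrier K. s (t x) = t (s x)) \<and> s \<noteq> t"
proof -
  obtain f :: "complex \<Rightarrow> 'k" where f: "inj_on f Q12"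
    using exists_inj_on[OF infinite_type countable_adjoin[OF countable_adjoin[OF countable_rat]]] by blast
  interpret c: complex_copy Q12 f 4
    using Q12.dimension_adjoin[OF Qi.dimension_adjoin[OF dimension_Rats]] Qi.subset_adjoin Q12.subset_adjoin
    by (intro complex_copy.intro f Q12.subfield_adjoin) auto
  let ?t = "cnj \<circ> Q12.vconj"
  have iQ: "\<i> \<in> Q12" using Qi.v_adjoin Q12.subset_adjoin by blast
  note mQ = c.minus_one_S
  have cQ: "Q12.vconj x \<in> Q12" "?t x \<in> Q12" if "x \<in> Q12" for x
    using that Q12.involution_vconj involution_cnj_vconj by (auto simp: cplx_involution_def)
  have 3: "dih_data c.K 3 (f omega) (c.copy Q12.vconj)"
    by (rule c.dih_data_copy[OF Q12.involution_vconj omega_adjoin(2) _ _ _ omega_adjoin(2)])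
      (auto simp: omega_powers vconj_omega dest!: order_cases(2))
  have m1: "Q12.vconj (-1) = -1" using Q12.vconj_simps(1) Q12.F_closed(2,3) by blast
  have com: "\<forall>x\<in>carrier c.K. c.copy Q12.vconj (c.copy ?t x) = c.copy ?t (c.copy Q12.vconj x)"
  proof
    fix x assume "x \<in> carrier c.K"
    then obtain y where y: "y \<in> Q12" "x = f y" by (auto simp: c.carrier_K)
    have "Q12.vconj (?t y) = ?t (Q12.vconj y)"
      using cnj_vconj_Q12[OF cQ(1)[OF y(1)]] by simp
    then show "c.copy Q12.vconj (c.copy ?t x) = c.copy ?t (c.copy Q12.vconj x)"
      using y cQ[OF y(1)] by (simp only: c.copy_apply)
  qed
  have ne: "c.copy Q12.vconj \<noteq> c.copy ?t"
  proof
    assume "c.copy Q12.vconj = c.copy ?t"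
    then have "f (Q12.vconj \<i>) = f (?t \<i>)" using c.copy_apply[OF iQ] by metis
    then have "Q12.vconj \<i> = ?t \<i>" using cQ[OF iQ] c.f_eq_iff by blast
    then show False by (simp add: vconj_i complex_eq_iff)
  qed
  have tw: "c.copy ?t (f omega) = f omega" using c.copy_apply[OF omega_adjoin(2)] by (simp add: vconj_omega)
  have ti: "?t \<i> \<noteq> \<i>" by (simp add: vconj_i complex_eq_iff)
  consider "m = 2" | "m = 4" using assms by blast
  then show ?thesis
  proof cases
    case 1
    have "dih_data c.K 2 (f (-1)) (c.copy ?t)"
      by (rule c.dih_data_copy[OF involution_cnj_vconj mQ _ _ _ iQ ti]) (auto simp: m1 dest!: order_cases(1))
    moreover have "c.copy Q12.vconj (f (-1)) = f (-1)" using c.copy_apply[OF mQ] by (simp add: m1)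
    ultimately show ?thesis using c.number_field_K c.degree_K 3 com ne tw 1 by blast
  next
    case 2
    have "dih_data c.K 4 (f \<i>) (c.copy ?t)"
    proof (rule c.dih_data_copy[OF involution_cnj_vconj iQ _ _ _ iQ ti])
      show "\<i> ^ k \<noteq> 1" if "0 < k" "k < 4" for k
        using order_cases(3)[OF that] by (elim disjE) (simp_all add: eval_nat_numeral complex_eq_iff)
    qed (simp_all add: vconj_i eval_nat_numeral complex_eq_iff)
    moreover have "c.copy Q12.vconj (f \<i>) = f \<i>" using c.copy_apply[OF iQ] by (simp add: vconj_i)
    ultimately show ?thesis using c.number_field_K c.degree_K 3 com ne tw 2 by blast
  qed
qed

end

subsection \<open>Dihedral subgroups\<close>

context number_field begin

lemma dih_data_nonzero:
  assumes "dih_data K m z s" "0 < m" shows "z \<in> carrier K - {\<zero>}"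
proof -
  have z: "z \<in> carrier K" "z [^] m = \<one>" using assms(1) by (auto simp: dih_data_def)
  have "z \<noteq> \<zero>"
  proof
    assume "z = \<zero>"
    then have "z [^] m = \<zero>" using assms(2) by (simp add: nat_pow_zero)
    then show False using z by simp
  qed
  then show ?thesis using z by simp
qed

abbreviation dih_embed :: "'a \<Rightarrow> ('a \<Rightarrow> 'a) \<Rightarrow> nat \<times> bool \<Rightarrow> 'a \<Rightarrow> 'a" where
  "dih_embed z s \<equiv> dih_map L (mult_op K z) s"

lemma dih_embedding:
  assumes d: "dih_data K m z s" and m: "0 < m"
  shows "dih_embed z s \<in> hom (dih m) L" "inj_on (dih_embed z s) (carrier (dih m))"
proof -
  interpret L: group "L_group K" by (rule group_L)
  have z: "z \<in> carrier K - {\<zero>}" by (rule dih_data_nonzero[OF d m])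
  have s: "s \<in> field_Aut K" and zm: "z [^] m = \<one>" and zi: "\<And>i. 0 < i \<Longrightarrow> i < m \<Longrightarrow> z [^] i \<noteq> \<one>"
    and sz: "s z = z [^] (m - 1)" and ex: "\<exists>x\<in>carrier K. s x \<noteq> x" and ss: "\<And>x. x \<in> carrier K \<Longrightarrow> s (s x) = x"
    using d by (auto simp: dih_data_def)
  have si: "s \<in> ring_iso K K" using s by (simp add: field_Aut_def)
  have gen: "s \<in> carrier L" "mult_op K z \<in> carrier L" using L_generators s z by auto
  have pow: "mult_op K z [^]\<^bsub>L\<^esub> i = mult_op K (z [^] i)" for i :: nat by (rule mult_op_pow[OF z])
  have zp: "z [^] i \<in> carrier K - {\<zero>}" for i :: nat using z by (induction i) (auto simp: integral_iff)
  have rm: "mult_op K z [^]\<^bsub>L\<^esub> m = \<one>\<^bsub>L\<^esub>" by (simp add: pow zm mult_op_one)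
  have s2: "s \<star> s = \<one>\<^bsub>L\<^esub>"
  proof (rule L_eqI)
    show "(s \<star> s) x = \<one>\<^bsub>L\<^esub> x" if "x \<in> carrier K" for x
      using gen ss that by (simp add: L_mult_apply L_one)
  qed (use gen in simp_all)
  have sr: "s \<star> mult_op K z = mult_op K z [^]\<^bsub>L\<^esub> (m - 1) \<star> s"
    unfolding pow
  proof (rule L_eqI)
    fix x assume x: "x \<in> carrier K"
    then show "(s \<star> mult_op K z) x = (mult_op K (z [^] (m - 1)) \<star> s) x"
      using gen z zp[of "m - 1"] ring_iso_memE(1,2)[OF si] sz
      by (simp add: L_mult_apply L_generators mult_op_apply L_closed)
  qed (use gen zp[of "m - 1"] L_generators in auto)
  show "dih_embed z s \<in> hom (dih m) L" by (rule L.dih_map_hom[OF gen(2,1) rm s2 sr])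
  show "inj_on (dih_embed z s) (carrier (dih m))"
  proof (rule L.dih_map_inj[OF gen(2,1) rm])
    fix i assume i: "0 < i" "i < m"
    show "mult_op K z [^]\<^bsub>L\<^esub> i \<noteq> \<one>\<^bsub>L\<^esub>"
      unfolding pow mult_op_one[symmetric] using mult_op_eq_iff[of "z [^] i" \<one>] zp[of i] zi[OF i] by simp
  next
    fix i :: nat
    show "s \<noteq> mult_op K z [^]\<^bsub>L\<^esub> i"
      unfolding pow
    proof
      \<comment> \<open>A multiplication operator that fixes \<open>\<one>\<close> is the identity,
        which \<open>s\<close> is not.\<close>
      assume e: "s = mult_op K (z [^] i)"
      have "s \<one> = z [^] i" unfolding e using zp[of i] by (simp add: mult_op_apply)
      then have "z [^] i = \<one>" using ring_iso_memE(4)[OF si] by simp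
      then have "s x = x" if "x \<in> carrier K" for x unfolding e using that by (simp add: mult_op_apply)
      then show False using ex by blast
    qed
  qed
qed

text \<open>The group of order two is realised by the signs, distinct because the characteristic is
  0.\<close>

lemma sign_embedding: "\<exists>g. g \<in> hom (dih 1) L \<and> inj_on g (carrier (dih 1))"
proof -
  interpret L: group "L_group K" by (rule group_L)
  have ne: "\<ominus> \<one> \<noteq> \<one>"
  proof
    assume "\<ominus> \<one> = \<one>"
    then have "\<one> \<oplus> \<one> = \<zero>" by (metis one_closed r_neg)
    then have "rat_emb K (1 + 1) = rat_emb K 0"
      using ring_hom_memE(3)[OF rat_emb_hom, of 1 1] ring_hom_zero[OF rat_emb_hom ring_from_type_algebra ring_axioms]
      by (simp add: rat_emb_one)
    then show False using rat_emb_inj by (simp add: inj_eq)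
  qed
  have c: "\<ominus> \<one> \<in> carrier K - {\<zero>}" by (metis Diff_iff a_inv_closed minus_zero one_closed one_not_zero singletonD minus_minus)
  let ?s = "mult_op K (\<ominus> \<one>)"
  have s: "?s \<in> carrier L" by (rule L_generators(2)[OF c])
  have "?s \<star> ?s = \<one>\<^bsub>L\<^esub>"
    using mult_op_mult[OF c c] by (simp add: l_minus mult_op_one)
  then have "dih_map L \<one>\<^bsub>L\<^esub> ?s \<in> hom (dih 1) L"
    using s by (intro L.dih_map_hom) simp_all
  moreover have "?s \<noteq> \<one>\<^bsub>L\<^esub>"
    using ne mult_op_eq_iff[of "\<ominus> \<one>" \<one>] by (simp add: mult_op_one[symmetric])
  then have "inj_on (dih_map L \<one>\<^bsub>L\<^esub> ?s) (carrier (dih 1))"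
    using s by (intro L.dih_map_inj) simp_all
  ultimately show ?thesis by blast
qed

lemma dih_embed_apply:
  assumes d: "dih_data K m z s" and m: "0 < m" and x: "x \<in> carrier K"
  shows "dih_embed z s (i, b) x = z [^] i \<otimes> (if b then s x else x)"
proof -
  interpret L: group "L_group K" by (rule group_L)
  have z: "z \<in> carrier K - {\<zero>}" by (rule dih_data_nonzero[OF d m])
  have s: "s \<in> field_Aut K" using d by (simp add: dih_data_def)
  have zp: "z [^] i \<in> carrier K - {\<zero>}" using z by (induction i) (auto simp: integral_iff)
  have c: "mult_op K (z [^] i) \<in> carrier L" "s \<in> carrier L"
    using L_generators s zp by auto
  then show ?thesis
    using x L_closed[OF c(2) x] by (cases b) (simp_all add: dih_map_def mult_op_pow[OF z] L_mult_apply mult_op_apply)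
qed

text \<open>The fourth and the ninth power separate the two factors of a product of a cube root and a
  fourth root of unity.\<close>

lemma dih_product_embedding:
  assumes zs: "dih_data K 3 z s" and wt: "dih_data K m w t" and m: "m \<in> {2, 4}"
    and sw: "s w = w" and tz: "t z = z" and com: "\<And>x. x \<in> carrier K \<Longrightarrow> s (t x) = t (s x)" and st: "s \<noteq> t"
  shows "\<exists>h. h \<in> hom (dih 3 \<times>\<times> dih m) L \<and> inj_on h (carrier (dih 3 \<times>\<times> dih m))"
proof -
  interpret L: group "L_group K" by (rule group_L)
  have m0: "0 < m" using m by auto
  have z: "z \<in> carrier K - {\<zero>}" and w: "w \<in> carrier K - {\<zero>}"
    using dih_data_nonzero[OF zs] dih_data_nonzero[OF wt m0] by simp_all
  have z3: "z [^] (3::nat) = \<one>" and s: "s \<in> field_Aut K" "\<And>x. x \<in> carrier K \<Longrightarrow> s (s x) = x" "\<exists>x\<in>carrier K. s x \<noteq> x"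
    using zs by (auto simp: dih_data_def)
  have wm: "w [^] m = \<one>" and t: "t \<in> field_Aut K" "\<And>x. x \<in> carrier K \<Longrightarrow> t (t x) = x" "\<exists>x\<in>carrier K. t x \<noteq> x"
    using wt by (auto simp: dih_data_def)
  \<comment> \<open>For \<open>m = 2\<close> too, \<open>w\<close> is a fourth root of unity, so one
    choice of exponents serves both cases.\<close>
  have w4: "w [^] (4::nat) = \<one>"
  proof -
    have "w [^] (4::nat) = (w [^] m) [^] (4 div m)" using w m by (auto simp: nat_pow_pow)
    then show ?thesis unfolding wm by (simp add: nat_pow_one)
  qed
  have si: "s \<in> ring_iso K K" and ti: "t \<in> ring_iso K K" using s t by (auto simp: field_Aut_def)
  interpret s: ring_hom_ring K K s by (rule hom_ring_hom_ring[OF aut_hom[OF si]])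
  interpret t: ring_hom_ring K K t by (rule hom_ring_hom_ring[OF aut_hom[OF ti]])
  have zp: "z [^] i \<in> carrier K - {\<zero>}" and wp: "w [^] i \<in> carrier K - {\<zero>}" for i :: nat
    using z w by (induction i) (auto simp: integral_iff)
  have sp: "s (w [^] i) = w [^] i" and tp: "t (z [^] i) = z [^] i" for i :: nat
    using s.hom_nat_pow[of w i] t.hom_nat_pow[of z i] z w sw tz by simp_all
  let ?f = "dih_embed z s" and ?g = "dih_embed w t"
  note f = dih_embedding[OF zs zero_less_numeral] and g = dih_embedding[OF wt m0]
  note fa = dih_embed_apply[OF zs zero_less_numeral] and ga = dih_embed_apply[OF wt m0]
  have fL: "?f p \<in> carrier L" if "p \<in> carrier (dih 3)" for p using hom_in_carrier[OF f(1)] that by simp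
  have gL: "?g q \<in> carrier L" if "q \<in> carrier (dih m)" for q using hom_in_carrier[OF g(1)] that by simp
  have sc: "s x \<in> carrier K" and tc: "t x \<in> carrier K" if "x \<in> carrier K" for x using that by auto
  have fg: "?f (i, b) (?g (j, c) x) = (z [^] i \<otimes> w [^] j) \<otimes> (if b then s (if c then t x else x) else if c then t x else x)"
    and gf: "?g (j, c) (?f (i, b) x) = (z [^] i \<otimes> w [^] j) \<otimes> (if b then s (if c then t x else x) else if c then t x else x)"
    if x: "x \<in> carrier K" for i j :: nat and b c x
  proof -
    have y: "(if c then t x else x) \<in> carrier K" "(if b then s x else x) \<in> carrier K" using x by auto
    have "w [^] j \<otimes> (if c then t x else x) \<in> carrier K" "z [^] i \<otimes> (if b then s x else x) \<in> carrier K"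
      using y zp[of i] wp[of j] by auto
    then show "?f (i, b) (?g (j, c) x) = (z [^] i \<otimes> w [^] j) \<otimes> (if b then s (if c then t x else x) else if c then t x else x)"
      "?g (j, c) (?f (i, b) x) = (z [^] i \<otimes> w [^] j) \<otimes> (if b then s (if c then t x else x) else if c then t x else x)"
      using x y zp[of i] wp[of j] com[OF x] sc[OF x] tc[OF x] sc[OF tc[OF x]]
      by (cases b; cases c; simp add: fa ga sp tp m_assoc m_lcomm)+
  qed
  have comm: "?f p \<star> ?g q = ?g q \<star> ?f p" if pq: "p \<in> carrier (dih 3)" "q \<in> carrier (dih m)" for p q
  proof (rule L_eqI)
    fix x assume "x \<in> carrier K"
    then show "(?f p \<star> ?g q) x = (?g q \<star> ?f p) x"
      using fL gL pq fg[of x] gf[of x] by (cases p; cases q) (simp add: L_mult_apply)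
  qed (use fL gL pq in auto)
  define h where "h = (\<lambda>(p, q). ?f p \<star> ?g q)"
  have "h \<in> hom (dih 3 \<times>\<times> dih m) L" unfolding h_def by (rule L.product_hom[OF f(1) g(1) comm])
  moreover have "inj_on h (carrier (dih 3 \<times>\<times> dih m))"
  proof (rule inj_onI)
    fix a a' assume "a \<in> carrier (dih 3 \<times>\<times> dih m)" "a' \<in> carrier (dih 3 \<times>\<times> dih m)" and e: "h a = h a'"
    then obtain p q p' q' where a: "a = (p, q)" "a' = (p', q')" "p \<in> carrier (dih 3)" "p' \<in> carrier (dih 3)"
      "q \<in> carrier (dih m)" "q' \<in> carrier (dih m)" by (auto simp: DirProd_def)
    obtain i b i' b' j c j' c' where p: "p = (i, b)" "p' = (i', b')" "q = (j, c)" "q' = (j', c')"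
      by (metis surj_pair)
    have "?f p (?g q x) = ?f p' (?g q' x)" if "x \<in> carrier K" for x
      using e that fL gL a by (metis (mono_tags, lifting) L_mult_apply case_prod_conv h_def)
    then have ex: "(z [^] i \<otimes> w [^] j) \<otimes> (if b then s (if c then t x else x) else if c then t x else x) =
      (z [^] i' \<otimes> w [^] j') \<otimes> (if b' then s (if c' then t x else x) else if c' then t x else x)"
      if "x \<in> carrier K" for x using fg that unfolding p by metis
    \<comment> \<open>Evaluating at \<open>\<one>\<close> removes the automorphisms and leaves only
      the roots of unity.\<close>
    have "s \<one> = \<one>" "t \<one> = \<one>" using ring_iso_memE(4)[OF si] ring_iso_memE(4)[OF ti] .
    then have u: "z [^] i \<otimes> w [^] j = z [^] i' \<otimes> w [^] j'"
      using ex[of \<one>] zp[of i] wp[of j] zp[of i'] wp[of j'] by (auto split: if_splits)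
    have p4: "(z [^] i \<otimes> w [^] j) [^] (4::nat) = z [^] i" for i j :: nat
    proof -
      have "(z [^] i \<otimes> w [^] j) [^] (4::nat) = (z [^] i) [^] (4::nat) \<otimes> (w [^] j) [^] (4::nat)"
        using zp[of i] wp[of j] by (simp add: nat_pow_distrib)
      also have "(w [^] j) [^] (4::nat) = (w [^] (4::nat)) [^] j" using w by (simp add: nat_pow_pow mult.commute)
      also have "(z [^] i) [^] (4::nat) = (z [^] (3::nat)) [^] i \<otimes> z [^] i"
        using z by (simp add: nat_pow_pow nat_pow_mult add.commute mult.commute)
      finally show ?thesis using zp[of i] z by (simp add: w4 z3 nat_pow_one)
    qed
    have p9: "(z [^] i \<otimes> w [^] j) [^] (9::nat) = w [^] j" for i j :: nat
    proof -
      have "(z [^] i \<otimes> w [^] j) [^] (9::nat) = (z [^] i) [^] (9::nat) \<otimes> (w [^] j) [^] (9::nat)"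
        using zp[of i] wp[of j] by (simp add: nat_pow_distrib)
      also have "(z [^] i) [^] (9::nat) = (z [^] (3::nat)) [^] (3 * i)" using z by (simp add: nat_pow_pow mult.commute)
      also have "(w [^] j) [^] (9::nat) = (w [^] (4::nat)) [^] (2 * j) \<otimes> w [^] j"
        using w by (simp add: nat_pow_pow nat_pow_mult add.commute mult.commute)
      finally show ?thesis using wp[of j] w by (simp add: w4 z3 nat_pow_one)
    qed
    have zi: "z [^] i = z [^] i'" and wj: "w [^] j = w [^] j'" using p4 p9 u by metis+
    have "?f (i, False) = ?f (i', False)" "?g (j, False) = ?g (j', False)"
      using zi wj mult_op_pow[OF z] mult_op_pow[OF w] by (simp_all add: dih_map_def)
    then have ij: "i = i'" "j = j'"
      using inj_onD[OF f(2), of "(i, False)" "(i', False)"] inj_onD[OF g(2), of "(j, False)" "(j', False)"] a p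
      by (auto simp: carrier_dih)
    have nz: "z [^] i \<otimes> w [^] j \<in> carrier K - {\<zero>}" using zp[of i] wp[of j] by (auto simp: integral_iff)
    have ex': "(if b then s (if c then t x else x) else if c then t x else x) =
      (if b' then s (if c' then t x else x) else if c' then t x else x)" if x: "x \<in> carrier K" for x
      using ex[OF x, folded ij] nz x m_lcancel[of "z [^] i \<otimes> w [^] j"] by auto
    \<comment> \<open>With the roots of unity cancelled, it remains to see that the four
      automorphisms \<open>id\<close>, \<open>s\<close>, \<open>t\<close> and
      \<open>s \<circ> t\<close> are pairwise different on \<open>K\<close>.\<close>
    have st': "\<exists>x\<in>carrier K. s x \<noteq> t x"
      using st s(1) t(1) extensionalityI[of s "carrier K" t] by (auto simp: field_Aut_def)
    have ex'': "\<forall>x\<in>carrier K. (if b then s (if c then t x else x) else if c then t x else x) =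
      (if b' then s (if c' then t x else x) else if c' then t x else x)" using ex' by blast
    have n1: "\<exists>x\<in>carrier K. s (t x) \<noteq> x" using st' s(2) tc by metis
    have n2: "\<exists>x\<in>carrier K. s (t x) \<noteq> s x" using t(3) s(2) tc by metis
    have n3: "\<exists>x\<in>carrier K. s (t x) \<noteq> t x" using s(3) t(2) sc tc com by metis
    have "b = b' \<and> c = c'"
      using ex'' n1 n2 n3 s(3) t(3) st'
      by (cases b; cases c; cases b'; cases c'; simp only: if_True if_False simp_thms) metis+
    then show "a = a'" using a p ij by simp
  qed
  ultimately show ?thesis by blast
qed

end

section \<open>Passing between subgroups of L(K) and types\<close>

text \<open>The model \<open>M\<close> enters as a bare multiplication with closure; the group laws
  come from \<open>W\<close>, through the composition of \<open>g\<close> with the inverse of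
  \<open>f\<close>.\<close>

lemma iso_subgroup_of_model:
  assumes f: "f \<in> iso M W" and g: "g \<in> hom M L" "inj_on g (carrier M)" and W: "group W" and L: "group L"
    and closed: "\<And>x y. x \<in> carrier M \<Longrightarrow> y \<in> carrier M \<Longrightarrow> x \<otimes>\<^bsub>M\<^esub> y \<in> carrier M"
  shows "\<exists>G. subgroup G L \<and> W \<cong> L\<lparr>carrier := G\<rparr>"
proof -
  define k where "k = inv_into (carrier M) f"
  have fb: "bij_betw f (carrier M) (carrier W)" and fh: "f \<in> hom M W" using f by (auto simp: iso_def)
  have kb: "bij_betw k (carrier W) (carrier M)" unfolding k_def by (rule bij_betw_inv_into[OF fb])
  have kc: "k x \<in> carrier M" "f (k x) = x" if "x \<in> carrier W" for x
    using that kb fb by (auto simp: k_def bij_betw_inv_into_right bij_betwE)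
  have km: "k (x \<otimes>\<^bsub>W\<^esub> y) = k x \<otimes>\<^bsub>M\<^esub> k y" if "x \<in> carrier W" "y \<in> carrier W" for x y
    unfolding k_def[of] using fb kc that closed hom_mult[OF fh]
    by (intro inv_into_f_eq) (auto simp: bij_betw_def k_def[symmetric])
  define h where "h = g \<circ> k"
  have hh: "h \<in> hom W L"
    using kc(1) km hom_in_carrier[OF g(1)] hom_mult[OF g(1)] by (intro homI) (simp_all add: h_def)
  have hi: "inj_on h (carrier W)"
    unfolding h_def using kb g(2) by (intro comp_inj_on) (auto simp: bij_betw_def)
  interpret h: group_hom W L h using W L hh by (simp add: group_hom_def group_hom_axioms_def)
  have "h \<in> iso W (L\<lparr>carrier := h ` carrier W\<rparr>)"
    using hh hi by (auto simp: iso_def hom_def bij_betw_def)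
  then show ?thesis using h.img_is_subgroup by (auto simp: is_iso_def)
qed

lemma DirProd_dih_closed:
  "x \<in> carrier (dih m \<times>\<times> dih k) \<Longrightarrow> y \<in> carrier (dih m \<times>\<times> dih k) \<Longrightarrow>
    x \<otimes>\<^bsub>dih m \<times>\<times> dih k\<^esub> y \<in> carrier (dih m \<times>\<times> dih k)"
  by (auto simp: DirProd_def dih_mult_closed)

lemma card_root_base:
  assumes "root_system R" "root_base R \<Delta>" shows "card \<Delta> = dim R"
proof -
  have "span R = UNIV" "independent \<Delta>" "span \<Delta> = UNIV"
    using assms by (auto simp: root_system_def root_base_def)
  then show ?thesis by (metis dim_eq_card_independent dim_span)
qed

text \<open>\<open>C\<close> is the preimage of the multiplication operators; the rank, being the
  size of a base, is matched with the degree.\<close>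

lemma weyl_cyclic_of_subgroup:
  assumes R: "root_system R" "reduced_roots R" and base: "root_base R \<Delta>"
    and K: "number_field K" "field_degree K = dim R"
    and G: "subgroup G (L_group K)" and \<phi>: "\<phi> \<in> iso (weyl_group R) (L_group K \<lparr>carrier := G\<rparr>)"
  shows "\<exists>C. weyl_cyclic R \<Delta> C"
proof -
  interpret number_field K by fact
  have hom: "\<phi> \<in> hom (weyl_group R) L" "inj_on \<phi> (carrier (weyl_group R))"
    using \<phi> subgroup.subset[OF G] by (auto simp: iso_def hom_def bij_betw_def)
  have fin: "finite (carrier (weyl_group R))"
    unfolding carrier_weyl_group by (rule finite_refl_group[OF R(1)])
  define D where "D = {w \<in> carrier (weyl_group R). \<phi> w \<in> mult_ops}"
  note D = mult_op_preimage[OF group_weyl_group fin hom D_def]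
  have pow: "w [^]\<^bsub>weyl_group R\<^esub> m = \<one>\<^bsub>weyl_group R\<^esub> \<longleftrightarrow> w ^^ m = id" if "w \<in> D" for w and m :: nat
    using that by (simp add: D_def carrier_weyl_group weyl_group_pow weyl_group_one)
  have "{w\<in>D. w [^]\<^bsub>weyl_group R\<^esub> m = \<one>\<^bsub>weyl_group R\<^esub>} = {w\<in>D. w ^^ m = id}" for m :: nat
    using pow by blast
  then have "weyl_cyclic R \<Delta> D"
    using D pow R base K(2) card_root_base[OF R(1) base]
    by (intro weyl_cyclic.intro) (simp_all add: carrier_weyl_group weyl_group_one)
  then show ?thesis by blast
qed

lemma (in weyl_cyclic) type_in_list:
  assumes "0 < card \<Delta>"
  shows "has_type R type_A1 \<or> has_type R type_A2 \<or> has_type R type_B2 \<or> has_type R type_G2 \<or>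
    has_type R (type_A1 \<boxplus> type_A1) \<or> has_type R (type_A1 \<boxplus> type_A1 \<boxplus> type_A2) \<or>
    has_type R (type_A2 \<boxplus> type_B2)"
proof -
  consider "card \<Delta> = 1" | "card \<Delta> = 2" | a b c d x y where "\<Delta> = {a, b, c, d}" "card \<Delta> = 4"
    "iso_pair \<Delta> a b" "root_pair a b 1 1" "c \<bullet> d = 0 \<or> root_pair c d x y \<and> x * y = 2"
    using base_classification assms by (metis One_nat_def Suc_leI le_SucE le_antisym numeral_2_eq_2)
  then show ?thesis
  proof cases
    case 1
    then obtain a where "\<Delta> = {a}" by (auto simp: card_1_singleton_iff)
    then show ?thesis using has_type_A1I base by blast
  next
    case 2
    then obtain a b where ab: "\<Delta> = {a, b}" "a \<noteq> b" by (meson card_2_iff)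
    then obtain x y where "root_pair a b x y" using exists_root_pair[of a b] by blast
    then show ?thesis using has_type_pairI base ab(1) by blast
  next
    case (3 a b c d x y)
    have dist: "c \<notin> {a, b}" "d \<notin> {a, b}" "c \<noteq> d"
      using 3(2) unfolding 3(1) by (auto simp: card_insert_if split: if_splits)
    have orth: "a \<bullet> c = 0" "a \<bullet> d = 0" "b \<bullet> c = 0" "b \<bullet> d = 0"
      using 3(3) dist unfolding iso_pair_def 3(1) by (auto simp: inner_commute)
    obtain u v where uv: "root_pair c d u v" "u * v = 0 \<or> u * v = 2"
    proof (cases "c \<bullet> d = 0")
      case True
      obtain u v where "root_pair c d u v" using exists_root_pair[of c d] dist 3(1) by blast
      then show ?thesis using that root_pair_orthogonal[OF _ True] by force
    next
      case False
      then show ?thesis using that 3(5) by blast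
    qed
    have base': "root_base R {a, b, c, d}" "card {a, b, c, d} = 4" using base 3 by simp_all
    show ?thesis using has_type_quadI[OF R base' 3(4) uv(1) orth] uv(2) by blast
  qed
qed

theorem theorem1:
  fixes R :: "'a::euclidean_space set" and n :: nat
  assumes "root_system R" and "reduced_roots R" and "n = dim R"
    and "infinite (UNIV :: 'k set)"
  shows "(\<exists>K :: 'k ring. number_field K \<and> field_degree K = n \<and>
            (\<exists>G. subgroup G (L_group K) \<and> weyl_group R \<cong> L_group K \<lparr>carrier := G\<rparr>))
    \<longleftrightarrow>
         (has_type R type_A1 \<or>
          has_type R type_A2 \<or>
          has_type R type_B2 \<or>
          has_type R type_G2 \<or>
          has_type R (type_A1 \<boxplus> type_A1) \<or>
          has_type R (type_A1 \<boxplus> type_A1 \<boxplus> type_A2) \<or>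
          has_type R (type_A2 \<boxplus> type_B2))"
    (is "?field \<longleftrightarrow> ?list")
proof
  note R = assms(1,2)
  assume ?field
  then obtain K :: "'k ring" and G \<phi> where K: "number_field K" "field_degree K = dim R"
    and G: "subgroup G (L_group K)" and \<phi>: "\<phi> \<in> iso (weyl_group R) (L_group K \<lparr>carrier := G\<rparr>)"
    using assms(3) by (auto simp: is_iso_def)
  obtain \<Delta> where base: "root_base R \<Delta>" using root_base_exists[OF R] by blast
  obtain C where "weyl_cyclic R \<Delta> C" using weyl_cyclic_of_subgroup[OF R base K G \<phi>] by blast
  then interpret weyl_cyclic R \<Delta> C .
  \<comment> \<open>A Euclidean space has positive dimension, so the rank is not 0.\<close>
  have "span \<Delta> \<noteq> {0}" using span_D UNIV_not_singleton by metis
  then have "\<Delta> \<noteq> {}" by auto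
  then have "0 < card \<Delta>" using fin_D by (simp add: card_gt_0_iff)
  then show ?list by (rule type_in_list)
next
  note R = assms(1,2)
  \<comment> \<open>The type of \<open>M\<close> stays general, since the models are dihedral groups
    and also products of two of them.\<close>
  have embed: ?field
    if "number_field K" "field_degree K = n" "f \<in> iso M (weyl_group R)" "g \<in> hom M (L_group K)"
      "inj_on g (carrier M)" "\<And>x y. x \<in> carrier M \<Longrightarrow> y \<in> carrier M \<Longrightarrow> x \<otimes>\<^bsub>M\<^esub> y \<in> carrier M"
    for K :: "'k ring" and M :: "'m monoid" and f g
    using iso_subgroup_of_model[OF that(3-5) group_weyl_group number_field.group_L[OF that(1)] that(6)] that(1,2)
    by blast
  assume ?list
  then consider "has_type R type_A1"
    | p :: nat where "has_type R type_A2 \<and> p = 1 \<or> has_type R type_B2 \<and> p = 2 \<or> has_type R type_G2 \<and> p = 3 \<or>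
        has_type R (type_A1 \<boxplus> type_A1) \<and> p = 0"
    | p :: nat where "has_type R (type_A1 \<boxplus> type_A1 \<boxplus> type_A2) \<and> p = 0 \<or> has_type R (type_A2 \<boxplus> type_B2) \<and> p = 2"
    by blast
  then show ?field
  proof cases
    case 1
    then obtain a where base: "root_base R {a}" using has_type_A1D by blast
    obtain f where f: "f \<in> iso (dih 1) (weyl_group R)" using weyl_iso_dih_1[OF R base] by blast
    have n: "n = 1" using card_root_base[OF R(1) base] assms(3) by simp
    obtain K :: "'k ring" where K: "number_field K" "field_degree K = 1"
      using exists_field_1[OF assms(4)] by blast
    obtain g where "g \<in> hom (dih 1) (L_group K)" "inj_on g (carrier (dih 1))"
      using number_field.sign_embedding[OF K(1)] by blast
    then show ?thesis using embed[OF K(1) _ f _ _ dih_mult_closed] K(2) n by simp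
  next
    case (2 p)
    then obtain a b x y where base: "root_base R {a, b}" and rp: "root_pair a b x y" and p: "x * y = int p"
      using has_type_pairD[OF R(1) 2] by blast
    obtain f where f: "f \<in> iso (dih (pair_order (x * y))) (weyl_group R)" using weyl_iso_dih[OF R base rp] by blast
    have m: "pair_order (x * y) \<in> {2, 3, 4, 6}" by (auto simp: pair_order_def)
    obtain K :: "'k ring" and z s where K: "number_field K" "field_degree K = 2" and d: "dih_data K (pair_order (x * y)) z s"
      using exists_field_2[OF assms(4) m] by blast
    have "a \<noteq> b" using rp by (simp add: root_pair_def)
    then have n: "n = 2" using card_root_base[OF R(1) base] assms(3) by simp
    have "0 < pair_order (x * y)" by (simp add: pair_order_def)
    from number_field.dih_embedding[OF K(1) d this] show ?thesis
      using embed[OF K(1) _ f _ _ dih_mult_closed] K(2) n by simp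
  next
    case (3 p)
    then obtain a b c d x y u v where base: "root_base R {a, b, c, d}" and ab: "root_pair a b x y" "x * y = 1"
      and cd: "root_pair c d u v" "u * v = int p" and disj: "{a, b} \<inter> {c, d} = {}"
      and orth: "a \<bullet> c = 0" "a \<bullet> d = 0" "b \<bullet> c = 0" "b \<bullet> d = 0"
      using has_type_quadD[OF R(1) 3] by (elim exE conjE) (rule that)
    define m where "m = pair_order (u * v)"
    have m: "m \<in> {2, 4}" using 3 cd(2) by (auto simp: m_def pair_order_def)
    obtain f where f: "f \<in> iso (dih 3 \<times>\<times> dih m) (weyl_group R)"
      using weyl_iso_dih_product[OF R base ab(1) cd(1) disj orth] ab(2) by (auto simp: m_def pair_order_def)
    obtain K :: "'k ring" and z s w t where K: "number_field K" "field_degree K = 4" and zs: "dih_data K 3 z s"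
      and wt: "dih_data K m w t" and st: "s w = w" "t z = z" "\<forall>x\<in>carrier K. s (t x) = t (s x)" "s \<noteq> t"
      using exists_field_4[OF assms(4) m] by blast
    obtain h where h: "h \<in> hom (dih 3 \<times>\<times> dih m) (L_group K)" "inj_on h (carrier (dih 3 \<times>\<times> dih m))"
      using number_field.dih_product_embedding[OF K(1) zs wt m st(1,2) _ st(4)] st(3) by blast
    have "a \<noteq> b" "c \<noteq> d" using ab cd by (simp_all add: root_pair_def)
    then have "card {a, b, c, d} = 4" using disj by auto
    then have "field_degree K = n" using card_root_base[OF R(1) base] assms(3) K(2) by simp
    then show ?thesis by (rule embed[OF K(1) _ f h DirProd_dih_closed])
  qed
qed

end
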